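(* Let $\mathbb{G}$ be a stratified Lie group of homogeneous dimension $Q$, let $0<\beta<1$ and let $b$ be a locally integrable function on $\mathbb{G}$. Let $\Phi,\Psi$ be Young functions with $\Phi\in\mathcal{Y}\cap\nabla_2$ and $\Psi^{-1}(t)\approx\Phi^{-1}(t)\,t^{-\beta/Q}$ (i.e. each side is bounded by a constant times the other, with constants independent of $t>0$). Then the following statements are equivalent. 1. $b\in\dot{\Lambda}_\beta(\mathbb{G})$ and $b\ge0$. 2. The commutator $[b,M^{\sharp}]$ is bounded from $L^\Phi(\mathbb{G})$ to $L^\Psi(\mathbb{G})$. 3. There exists a constant $C>0$ such that $$\sup_B |B|^{-\frac{\beta}{Q}}\,\Psi^{-1}\big(|B|^{-1}\big)\,\big\|b(\cdot)-2M^{\sharp}(b\,\chi_B)(\cdot)\big\|_{L^\Psi(B)}\le C.$$ 4. There exists a constant $C>0$ such that $$\sup_B |B|^{-1-\frac{\beta}{Q}}\,\big\|b(\cdot)-2M^{\sharp}(b\,\chi_B)(\cdot)\big\|_{L^1(B)}\le C.$$ Here the suprema are over all balls $B\subset\mathbb{G}$.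
   Context: **Stratified group.** $\mathbb{G}$ is the simply connected Lie group of a finite-dimensional real nilpotent Lie algebra $\mathcal{G}=V_1\oplus\cdots\oplus V_m$ with $[V_1,V_j]=V_{j+1}$ for $1\le j<m$ and $[V_1,V_m]=0$. The exponential map is a global diffeomorphism; dilations are $\delta_r(\exp\sum_j v_j)=\exp(\sum_j r^j v_j)$, $v_j\in V_j$, $r>0$. The homogeneous dimension is $Q=\sum_{j=1}^m j\dim V_j$. Haar measure $dx$ is the push-forward of Lebesgue measure by $\exp$; $|E|$ is the Haar measure of $E$. Fix a homogeneous norm $\rho:\mathbb{G}\to[0,\infty)$: continuous, $C^\infty$ away from the identity $e$, $\rho(x^{-1})=\rho(x)$, $\rho(\delta_t x)=t\rho(x)$ for $t>0$, $\rho(x)=0$ iff $x=e$, and $\rho(xy)\le c_0(\rho(x)+\rho(y))$ for some $c_0\ge1$. Balls are $B(x,r)=\{y\in\mathbb{G}:\rho(y^{-1}x)<r\}$, and $|B(x,r)|=c_1 r^Q$. **Young functions.** A Young function is a convex, left-continuous $\Phi:[0,\infty)\to[0,\infty]$ with $\lim_{r\to0+}\Phi(r)=\Phi(0)=0$ and $\lim_{r\to\infty}\Phi(r)=\infty$. $\mathcal{Y}$ is the set of Young functions with $0<\Phi(r)<\infty$ for $0<r<\infty$. $\Phi^{-1}(s)=\inf\{r\ge0:\Phi(r)>s\}$. $\Phi\in\nabla_2$ means: there is $C>1$ with $\Phi(r)\le\frac{1}{2C}\Phi(Cr)$ for all $r\ge0$. **Orlicz space.** $L^{\Phi}(\mathbb{G})$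 is the set of $f\in L^1_{\rm loc}(\mathbb{G})$ with $\int_{\mathbb{G}}\Phi(k|f(x)|)dx<\infty$ for some $k>0$, with norm $\|f\|_{L^\Phi(\mathbb{G})}=\inf\{\lambda>0:\int_{\mathbb{G}}\Phi(|f(x)|/\lambda)dx\le1\}$; $\|f\|_{L^\Phi(B)}=\|f\chi_B\|_{L^\Phi(\mathbb{G})}$. **Lipschitz space.** $b\in\dot{\Lambda}_\beta(\mathbb{G})$ means there is $C$ with $|b(x)-b(y)|\le C\rho(y^{-1}x)^\beta$ for all $x,y\in\mathbb{G}$. Locally integrable functions are identified when equal almost everywhere, so $b\in\dot\Lambda_\beta$ means $b$ agrees a.e. with such a function, and $b\ge0$ is meant a.e. **Sharp maximal operator.** $M^{\sharp}f(x)=\sup_{B\ni x}|B|^{-1}\int_B|f(y)-f_B|dy$, the supremum over all balls $B$ containing $x$, where $f_B=|B|^{-1}\int_B f(y)dy$. The commutator is $[b,M^{\sharp}]f(x)=b(x)M^{\sharp}f(x)-M^{\sharp}(bf)(x)$. **Boundedness.** A (possibly nonlinear) operator $T$ is bounded from $L^\Phi(\mathbb{G})$ to $L^\Psi(\mathbb{G})$ if there is $C$ such that for all $f\in L^\Phi(\mathbb{G})$, $Tf$ is well defined a.e. and $\|Tf\|_{L^\Psi(\mathbb{G})}\le C\|f\|_{L^\Phi(\mathbb{G})}$. *)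

theory Defs
  imports "HOL-Analysis.Analysis" "HOL-Algebra.Group"
begin

section \<open>Smooth maps\<close>

text \<open>
  \<open>Ck_on k f S\<close> is used for open \<open>S\<close> in finite-dimensional spaces, where it says that \<open>f\<close> is of
  class \<open>C^k\<close> on \<open>S\<close>: all iterated directional derivatives up to order \<open>k\<close> exist and are continuous.
\<close>

primrec Ck_on ::
    "nat \<Rightarrow> ('a::real_normed_vector \<Rightarrow> 'b::real_normed_vector) \<Rightarrow> 'a set \<Rightarrow> bool" where
  "Ck_on 0 f S \<longleftrightarrow> continuous_on S f"
| "Ck_on (Suc k) f S \<longleftrightarrow>
     (\<forall>x\<in>S. f differentiable (at x)) \<and>
     (\<forall>v. Ck_on k (\<lambda>x. frechet_derivative f (at x) v) S)"

definition smooth_on ::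
    "('a::real_normed_vector \<Rightarrow> 'b::real_normed_vector) \<Rightarrow> 'a set \<Rightarrow> bool" where
  "smooth_on f S \<longleftrightarrow> (\<forall>k. Ck_on k f S)"


section \<open>Stratified groups\<close>

locale lie_algebra =
  fixes bracket :: "'a::euclidean_space \<Rightarrow> 'a \<Rightarrow> 'a"
  assumes bilinear_bracket: "bilinear bracket"
    and bracket_self: "bracket x x = 0"
    and jacobi: "bracket x (bracket y z) + bracket y (bracket z x) + bracket z (bracket x y) = 0"

text \<open>
  The stratification \<open>V 1 \<oplus> \<dots> \<oplus> V m\<close>. The values of \<open>V\<close> outside \<open>{1..m}\<close> play no role.
  Nilpotency of the Lie algebra is a consequence.
\<close>

locale stratified_lie_algebra = lie_algebra bracket
  for bracket :: "'a::euclidean_space \<Rightarrow> 'a \<Rightarrow> 'a" +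
  fixes V :: "nat \<Rightarrow> 'a set" and m :: nat
  assumes m_pos: "1 \<le> m"
    and subspace_layer: "j \<in> {1..m} \<Longrightarrow> subspace (V j)"
    and direct_sum: "\<exists>!v. v \<in> (\<Pi>\<^sub>E j\<in>{1..m}. V j) \<and> x = (\<Sum>j=1..m. v j)"
    and bracket_layer: "1 \<le> j \<Longrightarrow> j < m \<Longrightarrow>
        span {bracket x y | x y. x \<in> V 1 \<and> y \<in> V j} = V (Suc j)"
    and bracket_top: "x \<in> V 1 \<Longrightarrow> y \<in> V m \<Longrightarrow> bracket x y = 0"

definition homogeneous_dim :: "(nat \<Rightarrow> 'a::euclidean_space set) \<Rightarrow> nat \<Rightarrow> nat" where
  "homogeneous_dim V m = (\<Sum>j=1..m. j * dim (V j))"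

definition layer_components ::
    "(nat \<Rightarrow> 'a::euclidean_space set) \<Rightarrow> nat \<Rightarrow> 'a \<Rightarrow> nat \<Rightarrow> 'a" where
  "layer_components V m x = (THE v. v \<in> (\<Pi>\<^sub>E j\<in>{1..m}. V j) \<and> x = (\<Sum>j=1..m. v j))"

definition dilation ::
    "(nat \<Rightarrow> 'a::euclidean_space set) \<Rightarrow> nat \<Rightarrow> real \<Rightarrow> 'a \<Rightarrow> 'a" where
  "dilation V m r x = (\<Sum>j=1..m. r ^ j *\<^sub>R layer_components V m x j)"

text \<open>
  The simply connected Lie group of a nilpotent Lie algebra is written in exponential coordinates:
  since the exponential map is a global diffeomorphism, the group is taken to be the vector space
  of the Lie algebra itself, with exponential map the identity. The tangent space at the neutral
  element (which is \<open>0\<close>) is then the same vector space, \<open>left_invariant_field G X\<close> is the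
  left-invariant vector field with value \<open>X\<close> at the neutral element, and the Lie bracket of
  vector fields is \<open>[X, Y] = DY \<cdot> X - DX \<cdot> Y\<close>.
\<close>

definition left_invariant_field :: "'a::euclidean_space monoid \<Rightarrow> 'a \<Rightarrow> 'a \<Rightarrow> 'a" where
  "left_invariant_field G X p = frechet_derivative (\<lambda>y. p \<otimes>\<^bsub>G\<^esub> y) (at \<one>\<^bsub>G\<^esub>) X"

text \<open>
  \<open>exp_one_parameter\<close> says that the one-parameter subgroup with initial velocity \<open>x\<close> is
  \<open>t \<mapsto> t *\<^sub>R x\<close>, i.e. that the exponential map is the identity; \<open>bracket_eq\<close> says that the Lie
  algebra of the group is the given one.
\<close>

locale stratified_group = stratified_lie_algebra bracket V m + group G
  for G :: "'a::euclidean_space monoid" and bracket :: "'a \<Rightarrow> 'a \<Rightarrow> 'a"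
    and V :: "nat \<Rightarrow> 'a set" and m :: nat +
  assumes carrier_UNIV: "carrier G = UNIV"
    and smooth_mult: "smooth_on (\<lambda>(x, y). x \<otimes>\<^bsub>G\<^esub> y) UNIV"
    and smooth_inv: "smooth_on (\<lambda>x. inv\<^bsub>G\<^esub> x) UNIV"
    and exp_one_parameter: "(s *\<^sub>R x) \<otimes>\<^bsub>G\<^esub> (t *\<^sub>R x) = (s + t) *\<^sub>R x"
    and bracket_eq: "bracket X Y =
        frechet_derivative (left_invariant_field G Y) (at \<one>\<^bsub>G\<^esub>) (left_invariant_field G X \<one>\<^bsub>G\<^esub>) -
        frechet_derivative (left_invariant_field G X) (at \<one>\<^bsub>G\<^esub>) (left_invariant_field G Y \<one>\<^bsub>G\<^esub>)"

definition homogeneous_norm ::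
    "'a::euclidean_space monoid \<Rightarrow> (nat \<Rightarrow> 'a set) \<Rightarrow> nat \<Rightarrow> ('a \<Rightarrow> real) \<Rightarrow> bool" where
  "homogeneous_norm G V m \<rho> \<longleftrightarrow>
     (\<forall>x. 0 \<le> \<rho> x) \<and>
     continuous_on UNIV \<rho> \<and>
     smooth_on \<rho> (- {\<one>\<^bsub>G\<^esub>}) \<and>
     (\<forall>x. \<rho> (inv\<^bsub>G\<^esub> x) = \<rho> x) \<and>
     (\<forall>x. \<forall>t>0. \<rho> (dilation V m t x) = t * \<rho> x) \<and>
     (\<forall>x. \<rho> x = 0 \<longleftrightarrow> x = \<one>\<^bsub>G\<^esub>) \<and>
     (\<exists>c0\<ge>1. \<forall>x y. \<rho> (x \<otimes>\<^bsub>G\<^esub> y) \<le> c0 * (\<rho> x + \<rho> y))"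

definition group_ball ::
    "'a::euclidean_space monoid \<Rightarrow> ('a \<Rightarrow> real) \<Rightarrow> 'a \<Rightarrow> real \<Rightarrow> 'a set" where
  "group_ball G \<rho> x r = {y. \<rho> (inv\<^bsub>G\<^esub> y \<otimes>\<^bsub>G\<^esub> x) < r}"

definition group_balls :: "'a::euclidean_space monoid \<Rightarrow> ('a \<Rightarrow> real) \<Rightarrow> 'a set set" where
  "group_balls G \<rho> = {group_ball G \<rho> x r | x r. 0 < r}"


section \<open>Young functions and Orlicz spaces\<close>

text \<open>
  A Young function \<open>[0,\<infinity>) \<rightarrow> [0,\<infinity>]\<close> is represented by a function on \<^typ>\<open>real\<close> whose values at
  negative arguments are irrelevant.
\<close>

definition young_function :: "(real \<Rightarrow> ennreal) \<Rightarrow> bool" where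
  "young_function \<Phi> \<longleftrightarrow>
     (\<forall>r\<ge>0. \<forall>s\<ge>0. \<forall>t\<in>{0..1}.
        \<Phi> ((1 - t) * r + t * s) \<le> ennreal (1 - t) * \<Phi> r + ennreal t * \<Phi> s) \<and>
     (\<forall>r>0. (\<Phi> \<longlongrightarrow> \<Phi> r) (at_left r)) \<and>
     \<Phi> 0 = 0 \<and>
     (\<Phi> \<longlongrightarrow> 0) (at_right 0) \<and>
     (\<Phi> \<longlongrightarrow> \<infinity>) at_top"

definition young_Y :: "(real \<Rightarrow> ennreal) set" where
  "young_Y = {\<Phi>. young_function \<Phi> \<and> (\<forall>r>0. 0 < \<Phi> r \<and> \<Phi> r < \<infinity>)}"

definition nabla2 :: "(real \<Rightarrow> ennreal) \<Rightarrow> bool" where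
  "nabla2 \<Phi> \<longleftrightarrow> (\<exists>C>1. \<forall>r\<ge>0. \<Phi> r \<le> ennreal (1 / (2 * C)) * \<Phi> (C * r))"

text \<open>
  Only used for finite \<open>s \<ge> 0\<close>, where the set is nonempty because \<open>\<Phi>\<close> tends to \<open>\<infinity>\<close>.
\<close>

definition young_inverse :: "(real \<Rightarrow> ennreal) \<Rightarrow> real \<Rightarrow> real" where
  "young_inverse \<Phi> s = Inf {r. 0 \<le> r \<and> ennreal s < \<Phi> r}"

definition locally_integrable :: "('a::euclidean_space \<Rightarrow> real) \<Rightarrow> bool" where
  "locally_integrable f \<longleftrightarrow> (\<forall>K. compact K \<longrightarrow> set_integrable lebesgue K f)"

definition orlicz_space :: "(real \<Rightarrow> ennreal) \<Rightarrow> ('a::euclidean_space \<Rightarrow> real) set" where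
  "orlicz_space \<Phi> =
     {f. locally_integrable f \<and> (\<exists>k>0. (\<integral>\<^sup>+x. \<Phi> (k * \<bar>f x\<bar>) \<partial>lebesgue) < \<infinity>)}"

text \<open>Equal to \<open>\<infinity>\<close> when there is no admissible \<open>l\<close>.\<close>

definition orlicz_norm :: "(real \<Rightarrow> ennreal) \<Rightarrow> ('a::euclidean_space \<Rightarrow> real) \<Rightarrow> ennreal" where
  "orlicz_norm \<Phi> f =
     Inf {ennreal l | l. 0 < l \<and> (\<integral>\<^sup>+x. \<Phi> (\<bar>f x\<bar> / l) \<partial>lebesgue) \<le> 1}"

definition orlicz_norm_on ::
    "(real \<Rightarrow> ennreal) \<Rightarrow> 'a set \<Rightarrow> ('a::euclidean_space \<Rightarrow> real) \<Rightarrow> ennreal" where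
  "orlicz_norm_on \<Phi> B f = orlicz_norm \<Phi> (\<lambda>x. f x * indicator B x)"


section \<open>Lipschitz functions and the sharp maximal operator\<close>

text \<open>Membership is a property of the class of \<open>b\<close> modulo equality almost everywhere.\<close>

definition lipschitz_space ::
    "'a::euclidean_space monoid \<Rightarrow> ('a \<Rightarrow> real) \<Rightarrow> real \<Rightarrow> ('a \<Rightarrow> real) set" where
  "lipschitz_space G \<rho> \<beta> =
     {b. \<exists>b' C. (AE x in lebesgue. b x = b' x) \<and>
           (\<forall>x y. \<bar>b' x - b' y\<bar> \<le> C * \<rho> (inv\<^bsub>G\<^esub> y \<otimes>\<^bsub>G\<^esub> x) powr \<beta>)}"

definition average :: "('a::euclidean_space \<Rightarrow> real) \<Rightarrow> 'a set \<Rightarrow> real" where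
  "average f B = (LINT y:B|lebesgue. f y) / measure lebesgue B"

definition sharp_max ::
    "'a::euclidean_space monoid \<Rightarrow> ('a \<Rightarrow> real) \<Rightarrow> ('a \<Rightarrow> real) \<Rightarrow> 'a \<Rightarrow> ennreal" where
  "sharp_max G \<rho> f x =
     (SUP B\<in>{B \<in> group_balls G \<rho>. x \<in> B}.
        (\<integral>\<^sup>+y\<in>B. ennreal \<bar>f y - average f B\<bar> \<partial>lebesgue) / emeasure lebesgue B)"

text \<open>
  The following two functions are meaningful at points where the sharp maximal functions involved
  are finite. For the commutator this is part of the definition of boundedness below. For the
  oscillation on a ball it holds almost everywhere whenever \<open>b\<close> is locally integrable, by the weak
  type (1,1) bound for the maximal function of the integrable function \<open>b\<close> times the indicator of \<open>B\<close>.
\<close>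

definition sharp_commutator ::
    "'a::euclidean_space monoid \<Rightarrow> ('a \<Rightarrow> real) \<Rightarrow> ('a \<Rightarrow> real) \<Rightarrow> ('a \<Rightarrow> real) \<Rightarrow> 'a \<Rightarrow> real" where
  "sharp_commutator G \<rho> b f x =
     b x * enn2real (sharp_max G \<rho> f x) - enn2real (sharp_max G \<rho> (\<lambda>y. b y * f y) x)"

definition sharp_osc ::
    "'a::euclidean_space monoid \<Rightarrow> ('a \<Rightarrow> real) \<Rightarrow> ('a \<Rightarrow> real) \<Rightarrow> 'a set \<Rightarrow> 'a \<Rightarrow> real" where
  "sharp_osc G \<rho> b B x = b x - 2 * enn2real (sharp_max G \<rho> (\<lambda>y. b y * indicator B y) x)"

text \<open>
  The first conjunct inside the quantifier says that \<open>M\<^sup>#(bf)\<close> makes sense, the next two that the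
  commutator is well defined almost everywhere.
\<close>

definition sharp_commutator_bounded ::
    "'a::euclidean_space monoid \<Rightarrow> ('a \<Rightarrow> real) \<Rightarrow> ('a \<Rightarrow> real) \<Rightarrow>
     (real \<Rightarrow> ennreal) \<Rightarrow> (real \<Rightarrow> ennreal) \<Rightarrow> bool" where
  "sharp_commutator_bounded G \<rho> b \<Phi> \<Psi> \<longleftrightarrow>
     (\<exists>C::real. \<forall>f\<in>orlicz_space \<Phi>.
        locally_integrable (\<lambda>x. b x * f x) \<and>
        (AE x in lebesgue. sharp_max G \<rho> f x < \<infinity>) \<and>
        (AE x in lebesgue. sharp_max G \<rho> (\<lambda>y. b y * f y) x < \<infinity>) \<and>
        orlicz_norm \<Psi> (sharp_commutator G \<rho> b f) \<le> ennreal C * orlicz_norm \<Phi> f)"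

end

theory Submission
  imports Defs
begin

text \<open>
  The four statements are proved in a circle.

  Only the following features of the group enter the analysis: the function
  \<open>d x y = \<rho> (y\<inverse> x)\<close> is a quasi-metric, its balls are open and bounded, and a ball of radius \<open>r\<close>
  has volume \<open>c1 r\<^sup>Q\<close>. They are collected in the locale \<open>ball_geometry\<close>. The volume of a ball is the
  part that needs Lie theory. In exponential coordinates the differential at the identity of the
  left translation by \<open>p\<close> inverts the series \<open>(1 - exp (- ad p)) / ad p\<close>: along the line
  through \<open>p\<close> the error in this identity solves a linear differential equation and is zero at the
  identity (\<open>lfield_exp_factor\<close>).
  The dilations are automorphisms of the Lie algebra, so the determinant of this series has the same
  value at \<open>p\<close> and at \<open>\<delta>\<^sub>r p\<close>; letting \<open>r \<rightarrow> 0\<close> gives the value \<open>1\<close>. Hence left translations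
  preserve Lebesgue measure, and the dilation \<open>\<delta>\<^sub>r\<close> scales it by \<open>r\<^sup>Q\<close>.

  \<^item> Suppose \<open>b \<ge> 0\<close> is Lipschitz of order \<open>\<beta>\<close>. Since \<open>b x \<ge> 0\<close>, the product \<open>b x * M\<^sup># f x\<close> is the
    sharp maximal function of \<open>b x * f\<close>, and replacing the constant \<open>b x\<close> by the function \<open>b\<close> inside
    a ball of radius \<open>r\<close> changes the mean oscillation by at most a multiple of \<open>r\<^sup>\<beta>\<close> times the
    average of \<open>\<bar>f\<bar>\<close> (\<open>osc_freeze\<close>). So the commutator is dominated by the fractional maximal function.
    Hedberg's argument (\<open>fractional_average_le\<close>) bounds the latter by
    \<open>\<Psi>\<inverse> (\<Phi> (M f / L))\<close> up to a constant, where \<open>M\<close> is the Hardy-Littlewood maximal function,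
    and \<open>M\<close> is bounded on \<open>L\<^sup>\<Phi>\<close> by the weak type inequality and the condition \<open>\<nabla>\<^sub>2\<close>
    (\<open>modular_maxfun\<close>).
  \<^item> Test a bounded commutator on the indicator of a ball \<open>B\<close>. On \<open>B\<close> the sharp maximal function of
    this indicator is \<open>1/2\<close>, so there \<open>b - 2 M\<^sup>#(b \<chi>\<^sub>B)\<close> is twice the commutator.
  \<^item> The Orlicz norm controls the \<open>L\<^sup>1\<close> norm on a ball by Hoelder's inequality (\<open>orlicz_average_le\<close>).
  \<^item> Finally \<open>\<bar>b\<^sub>B\<bar> \<le> 2 M\<^sup>#(b \<chi>\<^sub>B)\<close> on \<open>B\<close>, as the concentric ball of twice the volume shows
    (\<open>abs_average_le_osc\<close>). Where \<open>b < \<bar>b\<^sub>B\<bar>\<close> the difference \<open>\<bar>b\<^sub>B\<bar> - b\<close> is therefore at most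
    \<open>\<bar>b - 2 M\<^sup>#(b \<chi>\<^sub>B)\<bar>\<close>. This bounds both the mean oscillation of \<open>b\<close> on \<open>B\<close> and the number
    \<open>\<bar>b\<^sub>B\<bar> - b\<^sub>B\<close> by a multiple of \<open>r\<^sup>\<beta>\<close> (\<open>sharp_osc_controls\<close>). The first bound makes \<open>b\<close>
    Lipschitz by Campanato's theorem (\<open>campanato\<close>), the second makes it nonnegative as \<open>r \<rightarrow> 0\<close>.
\<close>

section \<open>Volume and linear maps on a Euclidean space\<close>

text \<open>
  A type with one element for each basis vector, so that \<open>real^'a basis_index\<close> is a copy of \<open>'a\<close>
  on which matrices, determinants and the change of variables formula make sense.
\<close>

typedef (overloaded) 'a basis_index = "Basis :: 'a::euclidean_space set"
  using nonempty_Basis by blast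

instance basis_index :: (euclidean_space) finite
proof
  have "finite (Rep_basis_index ` (UNIV :: 'a basis_index set))"
    using finite_Basis by (rule finite_subset[rotated]) (use Rep_basis_index in auto)
  then show "finite (UNIV :: 'a basis_index set)"
    by (rule finite_imageD) (simp add: inj_on_def Rep_basis_index_inject)
qed

text \<open>
  Change of variables is stated for well-ordered index types; any enumeration serves as the
  order.
\<close>

definition basis_rank :: "'a::euclidean_space basis_index \<Rightarrow> nat" where
  "basis_rank = (SOME f. inj f)"

lemma inj_basis_rank: "inj (basis_rank :: 'a::euclidean_space basis_index \<Rightarrow> nat)"
proof -
  have "\<exists>f :: 'a basis_index \<Rightarrow> nat. inj f"
    using finite_imp_inj_to_nat_seg[of "UNIV :: 'a basis_index set"] by auto
  then show ?thesis
    unfolding basis_rank_def by (rule someI_ex)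
qed

instantiation basis_index :: (euclidean_space) wellorder
begin

definition less_eq_basis_index :: "'a basis_index \<Rightarrow> 'a basis_index \<Rightarrow> bool" where
  "less_eq_basis_index i j \<longleftrightarrow> basis_rank i \<le> basis_rank j"

definition less_basis_index :: "'a basis_index \<Rightarrow> 'a basis_index \<Rightarrow> bool" where
  "less_basis_index i j \<longleftrightarrow> basis_rank i < basis_rank j"

instance
proof
  fix i j k :: "'a basis_index"
  show "i < j \<longleftrightarrow> i \<le> j \<and> \<not> j \<le> i" "i \<le> i" "i \<le> j \<or> j \<le> i"
    by (auto simp: less_eq_basis_index_def less_basis_index_def)
  show "i \<le> k" if "i \<le> j" "j \<le> k"
    using that by (auto simp: less_eq_basis_index_def)
  show "i = j" if "i \<le> j" "j \<le> i"
    using that inj_basis_rank by (auto simp: less_eq_basis_index_def dest: injD)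
next
  fix P :: "'a basis_index \<Rightarrow> bool" and a
  assume *: "\<And>x. (\<And>y. y < x \<Longrightarrow> P y) \<Longrightarrow> P x"
  show "P a"
    by (induction a rule: measure_induct_rule[of basis_rank])
      (use * in \<open>auto simp: less_basis_index_def\<close>)
qed

end

lemma bij_betw_Rep_basis_index: "bij_betw Rep_basis_index UNIV (Basis :: 'a::euclidean_space set)"
  by (rule bij_betw_imageI)
    (auto simp: inj_on_def Rep_basis_index_inject Rep_basis_index type_definition.Rep_range[OF type_definition_basis_index])

definition coords :: "'a::euclidean_space \<Rightarrow> real^'a basis_index" where
  "coords x = (\<chi> i. x \<bullet> Rep_basis_index i)"

definition uncoords :: "real^'a basis_index \<Rightarrow> 'a::euclidean_space" where
  "uncoords v = (\<Sum>i\<in>UNIV. v $ i *\<^sub>R Rep_basis_index i)"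

lemma inner_Rep_basis_index:
  "Rep_basis_index i \<bullet> Rep_basis_index j = (if i = j then 1 else 0)"
  using Rep_basis_index[of i] Rep_basis_index[of j]
  by (auto simp: inner_Basis Rep_basis_index_inject)

lemma uncoords_coords [simp]: "uncoords (coords x) = (x :: 'a::euclidean_space)"
proof -
  have "uncoords (coords x) = (\<Sum>b\<in>Basis. (x \<bullet> b) *\<^sub>R b)"
    unfolding uncoords_def coords_def
    using sum.reindex_bij_betw[OF bij_betw_Rep_basis_index, of "\<lambda>b. (x \<bullet> b) *\<^sub>R b"] by simp
  then show ?thesis by (simp add: euclidean_representation)
qed

lemma coords_uncoords [simp]: "coords (uncoords v) = v"
  by (simp add: vec_eq_iff coords_def uncoords_def inner_sum_left inner_Rep_basis_index if_distrib
      cong: if_cong)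

lemma linear_coords: "linear coords"
  by (rule linearI) (auto simp: coords_def vec_eq_iff inner_add_left)

lemma linear_uncoords: "linear uncoords"
  by (rule linearI) (auto simp: uncoords_def scaleR_left_distrib sum.distrib scaleR_sum_right)

lemma coords_image: "coords ` S = uncoords -` S"
  by (force intro: image_eqI[of _ coords "uncoords _"])

text \<open>
  The coordinate map carries the orthonormal basis to the standard one, hence boxes to boxes
  of the same volume, and a measure on the Borel sets is determined by boxes.
\<close>

lemma measure_coords_image:
  fixes S :: "'a::euclidean_space set"
  assumes S: "S \<in> sets borel"
  shows "emeasure lebesgue (coords ` S) = emeasure lebesgue S" "coords ` S \<in> sets borel"
proof -
  have meas: "uncoords \<in> borel_measurable borel"
    by (intro borel_measurable_continuous_onI linear_continuous_on linear_conv_bounded_linear[THEN iffD1] linear_uncoords)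
  have "lborel = distr lborel borel (uncoords :: _ \<Rightarrow> 'a)"
  proof (rule lborel_eqI)
    fix l u :: 'a
    assume lu: "\<And>b. b \<in> Basis \<Longrightarrow> l \<bullet> b \<le> u \<bullet> b"
    have eq: "uncoords -` box l u = box (coords l) (coords u)"
    proof (subst set_eq_iff, rule allI)
      fix v :: "real^'a basis_index"
      have "v \<in> uncoords -` box l u \<longleftrightarrow> (\<forall>b\<in>Basis. l \<bullet> b < uncoords v \<bullet> b \<and> uncoords v \<bullet> b < u \<bullet> b)"
        by (simp add: mem_box)
      also have "\<dots> \<longleftrightarrow> (\<forall>i. coords l $ i < coords (uncoords v) $ i \<and> coords (uncoords v) $ i < coords u $ i)"
        unfolding coords_def using bij_betw_Rep_basis_index[where 'a='a]
        by (auto simp: bij_betw_def set_eq_iff image_iff) metis+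
      finally show "v \<in> uncoords -` box l u \<longleftrightarrow> v \<in> box (coords l) (coords u)"
        by (simp add: mem_box_cart)
    qed
    have "emeasure (distr lborel borel uncoords) (box l u) = emeasure lborel (box (coords l) (coords u))"
      using meas by (subst emeasure_distr) (auto simp: eq)
    also have "\<dots> = ennreal (\<Prod>b\<in>Basis. (coords u - coords l) \<bullet> b)"
    proof (rule emeasure_lborel_box)
      fix b :: "(real, 'a basis_index) vec" assume "b \<in> Basis"
      then obtain i where "b = axis i 1"
        by (auto simp: Basis_vec_def)
      then show "coords l \<bullet> b \<le> coords u \<bullet> b"
        using lu[OF Rep_basis_index[of i]] by (simp add: inner_axis coords_def)
    qed
    also have "(\<Prod>b\<in>Basis. (coords u - coords l) \<bullet> b) = (\<Prod>i\<in>UNIV. (coords u - coords l) $ i)"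
    proof -
      have "bij_betw (\<lambda>i. axis i 1 :: real^'a basis_index) UNIV Basis"
        by (rule bij_betw_imageI) (auto simp: inj_on_def axis_eq_axis Basis_vec_def)
      from prod.reindex_bij_betw[OF this, of "\<lambda>b. (coords u - coords l) \<bullet> b"]
      show ?thesis by (simp add: inner_axis)
    qed
    also have "\<dots> = (\<Prod>b\<in>Basis. (u - l) \<bullet> b)"
      using prod.reindex_bij_betw[OF bij_betw_Rep_basis_index, of "\<lambda>b. (u - l) \<bullet> b"]
      by (simp add: coords_def inner_diff_left)
    finally show "emeasure (distr lborel borel uncoords) (box l u) = ennreal (\<Prod>b\<in>Basis. (u - l) \<bullet> b)" .
  qed auto
  then have "emeasure lborel S = emeasure (distr lborel borel uncoords) S" by simp
  also have "\<dots> = emeasure lborel (uncoords -` S)"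
    using meas S by (subst emeasure_distr) auto
  finally have 1: "emeasure lborel (coords ` S) = emeasure lborel S" by (simp add: coords_image)
  show 2: "coords ` S \<in> sets borel"
    using measurable_sets[OF meas S] by (simp add: coords_image)
  show "emeasure lebesgue (coords ` S) = emeasure lebesgue S"
    using 1 2 S by simp
qed

text \<open>
  The absolute value of the determinant: the factor by which a linear map multiplies volumes.
\<close>

definition vol_factor :: "('a::euclidean_space \<Rightarrow> 'a) \<Rightarrow> real" where
  "vol_factor f = \<bar>det (matrix (\<lambda>v. coords (f (uncoords v))))\<bar>"

lemma linear_coords_conj:
  "linear f \<Longrightarrow> linear (\<lambda>v. coords (f (uncoords v)))"
  using linear_compose[OF linear_compose[OF linear_uncoords] linear_coords] by (simp add: o_def)

lemma vol_factor_compose: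
  assumes "linear f" "linear g"
  shows "vol_factor (\<lambda>x. f (g x)) = vol_factor f * vol_factor g"
  using matrix_compose[OF linear_coords_conj[OF assms(2)] linear_coords_conj[OF assms(1)]]
  by (simp add: vol_factor_def o_def det_mul abs_mult)

lemma vol_factor_ident [simp]: "vol_factor (\<lambda>x. x) = 1"
  using matrix_id by (simp add: vol_factor_def id_def)

lemma matrix_coords_conj:
  "matrix (\<lambda>v. coords (f (uncoords v))) $ i $ j = f (Rep_basis_index j) \<bullet> Rep_basis_index i"
proof -
  have "uncoords (axis j 1) = Rep_basis_index j"
    by (simp add: uncoords_def axis_def if_distrib[of "\<lambda>c. c *\<^sub>R _"] cong: if_cong)
  then show ?thesis
    by (simp add: matrix_def coords_def)
qed

lemma vol_factor_diagonal:
  assumes "\<And>b. b \<in> Basis \<Longrightarrow> f b = c b *\<^sub>R b"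
  shows "vol_factor f = (\<Prod>b\<in>Basis. \<bar>c b\<bar>)"
proof -
  let ?M = "matrix (\<lambda>v. coords (f (uncoords v)))"
  have M: "?M $ i $ j = (if i = j then c (Rep_basis_index j) else 0)" for i j
    unfolding matrix_coords_conj using assms[OF Rep_basis_index[of j]]
    by (auto simp: inner_Rep_basis_index)
  have "vol_factor f = (\<Prod>i\<in>UNIV. \<bar>c (Rep_basis_index i)\<bar>)"
    unfolding vol_factor_def by (subst det_diagonal) (auto simp: M abs_prod)
  then show ?thesis
    using prod.reindex_bij_betw[OF bij_betw_Rep_basis_index, of "\<lambda>b. \<bar>c b\<bar>"] by simp
qed

lemma tendsto_vol_factor:
  assumes "\<And>b. b \<in> Basis \<Longrightarrow> ((\<lambda>r. f r b) \<longlongrightarrow> g b) F"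
  shows "((\<lambda>r. vol_factor (f r)) \<longlongrightarrow> vol_factor g) F"
  unfolding vol_factor_def det_def matrix_coords_conj
  by (intro tendsto_intros assms Rep_basis_index)

text \<open>
  Change of variables for a map with constant Jacobian, transported along the coordinate
  isometry.
\<close>

lemma measure_image_const_vol_factor:
  fixes g :: "'a::euclidean_space \<Rightarrow> 'a"
  assumes U: "open U" "bounded U" and gU: "open (g ` U)" and inj: "inj_on g U"
    and der: "\<And>x. x \<in> U \<Longrightarrow> (g has_derivative g' x) (at x)"
    and vol: "\<And>x. x \<in> U \<Longrightarrow> vol_factor (g' x) = c"
  shows "g ` U \<in> lmeasurable" "measure lebesgue (g ` U) = c * measure lebesgue U"
proof -
  define h where "h v = coords (g (uncoords v))" for v
  have U': "U \<in> sets borel" "g ` U \<in> sets borel" using U gU by auto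
  have fin: "U \<in> lmeasurable" using U by (simp add: bounded_set_imp_lmeasurable lmeasurable_open)
  have hU: "h ` (coords ` U) = coords ` (g ` U)"
    by (auto simp: h_def image_image)
  have der_h: "(h has_derivative (\<lambda>w. coords (g' (uncoords v) (uncoords w)))) (at v within coords ` U)"
    if "v \<in> coords ` U" for v
  proof -
    have v: "uncoords v \<in> U" using that by auto
    have 1: "(uncoords has_derivative uncoords) (at v within coords ` U)"
      by (intro bounded_linear_imp_has_derivative linear_uncoords[THEN linear_conv_bounded_linear[THEN iffD1]])
    have 2: "(coords has_derivative coords) (at x)" for x :: 'a
      by (intro bounded_linear_imp_has_derivative linear_coords[THEN linear_conv_bounded_linear[THEN iffD1]])
    have 3: "((\<lambda>x. coords (g x)) has_derivative (\<lambda>x. coords (g' (uncoords v) x))) (at (uncoords v))"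
      using has_derivative_compose[OF der[OF v] 2] .
    show ?thesis
      unfolding h_def using has_derivative_compose[OF 1 3] .
  qed
  have meas: "measure lebesgue (coords ` S) = measure lebesgue S" if "S \<in> sets borel" for S :: "'a set"
    using measure_coords_image[OF that] by (simp add: measure_def)
  have lm: "coords ` U \<in> lmeasurable"
    using fin measure_coords_image[OF U'(1)] by (auto simp: fmeasurable_def)
  have inj_h: "inj_on h (coords ` U)"
  proof (rule inj_onI)
    fix v w assume "v \<in> coords ` U" "w \<in> coords ` U" and "h v = h w"
    then obtain x y where xy: "x \<in> U" "y \<in> U" "v = coords x" "w = coords y" "coords (g x) = coords (g y)"
      by (auto simp: h_def)
    then have "g x = g y" by (metis uncoords_coords)
    then show "v = w" using inj xy by (auto dest: inj_onD)
  qed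
  have "((\<lambda>v. 1) has_integral measure lebesgue (coords ` U)) (coords ` U)"
    using lm by (simp add: has_integral_iff lmeasurable_iff_integrable_on lmeasure_integral)
  then have "((\<lambda>v. c * 1) has_integral c * measure lebesgue (coords ` U)) (coords ` U)"
    by (rule has_integral_mult_right)
  moreover have "\<bar>det (matrix (\<lambda>w. coords (g' (uncoords v) (uncoords w))))\<bar> = c * 1" if "v \<in> coords ` U" for v
    using vol[of "uncoords v"] that by (auto simp: vol_factor_def)
  ultimately have "((\<lambda>v. \<bar>det (matrix (\<lambda>w. coords (g' (uncoords v) (uncoords w))))\<bar>) has_integral
      c * measure lebesgue (coords ` U)) (coords ` U)"
    by (metis (no_types, lifting) has_integral_cong)
  with has_measure_differentiable_image[OF _ der_h inj_h] lm
  have *: "h ` coords ` U \<in> lmeasurable \<and> measure lebesgue (h ` coords ` U) = c * measure lebesgue (coords ` U)"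
    by (auto simp: fmeasurable_def)
  then show "measure lebesgue (g ` U) = c * measure lebesgue U"
    using meas U' by (simp add: hU)
  have "emeasure lebesgue (coords ` (g ` U)) < \<infinity>"
    using * unfolding hU by (auto simp only: fmeasurable_def mem_Collect_eq infinity_ennreal_def)
  then show "g ` U \<in> lmeasurable"
    using measure_coords_image(1)[OF U'(2)] U'(2) by (simp add: fmeasurable_def)
qed

section \<open>Stratified Lie algebras and their dilations\<close>

context lie_algebra
begin

lemma bracket_linear_right: "linear (bracket x)"
  and bracket_linear_left: "linear (\<lambda>x. bracket x y)"
  using bilinear_bracket by (auto simp: bilinear_def)

lemmas bracket_simps =
  linear_add[OF bracket_linear_right] linear_add[OF bracket_linear_left]
  linear_scale[OF bracket_linear_right] linear_scale[OF bracket_linear_left]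
  linear_0[OF bracket_linear_right] linear_0[OF bracket_linear_left]
  linear_sum[OF bracket_linear_right] linear_sum[OF bracket_linear_left]

lemma bracket_skew: "bracket x y = - bracket y x"
proof -
  have "0 = bracket (x + y) (x + y)" by (simp only: bracket_self)
  also have "\<dots> = bracket x y + bracket y x"
    by (simp only: bracket_simps) (simp add: bracket_self)
  finally show ?thesis by (metis add_eq_0_iff2)
qed

lemma bracket_bracket: "bracket (bracket x y) z = bracket x (bracket y z) - bracket y (bracket x z)"
proof -
  have "bracket (bracket x y) z = - bracket z (bracket x y)"
    by (rule bracket_skew)
  also have "\<dots> = bracket x (bracket y z) + bracket y (bracket z x)"
    using jacobi[of x y z] by (metis add_eq_0_iff2 minus_minus)
  also have "bracket y (bracket z x) = - bracket y (bracket x z)"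
    by (subst bracket_skew[of z x]) (simp add: linear_neg[OF bracket_linear_right])
  finally show ?thesis by simp
qed

end

context stratified_lie_algebra
begin

text \<open>
  With the value \<open>{0}\<close> above step \<open>m\<close> the inclusion of \<open>[layer i, layer j]\<close> in \<open>layer (i + j)\<close> holds
  for all positive \<open>i\<close> and \<open>j\<close>.
\<close>

definition layer :: "nat \<Rightarrow> 'a set" where
  "layer j = (if j \<in> {1..m} then V j else {0})"

lemma subspace_layer': "subspace (layer j)"
  using subspace_layer by (auto simp: layer_def)

lemma bracket_layer_1:
  assumes a: "a \<in> V 1" and k: "1 \<le> k" "u \<in> layer k"
  shows "bracket a u \<in> layer (1 + k)"
proof -
  consider "k < m" | "k = m" | "k > m" by linarith
  then show ?thesis
  proof cases
    case 1
    then have "bracket a u \<in> V (Suc k)"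
      using bracket_layer[of k] a k by (auto simp: layer_def intro!: span_base)
    then show ?thesis using 1 by (simp add: layer_def)
  next
    case 2
    then show ?thesis using bracket_top a k by (simp add: layer_def)
  next
    case 3
    then show ?thesis using k by (simp add: layer_def bracket_simps)
  qed
qed

text \<open>
  Layer \<open>i + 1\<close> is spanned by brackets \<open>[a, c]\<close> with \<open>a\<close> in the first layer and \<open>c\<close> in layer \<open>i\<close>, and
  the Jacobi identity writes \<open>[[a, c], w]\<close> as \<open>[a, [c, w]] - [c, [a, w]]\<close>, to which the induction
  hypothesis for \<open>i\<close> applies.
\<close>

lemma bracket_layers:
  assumes "1 \<le> i" "1 \<le> j" "x \<in> layer i" "y \<in> layer j"
  shows "bracket x y \<in> layer (i + j)"
  using assms
proof (induction i arbitrary: j x y rule: nat_induct_at_least)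
  case base
  then show ?case using m_pos by (intro bracket_layer_1) (auto simp: layer_def)
next
  case (Suc i)
  show ?case
  proof (cases "i < m")
    case False
    then show ?thesis
      using Suc by (auto simp: layer_def bracket_simps split: if_splits)
  next
    case True
    let ?P = "\<lambda>z. \<forall>j\<ge>1. \<forall>w\<in>layer j. bracket z w \<in> layer (Suc i + j)"
    have "x \<in> span {bracket x y | x y. x \<in> V 1 \<and> y \<in> V i}"
      using bracket_layer[OF Suc.hyps True] True Suc.prems by (simp add: layer_def)
    then have "?P x"
    proof (induction rule: span_induct)
      case base
      show ?case
        unfolding subspace_def using subspace_layer'
        by (auto simp: bracket_simps subspace_add subspace_scale subspace_0)
    next
      case (step z)
      then obtain a c where z: "z = bracket a c" and a: "a \<in> V 1" and c: "c \<in> layer i"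
        using True Suc.hyps by (auto simp: layer_def)
      show ?case
      proof (intro allI impI ballI)
        fix j w assume j: "1 \<le> j" and w: "w \<in> layer j"
        have "bracket a (bracket c w) \<in> layer (1 + (i + j))"
          using bracket_layer_1[OF a _ Suc.IH[OF j c w]] j by simp
        moreover have "bracket c (bracket a w) \<in> layer (i + (1 + j))"
          using Suc.IH[OF _ c bracket_layer_1[OF a j w]] by simp
        ultimately show "bracket z w \<in> layer (Suc i + j)"
          unfolding z bracket_bracket using subspace_layer' by (auto intro: subspace_diff)
      qed
    qed
    then show ?thesis using Suc.prems by auto
  qed
qed

abbreviation "lcomp \<equiv> layer_components V m"

lemma lcomp_PiE: "lcomp x \<in> (\<Pi>\<^sub>E j\<in>{1..m}. V j)" and sum_lcomp: "(\<Sum>j=1..m. lcomp x j) = x"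
  using theI'[OF direct_sum[of x]] unfolding layer_components_def by auto

lemma lcomp_unique:
  assumes "\<And>j. j \<in> {1..m} \<Longrightarrow> v j \<in> V j" "x = (\<Sum>j=1..m. v j)" "j \<in> {1..m}"
  shows "lcomp x j = v j"
proof -
  have "restrict v {1..m} \<in> (\<Pi>\<^sub>E j\<in>{1..m}. V j)" "x = (\<Sum>j=1..m. restrict v {1..m} j)"
    using assms by auto
  moreover have "lcomp x \<in> (\<Pi>\<^sub>E j\<in>{1..m}. V j) \<and> x = (\<Sum>j=1..m. lcomp x j)"
    using lcomp_PiE sum_lcomp by metis
  ultimately have "lcomp x = restrict v {1..m}"
    using direct_sum[of x] by blast
  then show ?thesis using assms by simp
qed

lemma lcomp_in: "j \<in> {1..m} \<Longrightarrow> lcomp x j \<in> V j"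
  using lcomp_PiE by (auto simp: PiE_def Pi_def)

lemma lcomp_in_layer: "j \<in> {1..m} \<Longrightarrow> lcomp x j \<in> layer j"
  using lcomp_in by (simp add: layer_def)

lemma lcomp_linear: assumes j: "j \<in> {1..m}" shows "linear (\<lambda>x. lcomp x j)"
proof (rule linearI)
  show "lcomp (x + y) j = lcomp x j + lcomp y j" for x y
    using sum_lcomp[of x] sum_lcomp[of y] j
    by (intro lcomp_unique) (auto simp: sum.distrib intro!: subspace_add[OF subspace_layer] lcomp_in)
  show "lcomp (c *\<^sub>R x) j = c *\<^sub>R lcomp x j" for c x
    using sum_lcomp[of x] j
    by (intro lcomp_unique)
      (auto simp: scaleR_sum_right[symmetric] intro!: subspace_scale[OF subspace_layer] lcomp_in)
qed

abbreviation "dil \<equiv> dilation V m"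

lemma dil_linear: "linear (dil r)"
proof -
  have "linear (\<lambda>x. \<Sum>j\<in>{1..m}. r ^ j *\<^sub>R lcomp x j)"
    by (intro linear_compose_sum ballI linear_compose_scale_right lcomp_linear)
  then show ?thesis by (simp add: dilation_def[abs_def])
qed

lemma dil_0 [simp]: "dil 0 x = 0"
  unfolding dilation_def by (intro sum.neutral) auto

lemma dil_1 [simp]: "dil 1 x = x"
  unfolding dilation_def using sum_lcomp[of x] by simp

lemma dil_layer:
  assumes "x \<in> layer j"
  shows "dil r x = r ^ j *\<^sub>R x"
proof (cases "j \<in> {1..m}")
  case True
  have "lcomp x i = (if i = j then x else 0)" if "i \<in> {1..m}" for i
    using that True assms
    by (intro lcomp_unique) (auto simp: layer_def subspace_0[OF subspace_layer])
  then show ?thesis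
    using True by (simp add: dilation_def if_distrib[of "\<lambda>c. _ *\<^sub>R c"] cong: if_cong)
next
  case False
  then show ?thesis using assms by (auto simp: layer_def linear_0[OF dil_linear])
qed

lemma dil_mult: "dil r (dil s x) = dil (r * s) x"
proof -
  have "dil r (dil s x) = (\<Sum>j=1..m. dil r (s ^ j *\<^sub>R lcomp x j))"
    by (subst (2) dilation_def) (rule linear_sum[OF dil_linear])
  also have "\<dots> = (\<Sum>j=1..m. s ^ j *\<^sub>R r ^ j *\<^sub>R lcomp x j)"
    by (intro sum.cong refl) (simp add: linear_scale[OF dil_linear] dil_layer[OF lcomp_in_layer])
  finally show ?thesis
    by (simp add: dilation_def power_mult_distrib mult.commute)
qed

text \<open>
  Dilations are automorphisms of the Lie algebra, since the bracket of components of degrees \<open>i\<close>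
  and \<open>j\<close> has degree \<open>i + j\<close>.
\<close>

lemma dil_bracket: "dil r (bracket x y) = bracket (dil r x) (dil r y)"
proof -
  have "bracket x y = bracket (\<Sum>i=1..m. lcomp x i) (\<Sum>j=1..m. lcomp y j)"
    by (simp only: sum_lcomp)
  also have "\<dots> = (\<Sum>j=1..m. \<Sum>i=1..m. bracket (lcomp x i) (lcomp y j))"
    by (simp only: bracket_simps)
  finally have "dil r (bracket x y) = (\<Sum>j=1..m. \<Sum>i=1..m. dil r (bracket (lcomp x i) (lcomp y j)))"
    by (simp add: linear_sum[OF dil_linear])
  also have "\<dots> = (\<Sum>j=1..m. \<Sum>i=1..m. bracket (r ^ i *\<^sub>R lcomp x i) (r ^ j *\<^sub>R lcomp y j))"
  proof (intro sum.cong refl)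
    fix i j assume ij: "i \<in> {1..m}" "j \<in> {1..m}"
    then have "dil r (bracket (lcomp x i) (lcomp y j)) = r ^ (i + j) *\<^sub>R bracket (lcomp x i) (lcomp y j)"
      by (intro dil_layer bracket_layers lcomp_in_layer) auto
    then show "dil r (bracket (lcomp x i) (lcomp y j)) = bracket (r ^ i *\<^sub>R lcomp x i) (r ^ j *\<^sub>R lcomp y j)"
      by (simp add: bracket_simps power_add mult.commute)
  qed
  also have "\<dots> = bracket (dil r x) (dil r y)"
    by (simp only: bracket_simps dilation_def scaleR_sum_right)
  finally show ?thesis .
qed

lemma continuous_on_dil_scale: "continuous_on S (\<lambda>r. dil r x)"
  unfolding dilation_def by (intro continuous_intros)

text \<open>
  Every operator \<open>ad p\<close> maps the sum of the layers above \<open>k\<close> into the sum of the layers above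
  \<open>k + 1\<close>.
\<close>

lemma ad_nilpotent: "((bracket p) ^^ m) x = 0"
proof -
  define F where "F k = span (\<Union>j\<in>{k<..}. layer j)" for k
  have step: "bracket p x \<in> F (Suc k)" if "x \<in> F k" for x k
    using that unfolding F_def[of k]
  proof (induction rule: span_induct)
    case base
    show ?case unfolding subspace_def F_def
      by (auto simp: bracket_simps span_add span_scale span_0)
  next
    case (step x)
    then obtain j where j: "k < j" "x \<in> layer j" by auto
    have "bracket p x = (\<Sum>i=1..m. bracket (lcomp p i) x)"
      by (subst sum_lcomp[of p, symmetric]) (simp only: bracket_simps)
    also have "\<dots> \<in> F (Suc k)"
      unfolding F_def
    proof (intro span_sum span_base)
      fix i assume "i \<in> {1..m}"
      then show "bracket (lcomp p i) x \<in> (\<Union>j\<in>{Suc k<..}. layer j)"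
        using bracket_layers[OF _ _ lcomp_in_layer j(2), of i p] j(1) by (auto intro!: bexI[of _ "i + j"])
    qed
    finally show ?case .
  qed
  have "x \<in> F 0"
  proof -
    have "(\<Sum>j=1..m. lcomp x j) \<in> F 0"
      unfolding F_def
    proof (intro span_sum span_base)
      fix j assume "j \<in> {1..m}"
      then show "lcomp x j \<in> (\<Union>j\<in>{0<..}. layer j)"
        using lcomp_in_layer[of j x] by auto
    qed
    then show ?thesis by (simp only: sum_lcomp)
  qed
  then have "((bracket p) ^^ k) x \<in> F k" for k
    by (induction k) (auto intro: step)
  moreover have "(\<Union>j\<in>{m<..}. layer j) \<subseteq> {0}" by (auto simp: layer_def)
  then have "F m \<subseteq> {0}" unfolding F_def by (metis span_mono span_0 span_insert_0 span_empty insert_is_Un)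
  ultimately show ?thesis by auto
qed

text \<open>
  In a basis made of bases of the layers the dilation is diagonal, with entry \<open>r\<^sup>j\<close> for each
  basis vector of layer \<open>j\<close>. The map \<open>T\<close> below passes from the orthonormal basis to this one, and
  the factor of \<open>T\<close> cancels.
\<close>

lemma vol_factor_dil:
  assumes r: "r > 0"
  shows "vol_factor (dil r) = r ^ homogeneous_dim V m"
proof -
  obtain E where E: "\<And>j. E j \<subseteq> V j" "\<And>j. independent (E j)" "\<And>j. V j \<subseteq> span (E j)" "\<And>j. card (E j) = dim (V j)"
  proof -
    have "\<forall>j. \<exists>E. E \<subseteq> V j \<and> independent E \<and> V j \<subseteq> span E \<and> card E = dim (V j)"
      using basis_exists by metis
    then show ?thesis using that by metis
  qed
  have finE: "finite (E j)" for j using E(2) independent_imp_finite by blast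
  have disj: "E i \<inter> E j = {}" if ij: "i \<in> {1..m}" "j \<in> {1..m}" "i \<noteq> j" for i j
  proof (rule ccontr)
    assume "E i \<inter> E j \<noteq> {}"
    then obtain e where e: "e \<in> E i" "e \<in> E j" by auto
    then have "e \<in> layer i" "e \<in> layer j" using E(1) ij by (auto simp: layer_def)
    then have "(2::real) ^ i *\<^sub>R e = 2 ^ j *\<^sub>R e" by (metis dil_layer)
    then have "e = 0" using ij(3) by simp
    then show False using e E(2) dependent_zero by blast
  qed
  define B where "B = (\<Union>j\<in>{1..m}. E j)"
  have finB: "finite B" unfolding B_def using finE by auto
  have "independent B"
  proof (rule independent_if_scalars_zero[OF finB])
    fix u :: "'a \<Rightarrow> real" and e assume 0: "(\<Sum>x\<in>B. u x *\<^sub>R x) = 0" and e: "e \<in> B"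
    obtain j where j: "j \<in> {1..m}" "e \<in> E j" using e by (auto simp: B_def)
    have "(\<Sum>x\<in>B. u x *\<^sub>R x) = (\<Sum>j=1..m. \<Sum>x\<in>E j. u x *\<^sub>R x)"
      unfolding B_def using disj finE by (intro sum.UNION_disjoint) auto
    then have "lcomp 0 j = (\<Sum>x\<in>E j. u x *\<^sub>R x)"
      using 0 j E(1) by (intro lcomp_unique) (auto intro!: subspace_sum subspace_scale subspace_layer)
    then have "(\<Sum>x\<in>E j. u x *\<^sub>R x) = 0" using linear_0[OF lcomp_linear[OF j(1)]] by simp
    then show "u e = 0" using independentD[OF E(2) finE subset_refl _ j(2)] by blast
  qed
  moreover have spanB: "span B = UNIV"
  proof -
    have "(\<Sum>j=1..m. lcomp x j) \<in> span B" for x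
    proof (rule span_sum)
      fix j assume j: "j \<in> {1..m}"
      then have "span (E j) \<subseteq> span B" by (intro span_mono) (auto simp: B_def)
      then show "lcomp x j \<in> span B" using lcomp_in[OF j] E(3) by blast
    qed
    then show ?thesis by (auto simp only: sum_lcomp)
  qed
  ultimately have cardB: "card B = DIM('a)"
    by (metis dim_UNIV dim_span dim_eq_card_independent)
  then obtain h where h: "bij_betw h (Basis :: 'a set) B"
    using finite_same_card_bij[OF finite_Basis finB] by auto
  have "\<forall>e\<in>B. \<exists>j. j \<in> {1..m} \<and> e \<in> E j" by (auto simp: B_def)
  then obtain g where g: "\<And>e. e \<in> B \<Longrightarrow> g e \<in> {1..m} \<and> e \<in> E (g e)" by metis
  have dil_e: "dil r e = r ^ g e *\<^sub>R e" if "e \<in> B" for e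
    using g[OF that] E(1) by (intro dil_layer) (auto simp: layer_def)
  define T where "T x = (\<Sum>b\<in>Basis. (x \<bullet> b) *\<^sub>R h b)" for x
  define D where "D x = (\<Sum>b\<in>Basis. (x \<bullet> b) *\<^sub>R r ^ g (h b) *\<^sub>R b)" for x
  have lin: "linear T" "linear D"
    unfolding T_def[abs_def] D_def[abs_def]
    by (auto intro!: linearI simp: inner_add_left algebra_simps sum.distrib scaleR_sum_right)
  have Tb: "T b = h b" if "b \<in> Basis" for b
    using that by (simp add: T_def inner_Basis if_distrib[of "\<lambda>c. c *\<^sub>R _"] cong: if_cong)
  have Db: "D b = r ^ g (h b) *\<^sub>R b" if "b \<in> Basis" for b
    using that by (simp add: D_def inner_Basis if_distrib[of "\<lambda>c. c *\<^sub>R _"] del: scaleR_scaleR cong: if_cong)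
  have "dil r (T x) = T (D x)" for x
  proof -
    have "dil r (T x) = (\<Sum>b\<in>Basis. (x \<bullet> b) *\<^sub>R r ^ g (h b) *\<^sub>R h b)"
      unfolding T_def using h
      by (auto simp: linear_sum[OF dil_linear] linear_scale[OF dil_linear] dil_e bij_betw_apply intro!: sum.cong)
    also have "\<dots> = T (D x)"
      unfolding D_def by (auto simp: linear_sum[OF lin(1)] linear_scale[OF lin(1)] Tb intro!: sum.cong)
    finally show ?thesis .
  qed
  then have "vol_factor (\<lambda>x. dil r (T x)) = vol_factor (\<lambda>x. T (D x))" by simp
  then have "vol_factor (dil r) * vol_factor T = vol_factor T * vol_factor D"
    by (simp only: vol_factor_compose dil_linear lin)
  moreover have "vol_factor T \<noteq> 0"
  proof -
    have "surj T"
    proof -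
      have "B \<subseteq> range T" 
      proof
        fix e assume "e \<in> B"
        then obtain b where "b \<in> Basis" "e = h b" using h by (auto simp: bij_betw_def)
        then show "e \<in> range T" using Tb by (metis rangeI)
      qed
      then have "span B \<subseteq> range T"
        using linear_subspace_image[OF lin(1) subspace_UNIV] span_minimal by blast
      then show ?thesis using spanB by auto
    qed
    then obtain S where "linear S" "T \<circ> S = id"
      using linear_surjective_right_inverse[OF lin(1)] by blast
    then have "vol_factor T * vol_factor S = 1"
      using vol_factor_compose[OF lin(1), of S] by (auto simp: fun_eq_iff)
    then show ?thesis by auto
  qed
  ultimately have "vol_factor (dil r) = vol_factor D" by simp
  also have "\<dots> = (\<Prod>b\<in>Basis. \<bar>r ^ g (h b)\<bar>)"
    by (rule vol_factor_diagonal) (rule Db)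
  also have "\<dots> = (\<Prod>e\<in>B. r ^ g e)"
    using prod.reindex_bij_betw[OF h, of "\<lambda>e. r ^ g e"] r by simp
  also have "\<dots> = (\<Prod>j=1..m. \<Prod>e\<in>E j. r ^ g e)"
    unfolding B_def using disj finE by (intro prod.UNION_disjoint) auto
  also have "\<dots> = (\<Prod>j=1..m. \<Prod>e\<in>E j. r ^ j)"
  proof (intro prod.cong refl)
    fix j e assume j: "j \<in> {1..m}" "e \<in> E j"
    then have "e \<in> B" by (auto simp: B_def)
    then have "g e = j" using g[of e] disj[of "g e" j] j by auto
    then show "r ^ g e = r ^ j" by simp
  qed
  also have "\<dots> = r ^ homogeneous_dim V m"
    by (simp add: E(4) homogeneous_dim_def power_sum power_mult)
  finally show ?thesis .
qed

lemma homogeneous_dim_pos: "homogeneous_dim V m > 0"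
proof (rule ccontr)
  assume "\<not> ?thesis"
  then have "\<forall>j\<in>{1..m}. dim (V j) = 0" by (auto simp: homogeneous_dim_def)
  then have V0: "V j \<subseteq> {0}" if "j \<in> {1..m}" for j using that by (simp add: dim_eq_0)
  obtain b :: 'a where b: "b \<in> Basis" using nonempty_Basis by blast
  have "b = (\<Sum>j=1..m. lcomp b j)" by (simp only: sum_lcomp)
  also have "\<dots> = 0" using lcomp_in V0 by (intro sum.neutral) blast
  finally show False using b nonzero_Basis by blast
qed

text \<open>
  The series \<open>(1 - exp (- ad p)) / ad p\<close>, which is finite because \<open>ad p\<close> is nilpotent.
\<close>

definition exp_factor :: "'a \<Rightarrow> 'a \<Rightarrow> 'a" where
  "exp_factor p y = (\<Sum>k<m. ((- 1) ^ k / fact (Suc k)) *\<^sub>R ((bracket p) ^^ k) y)"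

lemma ad_pow_linear: "linear ((bracket p) ^^ k)"
proof (induction k)
  case 0
  then show ?case using linear_id by (simp add: id_def)
next
  case (Suc k)
  then show ?case using linear_compose[OF Suc bracket_linear_right] by (simp add: o_def)
qed

lemma exp_factor_linear: "linear (exp_factor p)"
proof -
  have "linear (\<lambda>y. \<Sum>k\<in>{..<m}. ((- 1) ^ k / fact (Suc k)) *\<^sub>R ((bracket p) ^^ k) y)"
    by (intro linear_compose_sum ballI linear_compose_scale_right ad_pow_linear)
  then show ?thesis by (simp add: exp_factor_def[abs_def])
qed

lemma dil_ad_pow: "dil r (((bracket p) ^^ k) y) = ((bracket (dil r p)) ^^ k) (dil r y)"
  by (induction k) (auto simp: dil_bracket)

lemma dil_exp_factor: "dil r (exp_factor p y) = exp_factor (dil r p) (dil r y)"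
  unfolding exp_factor_def
  by (simp add: linear_sum[OF dil_linear] linear_scale[OF dil_linear] dil_ad_pow)

lemma tendsto_ad_pow:
  assumes "(f \<longlongrightarrow> p) F"
  shows "((\<lambda>r. ((bracket (f r)) ^^ k) y) \<longlongrightarrow> ((bracket p) ^^ k) y) F"
proof (induction k)
  case (Suc k)
  have "bounded_bilinear bracket"
    using bilinear_bracket bilinear_conv_bounded_bilinear by blast
  from bounded_bilinear.tendsto[OF this assms Suc] show ?case by simp
qed simp

text \<open>
  The series at \<open>dil r p\<close> is the conjugate by \<open>dil r\<close> of the series at \<open>p\<close>, so it has the same
  determinant; as \<open>r \<rightarrow> 0\<close> it tends to the identity.
\<close>

lemma vol_factor_exp_factor: "vol_factor (exp_factor p) = 1"
proof -
  have const: "vol_factor (exp_factor (dil r p)) = vol_factor (exp_factor p)" if "r > 0" for r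
  proof -
    have "vol_factor (\<lambda>y. dil r (exp_factor p y)) = vol_factor (\<lambda>y. exp_factor (dil r p) (dil r y))"
      by (simp add: dil_exp_factor)
    then have "vol_factor (dil r) * vol_factor (exp_factor p) = vol_factor (exp_factor (dil r p)) * vol_factor (dil r)"
      by (simp add: vol_factor_compose dil_linear exp_factor_linear)
    then show ?thesis using that by (simp add: vol_factor_dil)
  qed
  have "isCont (\<lambda>r. dil r p) 0"
    using continuous_on_dil_scale[of UNIV p] by (simp add: continuous_on_eq_continuous_at)
  then have "((\<lambda>r. dil r p) \<longlongrightarrow> dil 0 p) (at_right 0)"
    unfolding isCont_def filterlim_at_split by blast
  then have lim: "((\<lambda>r. dil r p) \<longlongrightarrow> 0) (at_right 0)" by simp
  have "((\<lambda>r. vol_factor (exp_factor (dil r p))) \<longlongrightarrow> vol_factor (exp_factor 0)) (at_right 0)"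
    unfolding exp_factor_def by (intro tendsto_vol_factor tendsto_intros tendsto_ad_pow lim)
  moreover have "exp_factor 0 = (\<lambda>y. y)"
  proof
    fix y
    have "((bracket 0) ^^ k) y = 0" if "k \<noteq> 0" for k
      using that by (cases k) (auto simp: bracket_simps)
    then have "exp_factor 0 y = (\<Sum>k<m. if k = 0 then y else 0)"
      unfolding exp_factor_def by (intro sum.cong) auto
    then show "exp_factor 0 y = y" using m_pos by simp
  qed
  ultimately have "((\<lambda>r. vol_factor (exp_factor (dil r p))) \<longlongrightarrow> 1) (at_right 0)" by simp
  moreover have "\<forall>\<^sub>F r in at_right 0. vol_factor (exp_factor (dil r p)) = vol_factor (exp_factor p)"
    using const by (auto intro: eventually_at_right_less[THEN eventually_mono])
  ultimately have "((\<lambda>r::real. vol_factor (exp_factor p)) \<longlongrightarrow> 1) (at_right 0)"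
    by (rule Lim_transform_eventually)
  then show ?thesis by (simp add: tendsto_const_iff)
qed

end

section \<open>Calculus for smooth maps\<close>

text \<open>
  The second difference \<open>f (x + h u + h v) - f (x + h u) - f (x + h v) + f x\<close> is symmetric in \<open>u\<close>
  and \<open>v\<close>. Two applications of the mean value theorem make it \<open>h\<^sup>2\<close> times either mixed derivative
  at points that tend to \<open>x\<close> with \<open>h\<close>.
\<close>

lemma mixed_partials_real:
  fixes f :: "'a::real_normed_vector \<Rightarrow> real"
  assumes f': "\<And>x. (f has_derivative f' x) (at x)"
    and f'': "\<And>w x. ((\<lambda>x. f' x w) has_derivative f'' w x) (at x)"
    and cont: "\<And>w z. continuous_on UNIV (\<lambda>x. f'' w x z)"
  shows "f'' u x v = f'' v x u"
proof -
  have line: "((\<lambda>s. g (a + s *\<^sub>R w)) has_real_derivative g' (a + s *\<^sub>R w) w) (at s)"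
    if "\<And>x. (g has_derivative g' x) (at x)" for g :: "'a \<Rightarrow> real" and g' a w s
  proof -
    have "((\<lambda>s. a + s *\<^sub>R w) has_derivative (\<lambda>h. h *\<^sub>R w)) (at s)"
      by (auto intro!: derivative_eq_intros)
    from has_derivative_compose[OF this that]
    have "((\<lambda>s. g (a + s *\<^sub>R w)) has_derivative (\<lambda>h. g' (a + s *\<^sub>R w) (h *\<^sub>R w))) (at s)" .
    moreover have "linear (g' (a + s *\<^sub>R w))" using that has_derivative_linear by blast
    ultimately show ?thesis
      by (simp add: has_field_derivative_def linear_scale mult_commute_abs)
  qed
  have second_difference: "\<exists>\<xi>\<in>{0..h}. \<exists>\<eta>\<in>{0..h}.
      f (x + h *\<^sub>R u + h *\<^sub>R v) - f (x + h *\<^sub>R u) - f (x + h *\<^sub>R v) + f x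
        = h * h * f'' u (x + \<xi> *\<^sub>R u + \<eta> *\<^sub>R v) v" if hp: "h > 0" for h u v
  proof -
    define g where "g s = f (x + h *\<^sub>R v + s *\<^sub>R u) - f (x + s *\<^sub>R u)" for s
    have "(g has_real_derivative f' (x + h *\<^sub>R v + s *\<^sub>R u) u - f' (x + s *\<^sub>R u) u) (at s)" for s
      unfolding g_def by (intro DERIV_diff line f')
    then obtain \<xi> where \<xi>: "0 < \<xi>" "\<xi> < h"
      "g h - g 0 = (h - 0) * (f' (x + h *\<^sub>R v + \<xi> *\<^sub>R u) u - f' (x + \<xi> *\<^sub>R u) u)"
      using MVT2[OF hp, of g "\<lambda>s. f' (x + h *\<^sub>R v + s *\<^sub>R u) u - f' (x + s *\<^sub>R u) u"] by blast
    define k where "k t = f' (x + \<xi> *\<^sub>R u + t *\<^sub>R v) u" for t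
    have "(k has_real_derivative f'' u (x + \<xi> *\<^sub>R u + t *\<^sub>R v) v) (at t)" for t
      unfolding k_def by (rule line[of "\<lambda>x. f' x u"]) (rule f'')
    then obtain \<eta> where \<eta>: "0 < \<eta>" "\<eta> < h"
      "k h - k 0 = (h - 0) * f'' u (x + \<xi> *\<^sub>R u + \<eta> *\<^sub>R v) v"
      using MVT2[OF hp, of k "\<lambda>t. f'' u (x + \<xi> *\<^sub>R u + t *\<^sub>R v) v"] by blast
    have "g h - g 0 = h * (k h - k 0)"
      using \<xi>(3) by (simp add: k_def algebra_simps)
    also have "\<dots> = h * h * f'' u (x + \<xi> *\<^sub>R u + \<eta> *\<^sub>R v) v"
      using \<eta>(3) by simp
    finally have "g h - g 0 = h * h * f'' u (x + \<xi> *\<^sub>R u + \<eta> *\<^sub>R v) v" .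
    moreover have "g h - g 0 = f (x + h *\<^sub>R u + h *\<^sub>R v) - f (x + h *\<^sub>R u) - f (x + h *\<^sub>R v) + f x"
      by (simp add: g_def algebra_simps)
    ultimately show ?thesis using \<xi> \<eta> by (intro bexI[of _ \<xi>] bexI[of _ \<eta>]) auto
  qed
  define h where "h n = inverse (real (Suc n))" for n
  have hpos: "h n > 0" for n by (simp add: h_def)
  have hlim: "h \<longlonglongrightarrow> 0" unfolding h_def by (rule LIMSEQ_inverse_real_of_nat)
  have lims: "(\<lambda>n. f'' u (x + \<xi> n *\<^sub>R u + \<eta> n *\<^sub>R v) v) \<longlonglongrightarrow> f'' u x v"
    if "\<And>n. \<xi> n \<in> {0..h n}" "\<And>n. \<eta> n \<in> {0..h n}" for u v \<xi> \<eta>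
  proof -
    have "\<xi> \<longlonglongrightarrow> 0" "\<eta> \<longlonglongrightarrow> 0"
      using that by (auto intro!: tendsto_sandwich[OF _ _ tendsto_const hlim])
    then have "(\<lambda>n. x + \<xi> n *\<^sub>R u + \<eta> n *\<^sub>R v) \<longlonglongrightarrow> x + 0 *\<^sub>R u + 0 *\<^sub>R v"
      by (intro tendsto_intros)
    then show ?thesis
      using continuous_on_tendsto_compose[OF cont, of "\<lambda>n. x + \<xi> n *\<^sub>R u + \<eta> n *\<^sub>R v" x] by simp
  qed
  have "\<exists>\<xi> \<eta>. \<forall>n. \<xi> n \<in> {0..h n} \<and> \<eta> n \<in> {0..h n} \<and>
      f (x + h n *\<^sub>R u + h n *\<^sub>R v) - f (x + h n *\<^sub>R u) - f (x + h n *\<^sub>R v) + f x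
        = h n * h n * f'' u (x + \<xi> n *\<^sub>R u + \<eta> n *\<^sub>R v) v" for u v
    using second_difference[OF hpos, where u = u and v = v] by metis
  then obtain \<xi> \<eta> \<xi>' \<eta>' where
    1: "\<And>n. \<xi> n \<in> {0..h n}" "\<And>n. \<eta> n \<in> {0..h n}"
      "\<And>n. f (x + h n *\<^sub>R u + h n *\<^sub>R v) - f (x + h n *\<^sub>R u) - f (x + h n *\<^sub>R v) + f x
        = h n * h n * f'' u (x + \<xi> n *\<^sub>R u + \<eta> n *\<^sub>R v) v" and
    2: "\<And>n. \<xi>' n \<in> {0..h n}" "\<And>n. \<eta>' n \<in> {0..h n}"
      "\<And>n. f (x + h n *\<^sub>R v + h n *\<^sub>R u) - f (x + h n *\<^sub>R v) - f (x + h n *\<^sub>R u) + f x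
        = h n * h n * f'' v (x + \<xi>' n *\<^sub>R v + \<eta>' n *\<^sub>R u) u"
    by metis
  have "f'' u (x + \<xi> n *\<^sub>R u + \<eta> n *\<^sub>R v) v = f'' v (x + \<xi>' n *\<^sub>R v + \<eta>' n *\<^sub>R u) u" for n
  proof -
    have "h n * h n * f'' u (x + \<xi> n *\<^sub>R u + \<eta> n *\<^sub>R v) v = h n * h n * f'' v (x + \<xi>' n *\<^sub>R v + \<eta>' n *\<^sub>R u) u"
      using 1(3)[of n] 2(3)[of n] by (simp add: algebra_simps)
    then show ?thesis using hpos[of n] by simp
  qed
  then show ?thesis
    using lims[OF 1(1,2), where u = u and v = v] lims[OF 2(1,2), where u = v and v = u]
    by (auto intro: LIMSEQ_unique)
qed

lemma mixed_partials:
  fixes f :: "'a::real_normed_vector \<Rightarrow> 'b::euclidean_space"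
  assumes f': "\<And>x. (f has_derivative f' x) (at x)"
    and f'': "\<And>w x. ((\<lambda>x. f' x w) has_derivative f'' w x) (at x)"
    and cont: "\<And>w z. continuous_on UNIV (\<lambda>x. f'' w x z)"
  shows "f'' u x v = f'' v x u"
proof (rule euclidean_eqI)
  fix b :: 'b assume "b \<in> Basis"
  show "f'' u x v \<bullet> b = f'' v x u \<bullet> b"
    by (rule mixed_partials_real[of "\<lambda>x. f x \<bullet> b" "\<lambda>x h. f' x h \<bullet> b" "\<lambda>w x h. f'' w x h \<bullet> b"])
      (intro has_derivative_inner_left f' f'' continuous_intros cont)+
qed

lemma smooth_on_UNIV_D:
  assumes "smooth_on f UNIV"
  shows "(f has_derivative frechet_derivative f (at x)) (at x)"
    and "smooth_on (\<lambda>x. frechet_derivative f (at x) v) UNIV"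
    and "continuous_on UNIV f"
proof -
  have C: "Ck_on k f UNIV" for k using assms by (simp add: smooth_on_def)
  show "(f has_derivative frechet_derivative f (at x)) (at x)"
    using C[of 1] by (simp add: frechet_derivative_works[symmetric])
  show "smooth_on (\<lambda>x. frechet_derivative f (at x) v) UNIV"
    unfolding smooth_on_def
  proof
    show "Ck_on k (\<lambda>x. frechet_derivative f (at x) v) UNIV" for k using C[of "Suc k"] by simp
  qed
  show "continuous_on UNIV f" using C[of 0] by simp
qed

text \<open>
  The product rule for \<open>A (c q) (w q)\<close> when \<open>A z\<close> is linear and only the maps \<open>z \<mapsto> A z w\<close> with \<open>w\<close>
  fixed are known to be differentiable; expanding \<open>w q\<close> in the basis reduces it to the scalar
  product rule.
\<close>

lemma has_derivative_linear_param:
  fixes A :: "'c::real_normed_vector \<Rightarrow> 'd::euclidean_space \<Rightarrow> 'e::real_normed_vector"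
  assumes lin: "\<And>z. linear (A z)"
    and A': "\<And>w z. ((\<lambda>z. A z w) has_derivative A' w z) (at z)"
    and c: "(c has_derivative c') (at q)" and w: "(w has_derivative w') (at q)"
  shows "((\<lambda>q. A (c q) (w q)) has_derivative (\<lambda>h. A' (w q) (c q) (c' h) + A (c q) (w' h))) (at q)"
proof -
  have rep: "A z v = (\<Sum>b\<in>Basis. (v \<bullet> b) *\<^sub>R A z b)" for z v
    by (subst euclidean_representation[of v, symmetric])
      (simp only: linear_sum[OF lin] linear_scale[OF lin])
  have "((\<lambda>z. \<Sum>b\<in>Basis. (v \<bullet> b) *\<^sub>R A z b) has_derivative (\<lambda>h. \<Sum>b\<in>Basis. (v \<bullet> b) *\<^sub>R A' b z h)) (at z)" for v z
    by (auto intro!: derivative_eq_intros A')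
  then have rep': "A' v z h = (\<Sum>b\<in>Basis. (v \<bullet> b) *\<^sub>R A' b z h)" for v z h
    using has_derivative_unique[OF A'[of v z]] by (metis (no_types, lifting) rep[abs_def] ext)
  have "((\<lambda>q. \<Sum>b\<in>Basis. (w q \<bullet> b) *\<^sub>R A (c q) b) has_derivative
      (\<lambda>h. \<Sum>b\<in>Basis. (w q \<bullet> b) *\<^sub>R A' b (c q) (c' h) + (w' h \<bullet> b) *\<^sub>R A (c q) b)) (at q)"
    by (intro has_derivative_sum has_derivative_scaleR has_derivative_inner_left w
        has_derivative_compose[OF c A'])
  then show ?thesis
    unfolding rep[of _ "w _"] by (simp add: sum.distrib rep[of _ "w' _", symmetric] rep'[of "w q", symmetric])
qed

text \<open>
  Uniqueness of the zero solution of a linear differential equation: if \<open>L\<close> bounds the norms of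
  the operators \<open>A t\<close>, then \<open>exp (- 2 L t) \<bar>r t\<bar>\<^sup>2\<close> does not increase.
\<close>

lemma linear_ode_zero:
  fixes r :: "real \<Rightarrow> 'a::euclidean_space"
  assumes r': "\<And>t. t \<in> {0..T} \<Longrightarrow> (r has_vector_derivative A t (r t)) (at t)"
    and lin: "\<And>t. linear (A t)" and cont: "\<And>b. b \<in> Basis \<Longrightarrow> continuous_on {0..T} (\<lambda>t. A t b)"
    and r0: "r 0 = 0" and T: "0 \<le> T"
  shows "r T = 0"
proof -
  have "\<exists>K. \<forall>t\<in>{0..T}. norm (A t b) \<le> K" if b: "b \<in> Basis" for b
    using compact_imp_bounded[OF compact_continuous_image[OF cont[OF b] compact_Icc]]
    by (auto simp: bounded_iff)
  then obtain K where K: "\<And>b t. b \<in> Basis \<Longrightarrow> t \<in> {0..T} \<Longrightarrow> norm (A t b) \<le> K b" by metis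
  define L where "L = (\<Sum>b\<in>Basis. K b)"
  have bound: "norm (A t z) \<le> L * norm z" if t: "t \<in> {0..T}" for t z
  proof -
    have "A t z = (\<Sum>b\<in>Basis. (z \<bullet> b) *\<^sub>R A t b)"
      by (subst euclidean_representation[of z, symmetric])
        (simp only: linear_sum[OF lin] linear_scale[OF lin])
    also have "norm \<dots> \<le> (\<Sum>b\<in>Basis. norm z * K b)"
    proof (rule sum_norm_le)
      fix b :: 'a assume b: "b \<in> Basis"
      show "norm ((z \<bullet> b) *\<^sub>R A t b) \<le> norm z * K b"
        using mult_mono[OF Basis_le_norm[OF b, of z] K[OF b t]] by simp
    qed
    finally show ?thesis by (simp add: L_def sum_distrib_left mult.commute)
  qed
  define \<phi> where "\<phi> t = exp (- 2 * L * t) * (r t \<bullet> r t)" for t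
  have "\<phi> T \<le> \<phi> 0"
  proof (rule DERIV_nonpos_imp_nonincreasing[OF T])
    fix t assume "0 \<le> t" "t \<le> T"
    then have t: "t \<in> {0..T}" by simp
    have inner: "((\<lambda>t. r t \<bullet> r t) has_real_derivative 2 * (r t \<bullet> A t (r t))) (at t)"
      using has_derivative_inner[OF r'[OF t, unfolded has_vector_derivative_def] r'[OF t, unfolded has_vector_derivative_def]]
      unfolding has_field_derivative_def
      by (simp add: algebra_simps inner_commute[of "A t (r t)"] mult_commute_abs)
    have "(\<phi> has_real_derivative exp (- 2 * L * t) * (2 * (r t \<bullet> A t (r t)) - 2 * L * (r t \<bullet> r t))) (at t)"
      unfolding \<phi>_def by (auto intro!: derivative_eq_intros inner simp: algebra_simps)
    moreover have "r t \<bullet> A t (r t) \<le> norm (r t) * (L * norm (r t))"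
      using norm_cauchy_schwarz[of "r t" "A t (r t)"] mult_left_mono[OF bound[OF t, of "r t"] norm_ge_zero[of "r t"]]
      by linarith
    then have "2 * (r t \<bullet> A t (r t)) - 2 * L * (r t \<bullet> r t) \<le> 0"
      by (simp add: dot_square_norm power2_eq_square algebra_simps)
    then have "exp (- 2 * L * t) * (2 * (r t \<bullet> A t (r t)) - 2 * L * (r t \<bullet> r t)) \<le> 0"
      by (simp add: mult_nonneg_nonpos)
    ultimately show "\<exists>y. (\<phi> has_real_derivative y) (at t) \<and> y \<le> 0" by blast
  qed
  then have "r T \<bullet> r T \<le> 0" by (simp add: \<phi>_def r0 mult_le_0_iff)
  then show ?thesis using inner_gt_zero_iff[of "r T"] by (metis linorder_not_le)
qed

section \<open>Haar measure of a stratified group\<close>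

context stratified_group
begin

abbreviation gmult :: "'a \<Rightarrow> 'a \<Rightarrow> 'a" (infixl "\<cdot>" 70) where "x \<cdot> y \<equiv> x \<otimes>\<^bsub>G\<^esub> y"

abbreviation ginv :: "'a \<Rightarrow> 'a" where "ginv x \<equiv> inv\<^bsub>G\<^esub> x"

lemma in_carrier [simp]: "x \<in> carrier G"
  by (simp add: carrier_UNIV)

lemma one_eq_0: "\<one>\<^bsub>G\<^esub> = 0"
proof -
  have "(0::'a) \<cdot> 0 = 0" using exp_one_parameter[of 0 0 0] by simp
  then show ?thesis using l_cancel_one'[of 0 0] by (metis in_carrier)
qed

lemma gmult_0 [simp]: "x \<cdot> 0 = x" "0 \<cdot> x = x"
  using r_one[of x] l_one[of x] by (simp_all add: one_eq_0)

lemma gmult_inv [simp]: "x \<cdot> ginv x = 0" "ginv x \<cdot> x = 0"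
  using r_inv[of x] l_inv[of x] by (simp_all add: one_eq_0)

lemma gmult_assoc: "x \<cdot> y \<cdot> z = x \<cdot> (y \<cdot> z)"
  by (rule m_assoc) auto

definition mu :: "'a \<times> 'a \<Rightarrow> 'a" where "mu z = fst z \<cdot> snd z"

definition D1 :: "'a \<times> 'a \<Rightarrow> 'a \<times> 'a \<Rightarrow> 'a" where
  "D1 z w = frechet_derivative mu (at z) w"

definition D2 :: "'a \<times> 'a \<Rightarrow> 'a \<times> 'a \<Rightarrow> 'a \<times> 'a \<Rightarrow> 'a" where
  "D2 w z h = frechet_derivative (\<lambda>z. D1 z w) (at z) h"

lemma mu_smooth: "smooth_on mu UNIV"
  using smooth_mult by (simp add: mu_def[abs_def] case_prod_unfold)

lemma D1: "(mu has_derivative D1 z) (at z)"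
  using smooth_on_UNIV_D(1)[OF mu_smooth] by (simp add: D1_def[abs_def])

lemma D1_linear: "linear (D1 z)"
  using D1 has_derivative_linear by blast

lemma D1_smooth: "smooth_on (\<lambda>z. D1 z w) UNIV"
  using smooth_on_UNIV_D(2)[OF mu_smooth] by (simp add: D1_def[abs_def])

lemma D2: "((\<lambda>z. D1 z w) has_derivative D2 w z) (at z)"
  using smooth_on_UNIV_D(1)[OF D1_smooth] by (simp add: D2_def[abs_def])

lemma D2_linear: "linear (D2 w z)"
  using D2 has_derivative_linear by blast

lemma D2_continuous: "continuous_on UNIV (\<lambda>z. D2 w z h)"
  using smooth_on_UNIV_D(3)[OF smooth_on_UNIV_D(2)[OF D1_smooth]] by (simp add: D2_def[abs_def])

lemma D2_sym: "D2 w z h = D2 h z w"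
  by (rule mixed_partials[OF D1 D2 D2_continuous])

lemma gmult_has_derivative:
  assumes "(f has_derivative f') (at x)" "(g has_derivative g') (at x)"
  shows "((\<lambda>x. f x \<cdot> g x) has_derivative (\<lambda>h. D1 (f x, g x) (f' h, g' h))) (at x)"
  using has_derivative_compose[OF has_derivative_Pair[OF assms] D1] by (simp add: mu_def)

lemma left_translation_derivative: "((\<lambda>y. p \<cdot> y) has_derivative (\<lambda>h. D1 (p, q) (0, h))) (at q)"
  by (rule gmult_has_derivative) (auto intro!: derivative_eq_intros)

lemma continuous_on_gmult: "continuous_on UNIV (\<lambda>y. x \<cdot> y)"
proof -
  have "continuous_on UNIV (\<lambda>y. mu (x, y))"
    by (rule continuous_on_compose2[OF smooth_on_UNIV_D(3)[OF mu_smooth]]) (auto intro!: continuous_intros)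
  then show ?thesis by (simp add: mu_def)
qed

text \<open>
  The left-invariant vector field with value \<open>X\<close> at the identity, as a function of the point \<open>p\<close>;
  \<open>dfield X p\<close> is its derivative at \<open>p\<close>.
\<close>

definition lfield :: "'a \<Rightarrow> 'a \<Rightarrow> 'a" where "lfield X p = D1 (p, 0) (0, X)"

definition dfield :: "'a \<Rightarrow> 'a \<Rightarrow> 'a \<Rightarrow> 'a" where "dfield X p h = D2 (0, X) (p, 0) (h, 0)"

lemma linear_pair2: "linear (\<lambda>x. (0, x))" and linear_pair1: "linear (\<lambda>x. (x, 0))"
  by (auto intro!: linearI)

lemma lfield_linear: "linear (\<lambda>X. lfield X p)"
  unfolding lfield_def using linear_compose[OF linear_pair2 D1_linear] by (simp add: o_def)

lemma dfield_linear: "linear (dfield X p)"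
  unfolding dfield_def[abs_def] using linear_compose[OF linear_pair1 D2_linear] by (simp add: o_def)

lemma dfield: "(lfield X has_derivative dfield X p) (at p)"
proof -
  have "((\<lambda>p. (p, 0)) has_derivative (\<lambda>h. (h, 0))) (at p)"
    by (auto intro!: derivative_eq_intros)
  from has_derivative_compose[OF this D2] show ?thesis
    by (simp add: lfield_def[abs_def] dfield_def[abs_def])
qed

lemma left_invariant_field_eq: "left_invariant_field G X p = lfield X p"
proof -
  show ?thesis
    using left_translation_derivative[of p 0]
    by (simp add: left_invariant_field_def one_eq_0 lfield_def frechet_derivative_at[symmetric])
qed

lemma lfield_0 [simp]: "lfield X 0 = X"
proof -
  have "((\<lambda>y. y) has_derivative (\<lambda>h. D1 (0, 0) (0, h))) (at 0)"
    using left_translation_derivative[of 0 0] by simp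
  from has_derivative_unique[OF this has_derivative_ident]
  show ?thesis by (simp add: lfield_def fun_eq_iff)
qed

lemma bracket_dfield: "bracket X Y = dfield Y 0 X - dfield X 0 Y"
proof -
  have eq: "left_invariant_field G Z = lfield Z" for Z by (simp add: fun_eq_iff left_invariant_field_eq)
  have fd: "frechet_derivative (lfield Z) (at p) = dfield Z p" for Z p
    using frechet_derivative_at[OF dfield] by metis
  show ?thesis using bracket_eq[of X Y] by (simp add: one_eq_0 eq fd)
qed

text \<open>
  Left invariance, obtained by differentiating the associative law \<open>p (q y) = (p q) y\<close> at \<open>y = 0\<close>.
\<close>

lemma lfield_translate: "D1 (p, q) (0, lfield Y q) = lfield Y (p \<cdot> q)"
proof -
  have "((\<lambda>y. p \<cdot> (q \<cdot> y)) has_derivative (\<lambda>h. D1 (p, q \<cdot> 0) (0, D1 (q, 0) (0, h)))) (at 0)"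
    by (rule has_derivative_compose[OF left_translation_derivative left_translation_derivative])
  moreover have "((\<lambda>y. (p \<cdot> q) \<cdot> y) has_derivative (\<lambda>h. D1 (p \<cdot> q, 0) (0, h))) (at 0)"
    by (rule left_translation_derivative)
  ultimately have "(\<lambda>h. D1 (p, q \<cdot> 0) (0, D1 (q, 0) (0, h))) = (\<lambda>h. D1 (p \<cdot> q, 0) (0, h))"
    by (intro has_derivative_unique) (simp_all add: gmult_assoc)
  then show ?thesis by (simp add: lfield_def fun_eq_iff)
qed

text \<open>
  Differentiating left invariance once more, in \<open>q\<close> at the identity. The second derivative of
  the translation is symmetric in \<open>X\<close> and \<open>Y\<close>, so it cancels in the commutator below.
\<close>

lemma dfield_along_lfield:
  "dfield Y p (lfield X p) = D2 (0, Y) (p, 0) (0, X) + lfield (dfield Y 0 X) p"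
proof -
  have "((\<lambda>q. D1 (p, q) (0, lfield Y q)) has_derivative
      (\<lambda>h. D2 (0, lfield Y 0) (p, 0) (0, h) + D1 (p, 0) (0, dfield Y 0 h))) (at 0)"
    by (rule has_derivative_linear_param[OF D1_linear D2, where c = "\<lambda>q. (p, q)" and w = "\<lambda>q. (0, lfield Y q)"])
      (auto intro!: derivative_eq_intros dfield)
  moreover have "((\<lambda>q. lfield Y (p \<cdot> q)) has_derivative (\<lambda>h. dfield Y p (lfield h p))) (at 0)"
    using has_derivative_compose[OF left_translation_derivative[of p 0] dfield[of Y]] by (simp add: lfield_def)
  ultimately have "(\<lambda>h. D2 (0, lfield Y 0) (p, 0) (0, h) + D1 (p, 0) (0, dfield Y 0 h)) = (\<lambda>h. dfield Y p (lfield h p))"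
    by (intro has_derivative_unique) (simp_all add: lfield_translate)
  from fun_cong[OF this, of X] show ?thesis
    unfolding lfield_def[of "dfield Y 0 X"] by simp
qed

lemma lfield_commutator:
  "dfield Y p (lfield X p) - dfield X p (lfield Y p) = lfield (bracket X Y) p"
  unfolding dfield_along_lfield bracket_dfield linear_diff[OF lfield_linear]
  using D2_sym[of "(0, Y)" "(p, 0)" "(0, X)"] by simp

text \<open>
  The integral curve through the identity of the field of \<open>X\<close> is the line spanned by \<open>X\<close>: this is
  what it means that the exponential map is the identity.
\<close>

lemma lfield_radial: "lfield X (t *\<^sub>R X) = X"
proof -
  have "((\<lambda>s. (t *\<^sub>R X) \<cdot> (s *\<^sub>R X)) has_derivative (\<lambda>h. D1 (t *\<^sub>R X, 0 *\<^sub>R X) (0, h *\<^sub>R X))) (at 0)"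
    by (rule gmult_has_derivative) (auto intro!: derivative_eq_intros)
  moreover have "((\<lambda>s. (t *\<^sub>R X) \<cdot> (s *\<^sub>R X)) has_derivative (\<lambda>h. h *\<^sub>R X)) (at 0)"
    unfolding exp_one_parameter by (auto intro!: derivative_eq_intros)
  ultimately have "(\<lambda>h. D1 (t *\<^sub>R X, 0 *\<^sub>R X) (0, h *\<^sub>R X)) = (\<lambda>h. h *\<^sub>R X)"
    by (rule has_derivative_unique)
  from fun_cong[OF this, of 1] show ?thesis by (simp add: lfield_def)
qed

text \<open>
  The previous identity for \<open>X = p\<close>, differentiated in \<open>p\<close> in the direction \<open>Z\<close>.
\<close>

lemma lfield_radial_deriv: "t *\<^sub>R dfield p (t *\<^sub>R p) Z + lfield Z (t *\<^sub>R p) = Z"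
proof -
  have "((\<lambda>p. D1 (t *\<^sub>R p, 0) (0, p)) has_derivative
      (\<lambda>h. D2 (0, p) (t *\<^sub>R p, 0) (t *\<^sub>R h, 0) + D1 (t *\<^sub>R p, 0) (0, h))) (at p)"
    by (rule has_derivative_linear_param[OF D1_linear D2, where c = "\<lambda>p. (t *\<^sub>R p, 0)" and w = "\<lambda>p. (0, p)"])
      (auto intro!: derivative_eq_intros)
  moreover have "((\<lambda>p. D1 (t *\<^sub>R p, 0) (0, p)) has_derivative (\<lambda>h. h)) (at p)"
    using lfield_radial by (simp add: lfield_def)
  ultimately have "(\<lambda>h. D2 (0, p) (t *\<^sub>R p, 0) (t *\<^sub>R h, 0) + D1 (t *\<^sub>R p, 0) (0, h)) = (\<lambda>h. h)"
    by (rule has_derivative_unique)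
  from fun_cong[OF this, of Z] have "dfield p (t *\<^sub>R p) (t *\<^sub>R Z) + lfield Z (t *\<^sub>R p) = Z"
    by (simp add: lfield_def dfield_def)
  then show ?thesis by (simp add: linear_scale[OF dfield_linear])
qed

text \<open>
  The differential at the identity of the left translation by \<open>p\<close> inverts \<open>exp_factor p\<close>. Along
  the line through \<open>p\<close> let \<open>c t\<close> be \<open>t\<close> times the series for \<open>t p\<close>, applied to \<open>Y\<close>. Then
  \<open>c' = Y - [p, c]\<close>, and with the commutator formula and the radial identity the error
  \<open>r t = lfield (c t) (t p) - t Y\<close> satisfies \<open>r' = dfield p (t p) r\<close> with \<open>r 0 = 0\<close>, so it vanishes.
\<close>

lemma lfield_exp_factor: "lfield (exp_factor p Y) p = Y"
proof -
  define c where "c t = (\<Sum>k<m. ((- 1) ^ k * t ^ Suc k / fact (Suc k)) *\<^sub>R ((bracket p) ^^ k) Y)" for t :: real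
  define c' where "c' t = (\<Sum>k<m. ((- 1) ^ k * t ^ k / fact k) *\<^sub>R ((bracket p) ^^ k) Y)" for t :: real
  have c_deriv: "(c has_vector_derivative c' t) (at t)" for t
  proof -
    have "((\<lambda>t. ((- 1) ^ k * t ^ Suc k / fact (Suc k)) *\<^sub>R ((bracket p) ^^ k) Y) has_vector_derivative
        ((- 1) ^ k * t ^ k / fact k) *\<^sub>R ((bracket p) ^^ k) Y) (at t)" for k
    proof -
      have "((\<lambda>t. (- 1) ^ k * t ^ Suc k / fact (Suc k)) has_real_derivative (- 1) ^ k * (real (Suc k) * t ^ k) / fact (Suc k)) (at t)"
        using DERIV_pow[of "Suc k" t] by (intro DERIV_cdivide DERIV_cmult) simp
      moreover have "(- 1) ^ k * (real (Suc k) * t ^ k) / fact (Suc k) = (- 1) ^ k * t ^ k / fact k"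
        by (simp add: divide_simps del: of_nat_Suc)
      ultimately have "((\<lambda>t. (- 1) ^ k * t ^ Suc k / fact (Suc k)) has_real_derivative (- 1) ^ k * t ^ k / fact k) (at t)"
        by simp
      from has_vector_derivative_scaleR[OF this has_vector_derivative_const]
      show ?thesis by simp
    qed
    then show ?thesis unfolding c_def c'_def by (intro has_vector_derivative_sum) auto
  qed
  have c'_eq: "c' t = Y - bracket p (c t)" for t
  proof -
    have "bracket p (c t) = (\<Sum>k<m. ((- 1) ^ k * t ^ Suc k / fact (Suc k)) *\<^sub>R ((bracket p) ^^ Suc k) Y)"
      by (simp add: c_def bracket_simps)
    also have "\<dots> = - (\<Sum>k<m. ((- 1) ^ Suc k * t ^ Suc k / fact (Suc k)) *\<^sub>R ((bracket p) ^^ Suc k) Y)"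
      by (simp add: sum_negf[symmetric])
    also have "(\<Sum>k<m. ((- 1) ^ Suc k * t ^ Suc k / fact (Suc k)) *\<^sub>R ((bracket p) ^^ Suc k) Y) =
        (\<Sum>k<Suc m. ((- 1) ^ k * t ^ k / fact k) *\<^sub>R ((bracket p) ^^ k) Y) - Y"
      by (subst sum.lessThan_Suc_shift) simp
    also have "(\<Sum>k<Suc m. ((- 1) ^ k * t ^ k / fact k) *\<^sub>R ((bracket p) ^^ k) Y) = c' t"
      by (simp add: c'_def ad_nilpotent)
    finally show ?thesis by simp
  qed
  define r where "r t = lfield (c t) (t *\<^sub>R p) - t *\<^sub>R Y" for t
  have "r 1 = 0"
  proof (rule linear_ode_zero[of 1 r "\<lambda>t. dfield p (t *\<^sub>R p)"])
    fix t :: real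
    have "((\<lambda>t. D1 (t *\<^sub>R p, 0) (0, c t)) has_derivative
        (\<lambda>h. D2 (0, c t) (t *\<^sub>R p, 0) (h *\<^sub>R p, 0) + D1 (t *\<^sub>R p, 0) (0, h *\<^sub>R c' t))) (at t)"
      by (rule has_derivative_linear_param[OF D1_linear D2, where c = "\<lambda>t. (t *\<^sub>R p, 0)" and w = "\<lambda>t. (0, c t)"])
        (auto intro!: derivative_eq_intros c_deriv[unfolded has_vector_derivative_def])
    then have "((\<lambda>t. lfield (c t) (t *\<^sub>R p)) has_derivative
        (\<lambda>h. dfield (c t) (t *\<^sub>R p) (h *\<^sub>R p) + lfield (h *\<^sub>R c' t) (t *\<^sub>R p))) (at t)"
      by (simp add: lfield_def dfield_def)
    then have "((\<lambda>t. lfield (c t) (t *\<^sub>R p)) has_vector_derivative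
        (dfield (c t) (t *\<^sub>R p) p + lfield (c' t) (t *\<^sub>R p))) (at t)"
      by (simp add: has_vector_derivative_def linear_scale[OF dfield_linear] linear_scale[OF lfield_linear] scaleR_add_right)
    then have "(r has_vector_derivative (dfield (c t) (t *\<^sub>R p) p + lfield (c' t) (t *\<^sub>R p) - Y)) (at t)"
      unfolding r_def by (auto intro!: derivative_eq_intros)
    moreover have "dfield (c t) (t *\<^sub>R p) p + lfield (c' t) (t *\<^sub>R p) - Y = dfield p (t *\<^sub>R p) (r t)"
    proof -
      have a: "dfield (c t) (t *\<^sub>R p) p = lfield (bracket p (c t)) (t *\<^sub>R p) + dfield p (t *\<^sub>R p) (lfield (c t) (t *\<^sub>R p))"
        using lfield_commutator[of "c t" "t *\<^sub>R p" p] by (simp add: lfield_radial algebra_simps)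
      have b: "lfield (c' t) (t *\<^sub>R p) = lfield Y (t *\<^sub>R p) - lfield (bracket p (c t)) (t *\<^sub>R p)"
        by (simp add: c'_eq linear_diff[OF lfield_linear])
      have c: "lfield Y (t *\<^sub>R p) - Y = - t *\<^sub>R dfield p (t *\<^sub>R p) Y"
        using lfield_radial_deriv[of t p Y] by (simp add: algebra_simps)
      show ?thesis
        unfolding a b r_def linear_diff[OF dfield_linear] linear_scale[OF dfield_linear]
        using c by (simp add: algebra_simps)
    qed
    ultimately show "(r has_vector_derivative dfield p (t *\<^sub>R p) (r t)) (at t)" by simp
  next
    show "linear (dfield p (t *\<^sub>R p))" for t by (rule dfield_linear)
    show "continuous_on {0..1} (\<lambda>t. dfield p (t *\<^sub>R p) b)" for b
      unfolding dfield_def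
      by (rule continuous_on_compose2[OF D2_continuous]) (auto intro!: continuous_intros)
    show "r 0 = 0" by (simp add: r_def c_def)
  qed simp
  moreover have "c 1 = exp_factor p Y" by (simp add: c_def exp_factor_def)
  ultimately show ?thesis by (simp add: r_def)
qed

lemma vol_factor_lfield: "vol_factor (\<lambda>X. lfield X p) = 1"
proof -
  have "vol_factor (\<lambda>X. lfield (exp_factor p X) p) = 1"
    by (simp add: lfield_exp_factor)
  moreover have "vol_factor (\<lambda>X. lfield (exp_factor p X) p) = vol_factor (\<lambda>X. lfield X p) * vol_factor (exp_factor p)"
    by (rule vol_factor_compose[OF lfield_linear exp_factor_linear])
  ultimately show ?thesis by (simp add: vol_factor_exp_factor)
qed

text \<open>
  By left invariance the differential at \<open>q\<close> of the translation by \<open>p\<close> maps the frame at \<open>q\<close> to the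
  frame at \<open>p q\<close>, and both frames have determinant one.
\<close>

lemma vol_factor_translation: "vol_factor (\<lambda>h. D1 (p, q) (0, h)) = 1"
proof -
  have "linear (\<lambda>h. D1 (p, q) (0, h))"
    using linear_compose[OF linear_pair2 D1_linear] by (simp add: o_def)
  from vol_factor_compose[OF this lfield_linear]
  have "vol_factor (\<lambda>h. D1 (p, q) (0, h)) * vol_factor (\<lambda>X. lfield X q) =
      vol_factor (\<lambda>X. D1 (p, q) (0, lfield X q))"
    by simp
  then show ?thesis by (simp add: lfield_translate vol_factor_lfield)
qed

lemma left_translation_measure:
  assumes "open U" "bounded U"
  shows "(\<lambda>y. p \<cdot> y) ` U \<in> lmeasurable" "measure lebesgue ((\<lambda>y. p \<cdot> y) ` U) = measure lebesgue U"
    "open ((\<lambda>y. p \<cdot> y) ` U)"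
proof -
  have "(\<lambda>y. p \<cdot> y) ` U = (\<lambda>y. ginv p \<cdot> y) -` U"
  proof (safe)
    fix x assume "ginv p \<cdot> x \<in> U"
    moreover have "p \<cdot> (ginv p \<cdot> x) = x" by (simp add: gmult_assoc[symmetric])
    ultimately show "x \<in> (\<lambda>y. p \<cdot> y) ` U" by (metis imageI)
  qed (simp add: gmult_assoc[symmetric])
  then show op: "open ((\<lambda>y. p \<cdot> y) ` U)"
    using open_vimage[OF assms(1) continuous_on_gmult] by simp
  have inj: "inj_on (\<lambda>y. p \<cdot> y) U"
    by (auto intro!: inj_onI)
  from measure_image_const_vol_factor[OF assms op inj left_translation_derivative vol_factor_translation]
  show "(\<lambda>y. p \<cdot> y) ` U \<in> lmeasurable" "measure lebesgue ((\<lambda>y. p \<cdot> y) ` U) = measure lebesgue U"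
    by auto
qed


lemma norm_inverse_mult:
  assumes "homogeneous_norm G V m \<rho>"
  shows "\<rho> (ginv y \<cdot> x) = \<rho> (ginv x \<cdot> y)"
proof -
  have "ginv (ginv y \<cdot> x) = ginv x \<cdot> y"
    using inv_mult_group[of "ginv y" x] by simp
  then show ?thesis using assms unfolding homogeneous_norm_def by metis
qed

lemma group_ball_eq_translate:
  assumes "homogeneous_norm G V m \<rho>"
  shows "group_ball G \<rho> x r = (\<lambda>y. x \<cdot> y) ` {y. \<rho> y < r}"
proof -
  note norm_inverse_mult[OF assms, of _ x]
  moreover have "x \<cdot> (ginv x \<cdot> y) = y" "ginv x \<cdot> (x \<cdot> y) = y" for y
    by (simp_all add: gmult_assoc[symmetric])
  ultimately show ?thesis
    unfolding group_ball_def by (auto intro!: image_eqI[of _ _ "ginv x \<cdot> _"])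
qed

lemma norm_ball_dilate:
  assumes \<rho>: "homogeneous_norm G V m \<rho>" and r: "r > 0" and s: "s > 0"
  shows "{y. \<rho> y < r} = dil (r / s) ` {y. \<rho> y < s}"
proof -
  have hom: "\<rho> (dil t x) = t * \<rho> x" if "t > 0" for t x
    using \<rho> that by (auto simp: homogeneous_norm_def)
  show ?thesis
  proof (intro Set.set_eqI iffI)
    fix y assume "y \<in> {y. \<rho> y < r}"
    then have "\<rho> (dil (s / r) y) < s" using r s by (simp add: hom field_simps)
    moreover have "y = dil (r / s) (dil (s / r) y)" using r s by (simp add: dil_mult)
    ultimately show "y \<in> dil (r / s) ` {y. \<rho> y < s}" by blast
  next
    fix y assume "y \<in> dil (r / s) ` {y. \<rho> y < s}"
    then show "y \<in> {y. \<rho> y < r}" using r s by (auto simp: hom field_simps)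
  qed
qed

text \<open>
  Let \<open>e > 0\<close> be the minimum of \<open>\<rho>\<close> on the Euclidean unit sphere. A point outside the open unit
  ball is moved to the sphere by some dilation with factor \<open>t \<le> 1\<close>, so \<open>\<rho> \<ge> e\<close> there. Hence
  \<open>{\<rho> < e}\<close> is bounded, and the other balls are its dilates.
\<close>

lemma bounded_norm_ball:
  assumes \<rho>: "homogeneous_norm G V m \<rho>"
  shows "bounded {y. \<rho> y < r}"
proof (cases "r > 0")
  case False
  then have "{y. \<rho> y < r} = {}" using \<rho> by (auto simp: homogeneous_norm_def not_less intro: order_trans)
  then show ?thesis by simp
next
  case r: True
  have hom: "\<rho> (dil t x) = t * \<rho> x" if "t > 0" for t x
    using \<rho> that by (auto simp: homogeneous_norm_def)
  have nonneg: "0 \<le> \<rho> x" and zero: "\<rho> x = 0 \<longleftrightarrow> x = 0" and cont: "continuous_on UNIV \<rho>" for x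
    using \<rho> by (auto simp: homogeneous_norm_def one_eq_0)
  have "sphere (0::'a) 1 \<noteq> {}" by simp
  then obtain z where z: "z \<in> sphere 0 1" "\<And>y. y \<in> sphere 0 1 \<Longrightarrow> \<rho> z \<le> \<rho> y"
    using continuous_attains_inf[OF compact_sphere _ continuous_on_subset[OF cont subset_UNIV]] by metis
  define e where "e = \<rho> z"
  have "z \<noteq> 0" using z by auto
  then have e: "e > 0" using nonneg[of z] zero[of z] by (simp add: e_def less_le)
  have "{y. \<rho> y < e} \<subseteq> ball 0 1"
  proof
    fix y assume "y \<in> {y. \<rho> y < e}"
    then have y: "\<rho> y < e" by simp
    show "y \<in> ball 0 1"
    proof (rule ccontr)
      assume "y \<notin> ball 0 1"
      then have "1 \<le> norm (dil 1 y)" by simp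
      moreover have "norm (dil 0 y) \<le> 1" by simp
      moreover have "continuous_on {0..1} (\<lambda>t. norm (dil t y))"
        by (intro continuous_on_norm continuous_on_dil_scale)
      ultimately obtain t where t: "0 \<le> t" "t \<le> 1" "norm (dil t y) = 1"
        using IVT'[of "\<lambda>t. norm (dil t y)" 0 1 1] by auto
      then have "t \<noteq> 0" by auto
      then have "e \<le> t * \<rho> y" using z(2)[of "dil t y"] t hom[of t y] by (simp add: e_def)
      also have "\<dots> \<le> 1 * \<rho> y" using t nonneg by (intro mult_right_mono) auto
      finally show False using y by simp
    qed
  qed
  then have "bounded {y. \<rho> y < e}" using bounded_ball bounded_subset by blast
  then have "bounded (dil (r / e) ` {y. \<rho> y < e})"
    by (rule bounded_linear_image) (simp add: dil_linear linear_conv_bounded_linear[symmetric])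
  then show ?thesis using norm_ball_dilate[OF \<rho> r e] by simp
qed

lemma open_norm_ball:
  assumes "homogeneous_norm G V m \<rho>"
  shows "open {y. \<rho> y < r}"
  using assms by (auto simp: homogeneous_norm_def intro: open_Collect_less continuous_on_const)

lemma open_group_ball:
  assumes "homogeneous_norm G V m \<rho>"
  shows "open (group_ball G \<rho> x r)"
  unfolding group_ball_eq_translate[OF assms]
  by (intro left_translation_measure(3) open_norm_ball bounded_norm_ball assms)

lemma bounded_group_ball:
  assumes "homogeneous_norm G V m \<rho>"
  shows "bounded (group_ball G \<rho> x r)"
proof -
  have "compact ((\<lambda>y. x \<cdot> y) ` closure {y. \<rho> y < r})"
    using bounded_norm_ball[OF assms, of r]
    by (intro compact_continuous_image continuous_on_subset[OF continuous_on_gmult]) auto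
  then have "bounded ((\<lambda>y. x \<cdot> y) ` closure {y. \<rho> y < r})" by (rule compact_imp_bounded)
  then show ?thesis
    unfolding group_ball_eq_translate[OF assms]
    by (rule bounded_subset) (intro image_mono closure_subset)
qed

lemma measure_group_ball:
  assumes \<rho>: "homogeneous_norm G V m \<rho>" and r: "r > 0"
  shows "measure lebesgue (group_ball G \<rho> x r) = measure lebesgue {y. \<rho> y < 1} * r ^ homogeneous_dim V m"
proof -
  have "measure lebesgue (group_ball G \<rho> x r) = measure lebesgue {y. \<rho> y < r}"
    unfolding group_ball_eq_translate[OF \<rho>]
    by (intro left_translation_measure(2) open_norm_ball bounded_norm_ball \<rho>)
  also have "{y. \<rho> y < r} = dil r ` {y. \<rho> y < 1}"
    using norm_ball_dilate[OF \<rho> r, of 1] by simp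
  also have "measure lebesgue \<dots> = r ^ homogeneous_dim V m * measure lebesgue {y. \<rho> y < 1}"
  proof (rule measure_image_const_vol_factor(2)[where g' = "\<lambda>_. dil r"])
    have "open {y. \<rho> y < r}" by (rule open_norm_ball[OF \<rho>])
    then show "open (dil r ` {y. \<rho> y < 1})" using norm_ball_dilate[OF \<rho> r, of 1] by simp
    show "inj_on (dil r) {y. \<rho> y < 1}"
    proof (rule inj_on_inverseI)
      show "dil (1 / r) (dil r x) = x" for x using r by (simp add: dil_mult)
    qed
    show "(dil r has_derivative dil r) (at x)" for x
      using dil_linear by (intro bounded_linear_imp_has_derivative) (simp add: linear_conv_bounded_linear[symmetric])
  qed (auto intro: open_norm_ball bounded_norm_ball \<rho> vol_factor_dil r)
  finally show ?thesis by simp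
qed

text \<open>
  This number is the constant \<open>c1\<close> in the volume formula.
\<close>

lemma measure_norm_ball_pos:
  assumes \<rho>: "homogeneous_norm G V m \<rho>"
  shows "measure lebesgue {y. \<rho> y < 1} > 0"
proof -
  have "\<not> negligible {y. \<rho> y < 1}"
  proof (rule open_not_negligible[OF open_norm_ball[OF \<rho>]])
    have "\<rho> 0 = 0" using \<rho> by (auto simp: homogeneous_norm_def one_eq_0)
    then show "{y. \<rho> y < 1} \<noteq> {}" by (auto intro!: exI[of _ 0])
  qed
  moreover have "{y. \<rho> y < 1} \<in> lmeasurable"
    by (intro lmeasurable_open open_norm_ball bounded_norm_ball \<rho>)
  ultimately show ?thesis
    by (metis measure_nonneg negligible_iff_measure less_le)
qed

end

section \<open>Young functions\<close>

lemma young_scale: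
  assumes "young_function \<Phi>" "0 \<le> r" "0 \<le> t" "t \<le> 1"
  shows "\<Phi> (t * r) \<le> ennreal t * \<Phi> r"
proof -
  have "\<Phi> ((1 - t) * 0 + t * r) \<le> ennreal (1 - t) * \<Phi> 0 + ennreal t * \<Phi> r"
    using assms unfolding young_function_def by auto
  moreover have "\<Phi> 0 = 0" using assms by (simp add: young_function_def)
  ultimately show ?thesis by simp
qed

lemma young_mono:
  assumes "young_function \<Phi>" "0 \<le> r" "r \<le> s"
  shows "\<Phi> r \<le> \<Phi> s"
proof (cases "s = 0")
  case False
  then have "\<Phi> (r / s * s) \<le> ennreal (r / s) * \<Phi> s"
    using assms by (intro young_scale) auto
  also have "\<dots> \<le> 1 * \<Phi> s"
    using assms by (intro mult_right_mono) (auto simp: ennreal_le_1 divide_le_eq_1)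
  finally show ?thesis using False by simp
qed (use assms in auto)

lemma young_0: "young_function \<Phi> \<Longrightarrow> \<Phi> 0 = 0"
  by (simp add: young_function_def)

lemma young_measurable:
  assumes Y: "young_function \<Phi>" and g: "g \<in> borel_measurable M" and nonneg: "\<And>x. 0 \<le> g x"
  shows "(\<lambda>x. \<Phi> (g x)) \<in> borel_measurable M"
proof (rule borel_measurableI_greater)
  fix a
  have "is_interval {r. 0 \<le> r \<and> a < \<Phi> r}"
    unfolding is_interval_1 using young_mono[OF Y] by (auto intro: less_le_trans)
  then have "{r. 0 \<le> r \<and> a < \<Phi> r} \<in> sets borel"
    by (rule real_interval_borel_measurable)
  from measurable_sets[OF g this]
  show "{x \<in> space M. a < \<Phi> (g x)} \<in> sets M"
    by (rule back_subst[where P = "\<lambda>A. A \<in> sets M"]) (use nonneg in auto)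
qed

lemma young_unbounded:
  assumes "young_function \<Phi>"
  obtains r where "0 < r" "ennreal s < \<Phi> r"
proof -
  have "(\<Phi> \<longlongrightarrow> \<infinity>) at_top" using assms by (simp add: young_function_def)
  then have "\<forall>\<^sub>F r in at_top. ennreal s < \<Phi> r"
    by (rule order_tendstoD) simp
  then have "\<forall>\<^sub>F r in at_top. 0 < r \<and> ennreal s < \<Phi> r"
    using eventually_gt_at_top by (rule eventually_conj[rotated])
  then show ?thesis using that eventually_happens' trivial_limit_at_top_linorder by blast
qed

lemma young_inverse_le:
  assumes "0 \<le> r" "ennreal s < \<Phi> r"
  shows "young_inverse \<Phi> s \<le> r"
  unfolding young_inverse_def using assms by (intro cInf_lower) (auto intro: bdd_belowI[of _ 0])

lemma young_inverse_greatest: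
  assumes "young_function \<Phi>" "\<And>r. 0 \<le> r \<Longrightarrow> ennreal s < \<Phi> r \<Longrightarrow> u \<le> r"
  shows "u \<le> young_inverse \<Phi> s"
proof -
  obtain r where "0 < r" "ennreal s < \<Phi> r" using young_unbounded[OF assms(1)] .
  then show ?thesis
    unfolding young_inverse_def using assms(2) by (intro cInf_greatest) (auto intro: less_imp_le)
qed

lemma young_inverse_nonneg: "young_function \<Phi> \<Longrightarrow> 0 \<le> young_inverse \<Phi> s"
  by (rule young_inverse_greatest) auto

lemma young_inverse_mono:
  assumes "young_function \<Phi>" "s \<le> t"
  shows "young_inverse \<Phi> s \<le> young_inverse \<Phi> t"
  using assms
  by (intro young_inverse_greatest young_inverse_le) (auto intro: le_less_trans ennreal_leI)

lemma young_inverse_pos: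
  assumes "young_function \<Phi>" "0 < s"
  shows "0 < young_inverse \<Phi> s"
proof -
  have "(\<Phi> \<longlongrightarrow> 0) (at_right 0)" using assms by (simp add: young_function_def)
  then have "\<forall>\<^sub>F r in at_right 0. \<Phi> r < ennreal s"
    by (rule order_tendstoD) (use assms in simp)
  then obtain \<delta> where \<delta>: "0 < \<delta>" "\<And>r. 0 < r \<Longrightarrow> r < \<delta> \<Longrightarrow> \<Phi> r < ennreal s"
    by (auto simp: eventually_at_right_field)
  have "\<delta> \<le> young_inverse \<Phi> s"
  proof (rule young_inverse_greatest[OF assms(1)])
    fix r assume "0 \<le> r" "ennreal s < \<Phi> r"
    then show "\<delta> \<le> r"
      using \<delta>(2)[of r] young_0[OF assms(1)] by (cases "r = 0") (force simp: not_less)+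
  qed
  then show ?thesis using \<delta>(1) by simp
qed

lemma young_young_inverse:
  assumes "young_function \<Phi>"
  shows "\<Phi> (young_inverse \<Phi> s) \<le> ennreal s"
proof (cases "young_inverse \<Phi> s = 0")
  case True
  then show ?thesis by (simp add: young_0[OF assms])
next
  case False
  let ?u = "young_inverse \<Phi> s"
  have pos: "0 < ?u" using False young_inverse_nonneg[OF assms, of s] by simp
  then have "(\<Phi> \<longlongrightarrow> \<Phi> ?u) (at_left ?u)" using assms by (simp add: young_function_def)
  moreover have "\<forall>\<^sub>F r in at_left ?u. \<Phi> r \<le> ennreal s"
  proof -
    have "\<Phi> r \<le> ennreal s" if "0 < r" "r < ?u" for r
      using young_inverse_le[of r s \<Phi>] that by (meson less_imp_le not_less)
    then show ?thesis using pos by (auto simp: eventually_at_left_field)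
  qed
  ultimately show ?thesis by (intro tendsto_upperbound) auto
qed

lemma le_young_inverse_young:
  assumes "young_function \<Phi>" "0 \<le> u" "\<Phi> u < \<infinity>"
  shows "u \<le> young_inverse \<Phi> (enn2real (\<Phi> u))"
proof (rule young_inverse_greatest[OF assms(1)])
  fix r assume "0 \<le> r" "ennreal (enn2real (\<Phi> u)) < \<Phi> r"
  then have "\<Phi> u < \<Phi> r" using assms(3) by simp
  then show "u \<le> r" using young_mono[OF assms(1) \<open>0 \<le> r\<close>, of u] by (meson not_less nle_le)
qed

text \<open>
  Above \<open>r\<close> the convex function \<open>\<Phi>\<close> lies above the line through the origin with slope \<open>t / r\<close>. This
  takes the place of Young's inequality for a conjugate pair.
\<close>

lemma young_linear_bound:
  assumes Y: "young_function \<Phi>" and r: "0 \<le> r" "ennreal t < \<Phi> r" and u: "0 \<le> u" and t: "0 \<le> t"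
  shows "ennreal (u * t) \<le> ennreal (r * t) + ennreal r * \<Phi> u"
proof (cases "u \<le> r")
  case True
  then have "ennreal (u * t) \<le> ennreal (r * t)" using t by (intro ennreal_leI mult_right_mono)
  then show ?thesis by (rule add_increasing2[rotated]) simp
next
  case False
  then have "u > 0" using r by simp
  have "\<Phi> (r / u * u) \<le> ennreal (r / u) * \<Phi> u"
    using False r by (intro young_scale[OF Y]) auto
  then have "ennreal t \<le> ennreal (r / u) * \<Phi> u" using r(2) \<open>u > 0\<close> by simp
  then have "ennreal u * ennreal t \<le> ennreal u * (ennreal (r / u) * \<Phi> u)"
    by (intro mult_left_mono) auto
  also have "\<dots> = ennreal (u * (r / u)) * \<Phi> u"
    using r \<open>u > 0\<close> by (subst ennreal_mult) (auto simp: mult.assoc)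
  finally have "ennreal (u * t) \<le> ennreal r * \<Phi> u"
    using \<open>u > 0\<close> t by (simp add: ennreal_mult)
  then show ?thesis by (rule add_increasing[rotated]) simp
qed

text \<open>
  Hoelder's inequality against an indicator. For each \<open>r\<close> with \<open>\<Phi> r > 1 / \<bar>A\<bar>\<close> the preceding
  bound, integrated over \<open>A\<close>, estimates the average of \<open>\<bar>g\<bar> / l\<close> by \<open>2 r\<close>; the infimum of such \<open>r\<close> is
  the value of the inverse function.
\<close>

lemma orlicz_average_le:
  assumes Y: "young_function \<Phi>" and A: "A \<in> lmeasurable" "0 < measure lebesgue A"
    and g: "(\<lambda>x. g x * indicator A x) \<in> borel_measurable lebesgue"
    and l: "0 < l" and modular: "(\<integral>\<^sup>+x\<in>A. \<Phi> (\<bar>g x\<bar> / l) \<partial>lebesgue) \<le> 1"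
  shows "(\<integral>\<^sup>+x\<in>A. ennreal \<bar>g x\<bar> \<partial>lebesgue) \<le>
    ennreal (2 * measure lebesgue A * young_inverse \<Phi> (1 / measure lebesgue A) * l)"
proof -
  define v where "v = measure lebesgue A"
  have v: "0 < v" "emeasure lebesgue A = ennreal v"
    using A by (auto simp: v_def emeasure_eq_measure2)
  have meas\<Phi>: "(\<lambda>x. \<Phi> (\<bar>g x\<bar> / l) * indicator A x) \<in> borel_measurable lebesgue"
  proof -
    have "(\<lambda>x. \<Phi> (\<bar>g x * indicator A x\<bar> / l)) \<in> borel_measurable lebesgue"
      using l g by (intro young_measurable[OF Y]) auto
    then show ?thesis
      by (rule back_subst[where P = "\<lambda>f. f \<in> borel_measurable lebesgue"])
        (auto simp: fun_eq_iff indicator_def young_0[OF Y])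
  qed
  define I where "I = (\<integral>\<^sup>+x\<in>A. ennreal \<bar>g x\<bar> \<partial>lebesgue)"
  have bound: "I \<le> ennreal (2 * v * l * r)" if r: "0 \<le> r" "ennreal (1 / v) < \<Phi> r" for r
  proof -
    have "ennreal (1 / (l * v)) * I = (\<integral>\<^sup>+x. ennreal (1 / (l * v)) * (ennreal \<bar>g x\<bar> * indicator A x) \<partial>lebesgue)"
    proof -
      have "(\<lambda>x. ennreal \<bar>g x\<bar> * indicator A x) \<in> borel_measurable lebesgue"
      proof -
        have "(\<lambda>x. ennreal \<bar>g x * indicator A x\<bar>) \<in> borel_measurable lebesgue" using g by measurable
        then show ?thesis
          by (rule back_subst[where P = "\<lambda>f. f \<in> borel_measurable lebesgue"])
            (auto simp: fun_eq_iff indicator_def)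
      qed
      then show ?thesis unfolding I_def by (simp add: nn_integral_cmult)
    qed
    also have "\<dots> \<le> (\<integral>\<^sup>+x. ennreal (r * (1 / v)) * indicator A x + ennreal r * (\<Phi> (\<bar>g x\<bar> / l) * indicator A x) \<partial>lebesgue)"
    proof (rule nn_integral_mono)
      fix x
      have "ennreal (1 / (l * v)) * ennreal \<bar>g x\<bar> = ennreal (\<bar>g x\<bar> / l * (1 / v))"
        using l v by (simp add: ennreal_mult'[symmetric])
      also have "\<dots> \<le> ennreal (r * (1 / v)) + ennreal r * \<Phi> (\<bar>g x\<bar> / l)"
        using r l v by (intro young_linear_bound[OF Y]) auto
      finally show "ennreal (1 / (l * v)) * (ennreal \<bar>g x\<bar> * indicator A x) \<le>
          ennreal (r * (1 / v)) * indicator A x + ennreal r * (\<Phi> (\<bar>g x\<bar> / l) * indicator A x)"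
        by (auto simp: indicator_def)
    qed
    also have "\<dots> = ennreal (r * (1 / v)) * emeasure lebesgue A + ennreal r * (\<integral>\<^sup>+x\<in>A. \<Phi> (\<bar>g x\<bar> / l) \<partial>lebesgue)"
      using meas\<Phi> A by (subst nn_integral_add) (auto simp: nn_integral_cmult nn_integral_cmult_indicator)
    also have "\<dots> \<le> ennreal (r * (1 / v)) * ennreal v + ennreal r * 1"
      using modular by (intro add_mono mult_left_mono) (auto simp: v)
    also have "\<dots> = ennreal (2 * r)"
      using v r by (simp add: ennreal_mult'[symmetric] ennreal_plus[symmetric] del: ennreal_plus)
    finally have "ennreal (l * v) * (ennreal (1 / (l * v)) * I) \<le> ennreal (l * v) * ennreal (2 * r)"
      by (intro mult_left_mono) auto
    moreover have "ennreal (l * v) * (ennreal (1 / (l * v)) * I) = I"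
      using l v by (simp add: mult.assoc[symmetric] ennreal_mult'[symmetric])
    ultimately show ?thesis
      using l v r by (simp add: ennreal_mult'[symmetric] mult_ac)
  qed
  obtain r0 where r0: "0 < r0" "ennreal (1 / v) < \<Phi> r0" using young_unbounded[OF Y] .
  have I_fin: "I < \<infinity>" using bound[of r0] r0 by (simp add: le_less_trans)
  have "enn2real I / (2 * v * l) \<le> young_inverse \<Phi> (1 / v)"
  proof (rule young_inverse_greatest[OF Y])
    fix r assume r: "0 \<le> r" "ennreal (1 / v) < \<Phi> r"
    have "enn2real I \<le> 2 * v * l * r"
      using bound[OF r] r v l by (simp add: enn2real_leI)
    then show "enn2real I / (2 * v * l) \<le> r" using v l by (simp add: divide_simps mult_ac)
  qed
  then have "enn2real I \<le> 2 * v * young_inverse \<Phi> (1 / v) * l"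
    using v l by (simp add: divide_simps mult_ac)
  then have "ennreal (enn2real I) \<le> ennreal (2 * v * young_inverse \<Phi> (1 / v) * l)" by (rule ennreal_leI)
  then show ?thesis using I_fin by (simp add: I_def v_def)
qed

section \<open>Balls and the maximal function\<close>

(* keeps the measure of a ball from being rewritten to that of a Borel representative *)
declare emeasure_completion [simp del]

text \<open>
  What the analysis uses about the group. The assumptions are stated for \<open>G\<close> and \<open>\<rho>\<close>, without the
  group laws, so that the sharp maximal function and the other notions defined from \<open>G\<close> and \<open>\<rho>\<close>
  can be used as they are.
\<close>

locale ball_geometry =
  fixes G :: "'a::euclidean_space monoid" and \<rho> :: "'a \<Rightarrow> real" and Q :: nat and c0 c1 :: real
  assumes dist_nonneg: "0 \<le> \<rho> (inv\<^bsub>G\<^esub> y \<otimes>\<^bsub>G\<^esub> x)"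
    and dist_eq_0: "\<rho> (inv\<^bsub>G\<^esub> y \<otimes>\<^bsub>G\<^esub> x) = 0 \<longleftrightarrow> x = y"
    and dist_sym: "\<rho> (inv\<^bsub>G\<^esub> y \<otimes>\<^bsub>G\<^esub> x) = \<rho> (inv\<^bsub>G\<^esub> x \<otimes>\<^bsub>G\<^esub> y)"
    and dist_triangle: "\<rho> (inv\<^bsub>G\<^esub> z \<otimes>\<^bsub>G\<^esub> x) \<le>
      c0 * (\<rho> (inv\<^bsub>G\<^esub> y \<otimes>\<^bsub>G\<^esub> x) + \<rho> (inv\<^bsub>G\<^esub> z \<otimes>\<^bsub>G\<^esub> y))"
    and c0: "1 \<le> c0" and c1: "0 < c1" and Q: "0 < Q"
    and open_ball': "open (group_ball G \<rho> x r)"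
    and bounded_ball': "bounded (group_ball G \<rho> x r)"
    and measure_ball: "0 < r \<Longrightarrow> measure lebesgue (group_ball G \<rho> x r) = c1 * r ^ Q"
begin

definition qd :: "'a \<Rightarrow> 'a \<Rightarrow> real" where "qd x y = \<rho> (inv\<^bsub>G\<^esub> y \<otimes>\<^bsub>G\<^esub> x)"

abbreviation vol :: "'a set \<Rightarrow> real" where "vol \<equiv> measure lebesgue"

abbreviation B :: "'a \<Rightarrow> real \<Rightarrow> 'a set" where "B \<equiv> group_ball G \<rho>"

lemma qd_nonneg: "0 \<le> qd x y" and qd_eq_0: "qd x y = 0 \<longleftrightarrow> x = y"
  and qd_sym: "qd x y = qd y x" and qd_triangle: "qd x z \<le> c0 * (qd x y + qd y z)"
  using dist_nonneg dist_eq_0 dist_sym dist_triangle unfolding qd_def by blast+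

lemma mem_B: "y \<in> B x r \<longleftrightarrow> qd x y < r"
  by (simp add: group_ball_def qd_def)

lemma qd_triangle_less:
  assumes "qd x y < a" "qd y z < b"
  shows "qd x z < c0 * (a + b)"
proof -
  have "qd x z \<le> c0 * (qd x y + qd y z)" by (rule qd_triangle)
  also have "\<dots> < c0 * (a + b)" using assms c0 by simp
  finally show ?thesis .
qed

lemma centre_mem_B: "0 < r \<Longrightarrow> x \<in> B x r"
  using qd_eq_0[of x x] by (simp add: mem_B)

lemma B_lmeasurable: "B x r \<in> lmeasurable"
  by (intro lmeasurable_open open_ball' bounded_ball')

lemma B_sets [measurable, simp]: "B x r \<in> sets lebesgue"
  using B_lmeasurable by auto

lemma emeasure_B: "0 < r \<Longrightarrow> emeasure lebesgue (B x r) = ennreal (c1 * r ^ Q)"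
  using emeasure_eq_measure2[OF B_lmeasurable, of x r] measure_ball[of r x] by simp

lemma measure_B_pos: "0 < r \<Longrightarrow> 0 < vol (B x r)"
  using c1 by (simp add: measure_ball)

text \<open>
  The enlargement factor in the covering lemma, see \<open>engulf\<close>.
\<close>

definition dil_const :: real where "dil_const = c0 * (1 + 2 * c0)"

lemma dil_const: "1 \<le> dil_const"
proof -
  have "1 * 1 \<le> c0 * (1 + 2 * c0)" using c0 by (intro mult_mono) auto
  then show ?thesis by (simp add: dil_const_def)
qed

lemma engulf:
  assumes "B x r \<inter> B y s \<noteq> {}" "r \<le> s"
  shows "B x r \<subseteq> B y (dil_const * s)"
proof
  fix w assume w: "w \<in> B x r"
  obtain z where z: "z \<in> B x r" "z \<in> B y s" using assms by auto
  have "qd z w < c0 * (r + r)"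
    using z w by (intro qd_triangle_less[of _ x]) (auto simp: mem_B qd_sym)
  also have "\<dots> \<le> c0 * (s + s)" using assms c0 by simp
  finally have "qd y w < c0 * (s + c0 * (s + s))"
    using z by (intro qd_triangle_less[of y z]) (auto simp: mem_B)
  then show "w \<in> B y (dil_const * s)" by (simp add: mem_B dil_const_def algebra_simps)
qed

text \<open>
  Vitali's greedy selection: take a ball of maximal radius, discard the balls that meet it
  (they lie in its enlargement), and continue with the rest.
\<close>

lemma vitali_finite:
  assumes "finite I"
  shows "\<exists>J\<subseteq>I. disjoint_family_on (\<lambda>p. B (fst p) (snd p)) J \<and>
    (\<forall>p\<in>I. \<exists>q\<in>J. B (fst p) (snd p) \<subseteq> B (fst q) (dil_const * snd q))"
  using assms
proof (induction "card I" arbitrary: I rule: less_induct)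
  case less
  show ?case
  proof (cases "I = {}")
    case False
    define R where "R = Max (snd ` I)"
    have "R \<in> snd ` I" unfolding R_def using less False by (intro Max_in) auto
    then obtain q where q: "q \<in> I" "snd q = R" by auto
    have R: "snd p \<le> R" if "p \<in> I" for p
      unfolding R_def using less that by (intro Max_ge) auto
    define I' where "I' = {p\<in>I. B (fst p) (snd p) \<inter> B (fst q) R = {}} - {q}"
    have "I' \<subseteq> I - {q}" by (auto simp: I'_def)
    then have "card I' \<le> card (I - {q})" using less(2) by (intro card_mono) auto
    also have "\<dots> < card I" using less(2) q by (intro card_Diff1_less)
    finally have "card I' < card I" .
    moreover have "finite I'" using less(2) by (auto simp: I'_def)
    ultimately have "\<exists>J\<subseteq>I'. disjoint_family_on (\<lambda>p. B (fst p) (snd p)) J \<and>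
        (\<forall>p\<in>I'. \<exists>q\<in>J. B (fst p) (snd p) \<subseteq> B (fst q) (dil_const * snd q))"
      by (rule less(1))
    then obtain J where J: "J \<subseteq> I'" "disjoint_family_on (\<lambda>p. B (fst p) (snd p)) J"
      "\<And>p. p \<in> I' \<Longrightarrow> \<exists>q\<in>J. B (fst p) (snd p) \<subseteq> B (fst q) (dil_const * snd q)"
      by blast
    have disj: "B (fst p) (snd p) \<inter> B (fst q) R = {}" if "p \<in> J" for p
      using that J(1) by (auto simp: I'_def)
    show ?thesis
    proof (intro exI[of _ "insert q J"] conjI ballI)
      show "insert q J \<subseteq> I" using J(1) q by (auto simp: I'_def)
      show "disjoint_family_on (\<lambda>p. B (fst p) (snd p)) (insert q J)"
        using J(2) disj q unfolding disjoint_family_on_def by (auto simp: Int_commute)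
    next
      fix p assume p: "p \<in> I"
      show "\<exists>q\<in>insert q J. B (fst p) (snd p) \<subseteq> B (fst q) (dil_const * snd q)"
      proof (cases "p \<in> I'")
        case True
        then show ?thesis using J(3) by blast
      next
        case False
        have "B (fst p) (snd p) \<subseteq> B (fst q) (dil_const * R)"
        proof (cases "B (fst p) (snd p) = {}")
          case ne: False
          then have "B (fst p) (snd p) \<inter> B (fst q) R \<noteq> {}" using False p q by (auto simp: I'_def)
          then show ?thesis using R[OF p] by (rule engulf)
        qed auto
        then show ?thesis using q by auto
      qed
    qed
  qed (auto simp: disjoint_family_on_def)
qed

lemma vitali_compact:
  assumes C: "compact C" and p: "\<And>x. x \<in> C \<Longrightarrow> x \<in> B (fst (p x)) (snd (p x))"
  obtains J where "finite J" "J \<subseteq> p ` C" "disjoint_family_on (\<lambda>q. B (fst q) (snd q)) J"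
    "C \<subseteq> (\<Union>q\<in>J. B (fst q) (dil_const * snd q))"
proof -
  obtain D where D: "D \<subseteq> C" "finite D" "C \<subseteq> (\<Union>x\<in>D. B (fst (p x)) (snd (p x)))"
  proof (rule compactE_image[OF C, of C "\<lambda>x. B (fst (p x)) (snd (p x))"])
    show "C \<subseteq> (\<Union>x\<in>C. B (fst (p x)) (snd (p x)))" using p by blast
  qed (auto intro: open_ball')
  obtain J where J: "J \<subseteq> p ` D" "disjoint_family_on (\<lambda>q. B (fst q) (snd q)) J"
    "\<And>i. i \<in> p ` D \<Longrightarrow> \<exists>q\<in>J. B (fst i) (snd i) \<subseteq> B (fst q) (dil_const * snd q)"
    using vitali_finite[OF finite_imageI[OF D(2), of p]] by blast
  show ?thesis
  proof (rule that[OF _ _ J(2)])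
    show "finite J" using J(1) D(2) by (meson finite_imageI finite_subset)
    show "J \<subseteq> p ` C" using J(1) D(1) by blast
    show "C \<subseteq> (\<Union>q\<in>J. B (fst q) (dil_const * snd q))"
    proof
      fix x assume "x \<in> C"
      then obtain x' where x': "x' \<in> D" "x \<in> B (fst (p x')) (snd (p x'))" using D(3) by auto
      then obtain q where "q \<in> J" "B (fst (p x')) (snd (p x')) \<subseteq> B (fst q) (dil_const * snd q)"
        using J(3)[of "p x'"] by blast
      then show "x \<in> (\<Union>q\<in>J. B (fst q) (dil_const * snd q))" using x' by blast
    qed
  qed
qed

text \<open>
  The uncentred maximal function.
\<close>

definition maxfun :: "('a \<Rightarrow> ennreal) \<Rightarrow> 'a \<Rightarrow> ennreal" where
  "maxfun h x = (SUP (z, r)\<in>{(z, r). 0 < r \<and> x \<in> B z r}.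
     (\<integral>\<^sup>+y\<in>B z r. h y \<partial>lebesgue) / emeasure lebesgue (B z r))"

lemma maxfun_upper:
  assumes "0 < r" "x \<in> B z r"
  shows "(\<integral>\<^sup>+y\<in>B z r. h y \<partial>lebesgue) / emeasure lebesgue (B z r) \<le> maxfun h x"
  unfolding maxfun_def using assms by (intro SUP_upper2[of "(z, r)"]) auto

lemma maxfun_least:
  assumes "\<And>z r. 0 < r \<Longrightarrow> x \<in> B z r \<Longrightarrow>
    (\<integral>\<^sup>+y\<in>B z r. h y \<partial>lebesgue) / emeasure lebesgue (B z r) \<le> X"
  shows "maxfun h x \<le> X"
  unfolding maxfun_def using assms by (intro SUP_least) auto

lemma less_maxfunE:
  assumes "t < maxfun h x"
  obtains z r where "0 < r" "x \<in> B z r" "t * emeasure lebesgue (B z r) \<le> (\<integral>\<^sup>+y\<in>B z r. h y \<partial>lebesgue)"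
    "B z r \<subseteq> {x. t < maxfun h x}"
proof -
  from assms obtain z r where zr: "0 < r" "x \<in> B z r"
    "t < (\<integral>\<^sup>+y\<in>B z r. h y \<partial>lebesgue) / emeasure lebesgue (B z r)"
    unfolding maxfun_def less_SUP_iff by auto
  have "t * emeasure lebesgue (B z r) \<le>
      (\<integral>\<^sup>+y\<in>B z r. h y \<partial>lebesgue) / emeasure lebesgue (B z r) * emeasure lebesgue (B z r)"
    by (rule mult_right_mono[OF less_imp_le[OF zr(3)]]) simp
  also have "\<dots> = (\<integral>\<^sup>+y\<in>B z r. h y \<partial>lebesgue)"
    using zr(1) c1 by (simp add: emeasure_B ennreal_divide_times divide_ennreal)
  finally have 1: "t * emeasure lebesgue (B z r) \<le> (\<integral>\<^sup>+y\<in>B z r. h y \<partial>lebesgue)" .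
  have "B z r \<subseteq> {x. t < maxfun h x}"
    using zr maxfun_upper[of r _ z h] by (auto intro: less_le_trans)
  with 1 zr that show ?thesis by blast
qed

lemma open_maxfun_greater: "open {x. t < maxfun h x}"
proof (subst open_subopen, intro ballI)
  fix x assume "x \<in> {x. t < maxfun h x}"
  then have "t < maxfun h x" by simp
  then obtain z r where "x \<in> B z r" "B z r \<subseteq> {x. t < maxfun h x}"
    by (rule less_maxfunE)
  then show "\<exists>T. open T \<and> x \<in> T \<and> T \<subseteq> {x. t < maxfun h x}"
    using open_ball' by blast
qed

lemma maxfun_measurable [measurable]: "maxfun h \<in> borel_measurable lebesgue"
proof (rule borel_measurableI_greater)
  fix t :: ennreal
  have "{x. t < maxfun h x} \<in> sets lebesgue" using open_maxfun_greater by auto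
  then show "{x \<in> space lebesgue. t < maxfun h x} \<in> sets lebesgue" by simp
qed

text \<open>
  The superlevel set is a union of balls on which the average of \<open>h\<close> is at least \<open>t\<close>. A compact
  subset is covered by the enlargements of finitely many disjoint balls of this kind. The open
  set itself is exhausted by compact sets.
\<close>

lemma weak_type_maxfun:
  assumes h: "h \<in> borel_measurable lebesgue"
  shows "t * emeasure lebesgue {x. t < maxfun h x} \<le> ennreal (dil_const ^ Q) * (\<integral>\<^sup>+y. h y \<partial>lebesgue)"
proof -
  let ?U = "{x. t < maxfun h x}"
  have compact_bound: "t * emeasure lebesgue C \<le> ennreal (dil_const ^ Q) * (\<integral>\<^sup>+y. h y \<partial>lebesgue)"
    if C: "compact C" "C \<subseteq> ?U" for C
  proof -
    have "\<exists>p. 0 < snd p \<and> x \<in> B (fst p) (snd p) \<and>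
        t * emeasure lebesgue (B (fst p) (snd p)) \<le> (\<integral>\<^sup>+y\<in>B (fst p) (snd p). h y \<partial>lebesgue)" if "x \<in> C" for x
    proof -
      have "t < maxfun h x" using C(2) that by auto
      then obtain z r where "0 < r" "x \<in> B z r" "t * emeasure lebesgue (B z r) \<le> (\<integral>\<^sup>+y\<in>B z r. h y \<partial>lebesgue)"
        by (rule less_maxfunE)
      then show ?thesis by (intro exI[of _ "(z, r)"]) auto
    qed
    then obtain p where p: "\<And>x. x \<in> C \<Longrightarrow> 0 < snd (p x) \<and> x \<in> B (fst (p x)) (snd (p x)) \<and>
        t * emeasure lebesgue (B (fst (p x)) (snd (p x))) \<le> (\<integral>\<^sup>+y\<in>B (fst (p x)) (snd (p x)). h y \<partial>lebesgue)"
      by metis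
    obtain J where finJ: "finite J" and J: "J \<subseteq> p ` C" "disjoint_family_on (\<lambda>q. B (fst q) (snd q)) J"
      "C \<subseteq> (\<Union>q\<in>J. B (fst q) (dil_const * snd q))"
      using vitali_compact[OF C(1), of p] p by blast
    have Jpos: "0 < snd q"
      "t * emeasure lebesgue (B (fst q) (snd q)) \<le> (\<integral>\<^sup>+y\<in>B (fst q) (snd q). h y \<partial>lebesgue)"
      if "q \<in> J" for q
      using J(1) p that by blast+
    have "emeasure lebesgue C \<le> emeasure lebesgue (\<Union>j\<in>J. B (fst j) (dil_const * snd j))"
      by (intro emeasure_mono sets.finite_UN finJ J(3)) auto
    also have "\<dots> \<le> (\<Sum>j\<in>J. emeasure lebesgue (B (fst j) (dil_const * snd j)))"
      using finJ by (intro emeasure_subadditive_finite) auto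
    also have "\<dots> = (\<Sum>j\<in>J. ennreal (dil_const ^ Q) * emeasure lebesgue (B (fst j) (snd j)))"
    proof (rule sum.cong[OF refl])
      fix j assume "j \<in> J"
      then have "0 < snd j" using Jpos by blast
      then show "emeasure lebesgue (B (fst j) (dil_const * snd j)) =
          ennreal (dil_const ^ Q) * emeasure lebesgue (B (fst j) (snd j))"
        using dil_const c1 by (simp add: emeasure_B ennreal_mult'[symmetric] power_mult_distrib mult_ac)
    qed
    finally have "t * emeasure lebesgue C \<le>
        t * (\<Sum>j\<in>J. ennreal (dil_const ^ Q) * emeasure lebesgue (B (fst j) (snd j)))"
      by (rule mult_left_mono) simp
    also have "\<dots> = ennreal (dil_const ^ Q) * (\<Sum>j\<in>J. t * emeasure lebesgue (B (fst j) (snd j)))"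
      by (simp add: sum_distrib_left mult_ac)
    also have "\<dots> \<le> ennreal (dil_const ^ Q) * (\<Sum>j\<in>J. \<integral>\<^sup>+y\<in>B (fst j) (snd j). h y \<partial>lebesgue)"
      using Jpos by (intro mult_left_mono sum_mono) auto
    also have "(\<Sum>j\<in>J. \<integral>\<^sup>+y\<in>B (fst j) (snd j). h y \<partial>lebesgue) =
        (\<integral>\<^sup>+y. (\<Sum>j\<in>J. h y * indicator (B (fst j) (snd j)) y) \<partial>lebesgue)"
      using h by (intro nn_integral_sum[symmetric]) auto
    also have "\<dots> \<le> (\<integral>\<^sup>+y. h y \<partial>lebesgue)"
    proof (rule nn_integral_mono)
      fix y
      have "(\<Sum>j\<in>J. indicator (B (fst j) (snd j)) y :: ennreal) = indicator (\<Union>j\<in>J. B (fst j) (snd j)) y"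
        using J(2) finJ by (intro indicator_UN_disjoint[symmetric]) auto
      also have "\<dots> \<le> 1" by (simp add: indicator_def)
      finally have "h y * (\<Sum>j\<in>J. indicator (B (fst j) (snd j)) y) \<le> h y * 1"
        by (intro mult_left_mono) auto
      then show "(\<Sum>j\<in>J. h y * indicator (B (fst j) (snd j)) y) \<le> h y"
        by (simp add: sum_distrib_left)
    qed
    finally show ?thesis by (simp add: mult_left_mono)
  qed
  obtain C where C: "\<And>n. compact (C n)" "\<And>n. C n \<subseteq> ?U" "\<And>n. C n \<subseteq> interior (C (Suc n))" "\<Union>(range C) = ?U"
    by (rule open_Union_compact_subsets[OF open_maxfun_greater, of t h]) (rule that; assumption)
  have "incseq C" using C(3) interior_subset by (intro incseq_SucI) blast
  then have "(SUP n. emeasure lebesgue (C n)) = emeasure lebesgue (\<Union>n. C n)"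
    using fmeasurableD[OF lmeasurable_compact[OF C(1)]] by (intro SUP_emeasure_incseq) auto
  then have "t * emeasure lebesgue ?U = t * (SUP n. emeasure lebesgue (C n))"
    using C(4) by simp
  also have "\<dots> = (SUP n. t * emeasure lebesgue (C n))"
    by (rule SUP_mult_left_ennreal)
  also have "\<dots> \<le> ennreal (dil_const ^ Q) * (\<integral>\<^sup>+y. h y \<partial>lebesgue)"
    by (intro SUP_least compact_bound C)
  finally show ?thesis .
qed

lemma AE_finite_of_small_superlevel_sets:
  assumes f: "f \<in> borel_measurable lebesgue"
    and bound: "\<And>n::nat. emeasure lebesgue {x. g n < f x} \<le> X n" and g: "\<And>n. g n < \<infinity>"
    and X: "X \<longlonglongrightarrow> (0::ennreal)"
  shows "AE x in lebesgue. f x < (\<infinity>::ennreal)"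
proof -
  have "emeasure lebesgue {x. f x = \<infinity>} \<le> X n" for n
  proof -
    have "{x. g n < f x} \<in> sets lebesgue"
      using measurable_sets[OF f, of "{g n<..}"] by (simp add: vimage_def)
    then have "emeasure lebesgue {x. f x = \<infinity>} \<le> emeasure lebesgue {x. g n < f x}"
      using g by (intro emeasure_mono) auto
    then show ?thesis using bound[of n] by (rule order_trans)
  qed
  then have "emeasure lebesgue {x. f x = \<infinity>} \<le> 0"
    using X by (intro LIMSEQ_le_const[OF X]) auto
  moreover have "{x. f x = \<infinity>} \<in> sets lebesgue"
    using measurable_sets[OF f, of "{\<infinity>}"] by (simp add: vimage_def)
  ultimately have "{x. f x = \<infinity>} \<in> null_sets lebesgue" by auto
  then have "AE x in lebesgue. x \<notin> {x. f x = \<infinity>}" by (rule AE_not_in)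
  then show ?thesis by (rule eventually_mono) (simp add: top.not_eq_extremum)
qed

lemma maxfun_finite_integrable:
  assumes h: "h \<in> borel_measurable lebesgue" and fin: "(\<integral>\<^sup>+y. h y \<partial>lebesgue) < \<infinity>"
  shows "AE x in lebesgue. maxfun h x < \<infinity>"
proof (rule AE_finite_of_small_superlevel_sets[OF maxfun_measurable])
  define I where "I = enn2real (\<integral>\<^sup>+y. h y \<partial>lebesgue)"
  have I: "(\<integral>\<^sup>+y. h y \<partial>lebesgue) = ennreal I" "0 \<le> I" using fin by (auto simp: I_def)
  show "emeasure lebesgue {x. ennreal (real (Suc n)) < maxfun h x} \<le> ennreal (dil_const ^ Q * I * inverse (real (Suc n)))" for n
  proof -
    have "ennreal (real (Suc n)) * emeasure lebesgue {x. ennreal (real (Suc n)) < maxfun h x} \<le> ennreal (dil_const ^ Q * I)"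
      using weak_type_maxfun[OF h, of "ennreal (real (Suc n))"] I dil_const by (simp add: ennreal_mult'[symmetric] del: of_nat_Suc)
    then have "ennreal (inverse (real (Suc n))) * (ennreal (real (Suc n)) * emeasure lebesgue {x. ennreal (real (Suc n)) < maxfun h x}) \<le>
        ennreal (inverse (real (Suc n))) * ennreal (dil_const ^ Q * I)"
      by (rule mult_left_mono) simp
    also have "\<dots> = ennreal (dil_const ^ Q * I * inverse (real (Suc n)))"
      using I dil_const by (subst ennreal_mult'[symmetric]) (auto simp: mult.commute)
    also have "ennreal (inverse (real (Suc n))) * (ennreal (real (Suc n)) * emeasure lebesgue {x. ennreal (real (Suc n)) < maxfun h x}) =
        emeasure lebesgue {x. ennreal (real (Suc n)) < maxfun h x}"
      by (subst mult.assoc[symmetric], subst ennreal_mult'[symmetric]) (auto simp del: of_nat_Suc)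
    finally show ?thesis .
  qed
  show "(\<lambda>n. ennreal (dil_const ^ Q * I * inverse (real (Suc n)))) \<longlonglongrightarrow> 0"
    using tendsto_ennrealI[OF tendsto_mult_right_zero[OF LIMSEQ_inverse_real_of_nat, of "dil_const ^ Q * I"]] by simp
qed simp

text \<open>
  Values of \<open>h\<close> below \<open>s\<close> contribute at most \<open>s\<close> to the maximal function, so only the part of \<open>h\<close>
  above \<open>s\<close> matters at height \<open>2 s\<close>.
\<close>

lemma weak_type_maxfun_truncated:
  assumes h: "h \<in> borel_measurable lebesgue" and s: "0 \<le> s"
  shows "ennreal s * emeasure lebesgue {x. ennreal (2 * s) < maxfun (\<lambda>y. ennreal (h y)) x} \<le>
    ennreal (dil_const ^ Q) * (\<integral>\<^sup>+y\<in>{y. s < h y}. ennreal (h y) \<partial>lebesgue)"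
proof -
  define h1 where "h1 y = ennreal (h y) * indicator {y. s < h y} y" for y
  have meas: "{y. s < h y} \<in> sets lebesgue"
    using borel_measurable_less[OF borel_measurable_const h, of s] by simp
  then have h1: "h1 \<in> borel_measurable lebesgue" unfolding h1_def using h by simp
  have le: "maxfun (\<lambda>y. ennreal (h y)) x \<le> maxfun h1 x + ennreal s" for x
  proof (rule maxfun_least)
    fix z r assume zr: "0 < r" "x \<in> B z r"
    have "(\<integral>\<^sup>+y\<in>B z r. ennreal (h y) \<partial>lebesgue) \<le> (\<integral>\<^sup>+y. h1 y * indicator (B z r) y + ennreal s * indicator (B z r) y \<partial>lebesgue)"
      by (rule nn_integral_mono) (auto simp: h1_def indicator_def intro: ennreal_leI)
    also have "\<dots> = (\<integral>\<^sup>+y\<in>B z r. h1 y \<partial>lebesgue) + ennreal s * emeasure lebesgue (B z r)"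
      using h1 by (subst nn_integral_add) (auto simp: nn_integral_cmult_indicator)
    finally have "(\<integral>\<^sup>+y\<in>B z r. ennreal (h y) \<partial>lebesgue) / emeasure lebesgue (B z r) \<le>
        ((\<integral>\<^sup>+y\<in>B z r. h1 y \<partial>lebesgue) + ennreal s * emeasure lebesgue (B z r)) / emeasure lebesgue (B z r)"
      by (rule divide_right_mono_ennreal)
    also have "\<dots> = (\<integral>\<^sup>+y\<in>B z r. h1 y \<partial>lebesgue) / emeasure lebesgue (B z r) + ennreal s"
    proof -
      have "ennreal s * emeasure lebesgue (B z r) / emeasure lebesgue (B z r) = ennreal s"
        using zr c1 by (simp add: emeasure_B ennreal_mult'[symmetric] divide_ennreal s)
      then show ?thesis by (simp add: add_divide_distrib_ennreal)
    qed
    also have "\<dots> \<le> maxfun h1 x + ennreal s"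
      using zr by (intro add_right_mono maxfun_upper)
    finally show "(\<integral>\<^sup>+y\<in>B z r. ennreal (h y) \<partial>lebesgue) / emeasure lebesgue (B z r) \<le> maxfun h1 x + ennreal s" .
  qed
  have "{x. ennreal (2 * s) < maxfun (\<lambda>y. ennreal (h y)) x} \<subseteq> {x. ennreal s < maxfun h1 x}"
  proof clarify
    fix x assume "ennreal (2 * s) < maxfun (\<lambda>y. ennreal (h y)) x"
    also note le[of x]
    finally have "ennreal s + ennreal s < maxfun h1 x + ennreal s"
      using s by (simp add: ennreal_plus[symmetric] del: ennreal_plus)
    then have "\<not> maxfun h1 x \<le> ennreal s" using add_right_mono[of "maxfun h1 x" "ennreal s" "ennreal s"] by (simp only: not_le[symmetric]) blast
    then show "ennreal s < maxfun h1 x" by simp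
  qed
  then have "emeasure lebesgue {x. ennreal (2 * s) < maxfun (\<lambda>y. ennreal (h y)) x} \<le> emeasure lebesgue {x. ennreal s < maxfun h1 x}"
    using open_maxfun_greater by (intro emeasure_mono) auto
  then have "ennreal s * emeasure lebesgue {x. ennreal (2 * s) < maxfun (\<lambda>y. ennreal (h y)) x} \<le> ennreal s * emeasure lebesgue {x. ennreal s < maxfun h1 x}"
    by (rule mult_left_mono) simp
  also have "\<dots> \<le> ennreal (dil_const ^ Q) * (\<integral>\<^sup>+y. h1 y \<partial>lebesgue)"
    by (rule weak_type_maxfun[OF h1])
  finally show ?thesis by (simp add: h1_def)
qed

end

section \<open>The maximal function on Orlicz spaces\<close>

text \<open>
  Terms that at least double from each index to the next sum to at most twice the last one.
\<close>

lemma sum_geometric_int: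
  fixes a :: "int \<Rightarrow> ennreal"
  assumes a: "\<And>k. a k \<le> ennreal (1 / 2) * a (k + 1)"
  shows "(\<integral>\<^sup>+k. a k * indicator {..k0} k \<partial>count_space UNIV) \<le> 2 * a k0"
proof -
  have le: "a (k0 - int j) \<le> ennreal ((1 / 2) ^ j) * a k0" for j
  proof (induction j)
    case (Suc j)
    have "a (k0 - int (Suc j)) \<le> ennreal (1 / 2) * a (k0 - int j)"
      using a[of "k0 - int (Suc j)"] by (simp add: algebra_simps)
    also have "\<dots> \<le> ennreal (1 / 2) * (ennreal ((1 / 2) ^ j) * a k0)"
      by (rule mult_left_mono[OF Suc]) simp
    also have "\<dots> = ennreal ((1 / 2) ^ Suc j) * a k0"
      by (subst mult.assoc[symmetric], subst ennreal_mult'[symmetric]) auto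
    finally show ?case .
  qed simp
  have bij: "bij_betw (\<lambda>j. k0 - int j) UNIV {..k0}"
    by (rule bij_betwI[where g = "\<lambda>k. nat (k0 - k)"]) auto
  have "(\<integral>\<^sup>+k. a k * indicator {..k0} k \<partial>count_space UNIV) = (\<integral>\<^sup>+k. a k \<partial>count_space {..k0})"
    by (rule nn_integral_count_space_indicator[symmetric]) auto
  also have "\<dots> = (\<integral>\<^sup>+j. a (k0 - int j) \<partial>count_space UNIV)"
    by (rule nn_integral_bij_count_space[OF bij, symmetric])
  also have "\<dots> \<le> (\<integral>\<^sup>+j. ennreal ((1 / 2) ^ j) * a k0 \<partial>count_space UNIV)"
    by (intro nn_integral_mono le)
  also have "\<dots> = (\<integral>\<^sup>+j. ennreal ((1 / 2) ^ j) \<partial>count_space (UNIV :: nat set)) * a k0"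
    by (rule nn_integral_multc) simp
  also have "(\<integral>\<^sup>+j. ennreal ((1 / 2) ^ j) \<partial>count_space (UNIV :: nat set)) = 2"
  proof -
    have "(\<lambda>j. (1 / 2 :: real) ^ j) sums 2" using geometric_sums[of "1 / 2 :: real"] by simp
    then have "(\<Sum>j. ennreal ((1 / 2) ^ j)) = ennreal 2" by (intro suminf_ennreal_eq) auto
    then show ?thesis by (simp add: nn_integral_count_space_nat)
  qed
  finally show ?thesis .
qed

lemma powr_int_bracket:
  fixes C u :: real
  assumes C: "1 < C" and u: "0 < u"
  obtains k :: int where "C powr k < u" "u \<le> C * C powr k"
proof
  define k where "k = \<lceil>log C u\<rceil> - 1"
  have "real_of_int k < log C u" "log C u \<le> real_of_int k + 1" unfolding k_def by linarith+
  then have "C powr k < C powr (log C u)" "C powr (log C u) \<le> C powr (k + 1)"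
    using C by simp_all
  then show "C powr k < u" "u \<le> C * C powr k"
    using C u by (auto simp: powr_add mult.commute)
qed

context ball_geometry
begin

text \<open>
  Decompose according to the levels \<open>2 C\<^sup>k\<close> with \<open>k\<close> an integer, where \<open>C\<close> is the constant of \<open>\<nabla>\<^sub>2\<close>. The
  truncated weak type bound at height \<open>2 C\<^sup>k\<close> turns the sum of \<open>\<Phi> (C\<^sup>k)\<close> times the measures of the
  superlevel sets into the integral over \<open>y\<close> of \<open>h y\<close> times the sum of \<open>\<Phi> (C\<^sup>k) / C\<^sup>k\<close> over the levels
  \<open>C\<^sup>k < h y\<close>. By \<open>\<nabla>\<^sub>2\<close> these quotients at least double with each step, so their sum is governed by
  the last one, and the result is a multiple of \<open>\<Phi> (h y)\<close>.
\<close>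

lemma modular_maxfun:
  assumes Y: "young_function \<Phi>" and C: "1 < C"
    and nabla: "\<And>r. 0 \<le> r \<Longrightarrow> \<Phi> r \<le> ennreal (1 / (2 * C)) * \<Phi> (C * r)"
    and h: "h \<in> borel_measurable lebesgue" and h0: "\<And>x. 0 \<le> h x"
  shows "(\<integral>\<^sup>+x. \<Phi> (enn2real (maxfun (\<lambda>y. ennreal (h y)) x) / (2 * C)) \<partial>lebesgue) \<le>
    ennreal (2 * C * dil_const ^ Q) * (\<integral>\<^sup>+x. \<Phi> (h x) \<partial>lebesgue)"
proof -
  define P where "P k = C powr (real_of_int k)" for k :: int
  have P: "0 < P k" "P (k + 1) = C * P k" for k
    using C by (auto simp: P_def powr_add)
  define D where "D = ennreal (dil_const ^ Q)"
  define m where "m = maxfun (\<lambda>y. ennreal (h y))"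
  define a where "a k = \<Phi> (P k) * ennreal (1 / P k)" for k
  have a_step: "a k \<le> ennreal (1 / 2) * a (k + 1)" for k
  proof -
    have "a k \<le> (ennreal (1 / (2 * C)) * \<Phi> (C * P k)) * ennreal (1 / P k)"
      unfolding a_def using P(1)[of k] by (intro mult_right_mono nabla) auto
    also have "\<dots> = \<Phi> (P (k + 1)) * (ennreal (1 / (2 * C)) * ennreal (1 / P k))"
      by (simp add: P(2) mult_ac)
    also have "ennreal (1 / (2 * C)) * ennreal (1 / P k) = ennreal (1 / 2) * ennreal (1 / P (k + 1))"
      using P(1)[of k] C by (subst (1 2) ennreal_mult'[symmetric]) (auto simp: P(2))
    finally show ?thesis by (simp add: a_def mult_ac)
  qed
  have set_meas: "{x. ennreal (2 * P k) < m x} \<in> sets lebesgue" for k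
    unfolding m_def using open_maxfun_greater by auto
  have set_meas': "{y. P k < h y} \<in> sets lebesgue" for k
    using borel_measurable_less[OF borel_measurable_const h, of "P k"] by simp
  have "(\<integral>\<^sup>+x. \<Phi> (enn2real (m x) / (2 * C)) \<partial>lebesgue) \<le>
      (\<integral>\<^sup>+x. \<integral>\<^sup>+k. \<Phi> (P k) * indicator {x. ennreal (2 * P k) < m x} x \<partial>count_space UNIV \<partial>lebesgue)"
  proof (rule nn_integral_mono)
    fix x
    show "\<Phi> (enn2real (m x) / (2 * C)) \<le> (\<integral>\<^sup>+k. \<Phi> (P k) * indicator {x. ennreal (2 * P k) < m x} x \<partial>count_space UNIV)"
    proof (cases "enn2real (m x) = 0")
      case True
      then show ?thesis by (simp add: young_0[OF Y])
    next
      case False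
      define u where "u = enn2real (m x)"
      have u: "0 < u" using False by (simp add: u_def less_le)
      then have "m x \<noteq> \<infinity>" by (auto simp: u_def)
      then have m_u: "m x = ennreal u" by (simp add: u_def less_top)
      obtain k :: int where k: "P k < u / 2" "u / 2 \<le> C * P k"
        using powr_int_bracket[OF C, of "u / 2"] u by (auto simp: P_def)
      have "\<Phi> (u / (2 * C)) \<le> \<Phi> (P k)"
        using k(2) u C by (intro young_mono[OF Y]) (auto simp: field_simps)
      also have "\<dots> = \<Phi> (P k) * indicator {x. ennreal (2 * P k) < m x} x"
        using k(1) P(1)[of k] by (simp add: m_u ennreal_less_iff)
      also have "\<dots> \<le> (\<integral>\<^sup>+k. \<Phi> (P k) * indicator {x. ennreal (2 * P k) < m x} x \<partial>count_space UNIV)"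
        by (rule nn_integral_ge_point) simp
      finally show ?thesis by (simp add: u_def)
    qed
  qed
  also have "\<dots> = (\<integral>\<^sup>+k. \<integral>\<^sup>+x. \<Phi> (P k) * indicator {x. ennreal (2 * P k) < m x} x \<partial>lebesgue \<partial>count_space UNIV)"
    using set_meas by (intro nn_integral_count_space_nn_integral) auto
  also have "\<dots> \<le> (\<integral>\<^sup>+k. \<integral>\<^sup>+y. D * (a k * (ennreal (h y) * indicator {y. P k < h y} y)) \<partial>lebesgue \<partial>count_space UNIV)"
  proof (rule nn_integral_mono)
    fix k
    let ?E = "emeasure lebesgue {x. ennreal (2 * P k) < m x}"
    let ?I = "\<integral>\<^sup>+y\<in>{y. P k < h y}. ennreal (h y) \<partial>lebesgue"
    have "ennreal (1 / P k) * (ennreal (P k) * ?E) \<le> ennreal (1 / P k) * (D * ?I)"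
      unfolding m_def D_def using weak_type_maxfun_truncated[OF h less_imp_le[OF P(1)]]
      by (rule mult_left_mono) simp
    moreover have "ennreal (1 / P k) * (ennreal (P k) * ?E) = ?E"
      using P(1)[of k] by (subst mult.assoc[symmetric], subst ennreal_mult'[symmetric]) auto
    ultimately have "\<Phi> (P k) * ?E \<le> \<Phi> (P k) * (ennreal (1 / P k) * (D * ?I))"
      by (intro mult_left_mono) auto
    also have "\<dots> = D * (a k * ?I)" by (simp add: a_def mult_ac)
    also have "\<dots> = (\<integral>\<^sup>+y. D * (a k * (ennreal (h y) * indicator {y. P k < h y} y)) \<partial>lebesgue)"
      using h set_meas' by (simp add: nn_integral_cmult)
    finally show "(\<integral>\<^sup>+x. \<Phi> (P k) * indicator {x. ennreal (2 * P k) < m x} x \<partial>lebesgue) \<le>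
        (\<integral>\<^sup>+y. D * (a k * (ennreal (h y) * indicator {y. P k < h y} y)) \<partial>lebesgue)"
      using set_meas by (simp add: nn_integral_cmult_indicator)
  qed
  also have "\<dots> = (\<integral>\<^sup>+y. \<integral>\<^sup>+k. D * (a k * (ennreal (h y) * indicator {y. P k < h y} y)) \<partial>count_space UNIV \<partial>lebesgue)"
    using h set_meas' by (intro nn_integral_count_space_nn_integral[symmetric]) auto
  also have "\<dots> \<le> (\<integral>\<^sup>+y. ennreal (2 * C * dil_const ^ Q) * \<Phi> (h y) \<partial>lebesgue)"
  proof (rule nn_integral_mono)
    fix y
    show "(\<integral>\<^sup>+k. D * (a k * (ennreal (h y) * indicator {y. P k < h y} y)) \<partial>count_space UNIV) \<le>
        ennreal (2 * C * dil_const ^ Q) * \<Phi> (h y)"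
    proof (cases "h y = 0")
      case True
      then show ?thesis by simp
    next
      case False
      then have u: "0 < h y" using h0[of y] by simp
      obtain k0 :: int where k0: "P k0 < h y" "h y \<le> C * P k0"
        using powr_int_bracket[OF C u] by (auto simp: P_def)
      have P_mono: "P k \<le> P l" if "k \<le> l" for k l
        using C that by (simp add: P_def)
      have "P k < h y \<longleftrightarrow> k \<le> k0" for k
      proof
        show "k \<le> k0" if "P k < h y"
        proof (rule ccontr)
          assume "\<not> k \<le> k0"
          then have "P (k0 + 1) \<le> P k" by (intro P_mono) auto
          then show False using that k0 P(2)[of k0] by simp
        qed
        show "P k < h y" if "k \<le> k0" using P_mono[OF that] k0 by simp
      qed
      then have "(\<integral>\<^sup>+k. D * (a k * (ennreal (h y) * indicator {y. P k < h y} y)) \<partial>count_space UNIV) =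
          (\<integral>\<^sup>+k. (D * ennreal (h y)) * (a k * indicator {..k0} k) \<partial>count_space UNIV)"
        by (intro nn_integral_cong) (simp add: indicator_def mult_ac)
      also have "\<dots> = (D * ennreal (h y)) * (\<integral>\<^sup>+k. a k * indicator {..k0} k \<partial>count_space UNIV)"
        by (rule nn_integral_cmult) simp
      also have "\<dots> \<le> (D * ennreal (h y)) * (2 * a k0)"
        by (intro mult_left_mono sum_geometric_int a_step) auto
      also have "\<dots> = (D * 2 * \<Phi> (P k0)) * (ennreal (h y) * ennreal (1 / P k0))"
        by (simp add: a_def mult_ac)
      also have "ennreal (h y) * ennreal (1 / P k0) = ennreal (h y / P k0)"
        using u by (subst ennreal_mult'[symmetric]) auto
      also have "(D * 2 * \<Phi> (P k0)) * ennreal (h y / P k0) \<le> (D * 2 * \<Phi> (h y)) * ennreal C"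
        using k0 P(1)[of k0] by (intro mult_mono mult_left_mono young_mono[OF Y] ennreal_leI) (auto simp: field_simps)
      also have "\<dots> = ennreal (2 * C * dil_const ^ Q) * \<Phi> (h y)"
      proof -
        have "ennreal (2 * C * dil_const ^ Q) = 2 * ennreal C * D"
          using C dil_const by (simp add: D_def ennreal_mult)
        then show ?thesis by (simp add: mult_ac)
      qed
      finally show ?thesis .
    qed
  qed
  also have "\<dots> = ennreal (2 * C * dil_const ^ Q) * (\<integral>\<^sup>+x. \<Phi> (h x) \<partial>lebesgue)"
    using young_measurable[OF Y h h0] by (rule nn_integral_cmult)
  finally show ?thesis by (simp add: m_def)
qed

text \<open>
  Convexity trades the constant in front of the modular for a larger divisor \<open>L\<close>.
\<close>

lemma modular_maxfun_le_1:
  assumes Y: "young_function \<Phi>" and nabla: "nabla2 \<Phi>"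
  obtains L where "1 \<le> L" "\<And>h :: 'a \<Rightarrow> real. h \<in> borel_measurable lebesgue \<Longrightarrow> (\<And>x. 0 \<le> h x) \<Longrightarrow>
    (\<integral>\<^sup>+x. \<Phi> (h x) \<partial>lebesgue) \<le> 1 \<Longrightarrow>
    (\<integral>\<^sup>+x. \<Phi> (enn2real (maxfun (\<lambda>y. ennreal (h y)) x) / L) \<partial>lebesgue) \<le> 1"
proof -
  obtain C where C: "1 < C" "\<And>r. 0 \<le> r \<Longrightarrow> \<Phi> r \<le> ennreal (1 / (2 * C)) * \<Phi> (C * r)"
    using nabla unfolding nabla2_def by blast
  define A where "A = 2 * C * dil_const ^ Q"
  have A: "1 \<le> A"
  proof -
    have "1 * 1 \<le> (2 * C) * dil_const ^ Q" using C dil_const by (intro mult_mono) auto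
    then show ?thesis by (simp add: A_def)
  qed
  show ?thesis
  proof (rule that[of "2 * C * A"])
    show "1 \<le> 2 * C * A"
    proof -
      have "1 * 1 \<le> (2 * C) * A" using C A by (intro mult_mono) auto
      then show ?thesis by simp
    qed
  next
    fix h :: "'a \<Rightarrow> real"
    assume h: "h \<in> borel_measurable lebesgue" "\<And>x. 0 \<le> h x" and le: "(\<integral>\<^sup>+x. \<Phi> (h x) \<partial>lebesgue) \<le> 1"
    let ?u = "\<lambda>x. enn2real (maxfun (\<lambda>y. ennreal (h y)) x)"
    have meas: "(\<lambda>x. \<Phi> (?u x / (2 * C))) \<in> borel_measurable lebesgue"
      using C by (intro young_measurable[OF Y]) auto
    have "(\<integral>\<^sup>+x. \<Phi> (?u x / (2 * C * A)) \<partial>lebesgue) \<le> (\<integral>\<^sup>+x. ennreal (1 / A) * \<Phi> (?u x / (2 * C)) \<partial>lebesgue)"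
    proof (rule nn_integral_mono)
      fix x
      have "\<Phi> (1 / A * (?u x / (2 * C))) \<le> ennreal (1 / A) * \<Phi> (?u x / (2 * C))"
        using A C by (intro young_scale[OF Y]) auto
      then show "\<Phi> (?u x / (2 * C * A)) \<le> ennreal (1 / A) * \<Phi> (?u x / (2 * C))"
        by (simp add: mult_ac)
    qed
    also have "\<dots> = ennreal (1 / A) * (\<integral>\<^sup>+x. \<Phi> (?u x / (2 * C)) \<partial>lebesgue)"
      using meas by (rule nn_integral_cmult)
    also have "\<dots> \<le> ennreal (1 / A) * (ennreal A * (\<integral>\<^sup>+x. \<Phi> (h x) \<partial>lebesgue))"
      unfolding A_def by (intro mult_left_mono modular_maxfun Y C h) auto
    also have "\<dots> \<le> ennreal (1 / A) * (ennreal A * 1)"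
      by (intro mult_left_mono le) auto
    also have "\<dots> = 1" using A by (simp add: ennreal_mult'[symmetric])
    finally show "(\<integral>\<^sup>+x. \<Phi> (?u x / (2 * C * A)) \<partial>lebesgue) \<le> 1" .
  qed
qed

text \<open>
  Convexity gives \<open>\<Phi> 1 * h \<le> \<Phi> h\<close> where \<open>h \<ge> 1\<close>, so the part of \<open>h\<close> above a level \<open>s \<ge> 1\<close> has integral
  at most \<open>1 / \<Phi> 1\<close>, and the measure of \<open>{M h > 2 s}\<close> is of order \<open>1 / s\<close>.
\<close>

lemma maxfun_finite_modular:
  assumes Y: "young_function \<Phi>" and pos: "0 < \<Phi> 1" "\<Phi> 1 < \<infinity>"
    and h: "h \<in> borel_measurable lebesgue" "\<And>x. 0 \<le> h x"
    and le: "(\<integral>\<^sup>+x. \<Phi> (h x) \<partial>lebesgue) \<le> 1"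
  shows "AE x in lebesgue. maxfun (\<lambda>y. ennreal (h y)) x < \<infinity>"
proof (rule AE_finite_of_small_superlevel_sets[OF maxfun_measurable])
  define \<phi> where "\<phi> = enn2real (\<Phi> 1)"
  have \<phi>: "\<Phi> 1 = ennreal \<phi>" "0 < \<phi>" using pos by (auto simp: \<phi>_def enn2real_positive_iff)
  let ?E = "\<lambda>n. emeasure lebesgue {x. ennreal (2 * real (Suc n)) < maxfun (\<lambda>y. ennreal (h y)) x}"
  show "?E n \<le> ennreal (dil_const ^ Q / \<phi> * inverse (real (Suc n)))" for n
  proof -
    have meas: "{y. real (Suc n) < h y} \<in> sets lebesgue"
      using borel_measurable_less[OF borel_measurable_const h(1), of "real (Suc n)"] by simp
    have "(\<integral>\<^sup>+y\<in>{y. real (Suc n) < h y}. ennreal (h y) \<partial>lebesgue) \<le> (\<integral>\<^sup>+y. ennreal (1 / \<phi>) * \<Phi> (h y) \<partial>lebesgue)"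
    proof (rule nn_integral_mono)
      fix y
      show "ennreal (h y) * indicator {y. real (Suc n) < h y} y \<le> ennreal (1 / \<phi>) * \<Phi> (h y)"
      proof (cases "real (Suc n) < h y")
        case True
        then have u: "1 \<le> h y" by simp
        then have "\<Phi> (1 / h y * h y) \<le> ennreal (1 / h y) * \<Phi> (h y)"
          by (intro young_scale[OF Y]) auto
        then have "ennreal \<phi> \<le> ennreal (1 / h y) * \<Phi> (h y)" using u by (simp add: \<phi>)
        then have "ennreal (h y / \<phi>) * ennreal \<phi> \<le> ennreal (h y / \<phi>) * (ennreal (1 / h y) * \<Phi> (h y))"
          by (rule mult_left_mono) simp
        moreover have "ennreal (h y / \<phi>) * ennreal \<phi> = ennreal (h y)"
          using u \<phi> by (subst ennreal_mult'[symmetric]) auto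
        moreover have "ennreal (h y / \<phi>) * (ennreal (1 / h y) * \<Phi> (h y)) = ennreal (1 / \<phi>) * \<Phi> (h y)"
          using u \<phi> by (subst mult.assoc[symmetric], subst ennreal_mult'[symmetric]) auto
        ultimately show ?thesis using True by simp
      qed simp
    qed
    also have "\<dots> = ennreal (1 / \<phi>) * (\<integral>\<^sup>+y. \<Phi> (h y) \<partial>lebesgue)"
      using young_measurable[OF Y h] by (rule nn_integral_cmult)
    also have "\<dots> \<le> ennreal (1 / \<phi>) * 1" by (intro mult_left_mono le) auto
    finally have I: "(\<integral>\<^sup>+y\<in>{y. real (Suc n) < h y}. ennreal (h y) \<partial>lebesgue) \<le> ennreal (1 / \<phi>)" by simp
    have "ennreal (inverse (real (Suc n))) * (ennreal (real (Suc n)) * ?E n) \<le>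
        ennreal (inverse (real (Suc n))) * (ennreal (dil_const ^ Q) * ennreal (1 / \<phi>))"
      using weak_type_maxfun_truncated[OF h(1), of "real (Suc n)"] mult_left_mono[OF I, of "ennreal (dil_const ^ Q)"]
      by (intro mult_left_mono) (auto intro: order_trans)
    also have "\<dots> = ennreal (dil_const ^ Q / \<phi> * inverse (real (Suc n)))"
      using \<phi> dil_const by (simp add: ennreal_mult'[symmetric] mult.commute del: of_nat_Suc)
    also have "ennreal (inverse (real (Suc n))) * (ennreal (real (Suc n)) * ?E n) = ?E n"
      by (subst mult.assoc[symmetric], subst ennreal_mult'[symmetric]) (auto simp del: of_nat_Suc)
    finally show ?thesis .
  qed
  show "(\<lambda>n. ennreal (dil_const ^ Q / \<phi> * inverse (real (Suc n)))) \<longlonglongrightarrow> 0"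
    using tendsto_ennrealI[OF tendsto_mult_right_zero[OF LIMSEQ_inverse_real_of_nat, of "dil_const ^ Q / \<phi>"]] by simp
qed simp

lemma radius_powr:
  assumes "0 < r" and v: "v = c1 * r ^ Q"
  shows "r powr \<beta> = c1 powr (- \<beta> / real Q) * v powr (\<beta> / real Q)"
proof -
  have "v powr (\<beta> / real Q) = c1 powr (\<beta> / real Q) * (r ^ Q) powr (\<beta> / real Q)"
    using assms c1 by (simp add: powr_mult)
  also have "(r ^ Q) powr (\<beta> / real Q) = r powr \<beta>"
    using assms Q by (simp add: powr_realpow[symmetric] powr_powr)
  finally show ?thesis
    using c1 by (simp add: mult.assoc[symmetric] powr_add[symmetric])
qed

text \<open>
  Hedberg's argument. Put \<open>u = M h x\<close> and \<open>t = \<Phi> (u / L)\<close>, and let \<open>v\<close> be the volume of the ball, so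
  that \<open>r\<^sup>\<beta>\<close> is a multiple of \<open>v powr (\<beta> / Q)\<close>. For \<open>v \<le> 1 / t\<close> bound the average by \<open>u \<le> L * \<Phi>\<inverse> t\<close>;
  for larger \<open>v\<close> bound it by \<open>2 * \<Phi>\<inverse> (1 / v)\<close>. In both cases the relation between \<open>\<Phi>\<inverse>\<close> and \<open>\<Psi>\<inverse>\<close> and
  the monotonicity of \<open>\<Psi>\<inverse>\<close> give a multiple of \<open>\<Psi>\<inverse> t\<close>.
\<close>

lemma fractional_average_le:
  assumes Y: "young_function \<Phi>" "young_function \<Psi>" and \<Phi>: "\<Phi> \<in> young_Y"
    and \<beta>: "0 < \<beta>" and L: "1 \<le> L" and c: "0 < c"
    and inv: "\<And>t. 0 < t \<Longrightarrow> young_inverse \<Phi> t * t powr (- \<beta> / real Q) \<le> c * young_inverse \<Psi> t"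
    and h: "h \<in> borel_measurable lebesgue" "\<And>x. 0 \<le> h x"
    and le: "(\<integral>\<^sup>+x. \<Phi> (h x) \<partial>lebesgue) \<le> 1"
    and fin: "maxfun (\<lambda>y. ennreal (h y)) x < \<infinity>" and r: "0 < r" "x \<in> B z r"
    and avg: "(\<integral>\<^sup>+y\<in>B z r. ennreal (h y) \<partial>lebesgue) = ennreal a" "0 \<le> a"
  shows "r powr \<beta> * (a / vol (B z r)) \<le> c1 powr (- \<beta> / real Q) * (L + 2) * c *
    young_inverse \<Psi> (enn2real (\<Phi> (enn2real (maxfun (\<lambda>y. ennreal (h y)) x) / L)))"
proof -
  define v where "v = c1 * r ^ Q"
  have v: "0 < v" "vol (B z r) = v" using r c1 by (auto simp: v_def measure_ball)
  define u where "u = enn2real (maxfun (\<lambda>y. ennreal (h y)) x)"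
  have mu: "maxfun (\<lambda>y. ennreal (h y)) x = ennreal u" "0 \<le> u" using fin by (auto simp: u_def)
  define \<gamma> where "\<gamma> = \<beta> / real Q"
  have \<gamma>: "0 < \<gamma>" using \<beta> Q by (simp add: \<gamma>_def)
  have rp: "r powr \<beta> = c1 powr (- \<gamma>) * v powr \<gamma>"
    using radius_powr[OF r(1) v_def] by (simp add: \<gamma>_def)
  have au: "a / v \<le> u"
  proof -
    have "ennreal (a / v) = ennreal a / ennreal v" using v avg(2) by (simp add: divide_ennreal)
    also have "\<dots> \<le> ennreal u"
      using maxfun_upper[OF r, of "\<lambda>y. ennreal (h y)"] r by (simp add: avg emeasure_B mu v_def)
    finally show ?thesis using mu(2) by simp
  qed
  have a\<Phi>: "a / v \<le> 2 * young_inverse \<Phi> (1 / v)"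
  proof -
    have "(\<integral>\<^sup>+x\<in>B z r. ennreal \<bar>h x\<bar> \<partial>lebesgue) \<le> ennreal (2 * vol (B z r) * young_inverse \<Phi> (1 / vol (B z r)) * 1)"
    proof (rule orlicz_average_le[OF Y(1) B_lmeasurable])
      have "(\<integral>\<^sup>+x\<in>B z r. \<Phi> (\<bar>h x\<bar> / 1) \<partial>lebesgue) \<le> (\<integral>\<^sup>+x. \<Phi> (h x) \<partial>lebesgue)"
        using h(2) by (intro nn_integral_mono) (auto simp: indicator_def)
      then show "(\<integral>\<^sup>+x\<in>B z r. \<Phi> (\<bar>h x\<bar> / 1) \<partial>lebesgue) \<le> 1" using le by (rule order_trans)
    qed (use h v in auto)
    then have "ennreal a \<le> ennreal (2 * v * young_inverse \<Phi> (1 / v))"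
      using h(2) by (simp add: v avg)
    then have "a \<le> 2 * v * young_inverse \<Phi> (1 / v)"
      using v young_inverse_nonneg[OF Y(1)] by simp
    then show ?thesis using v by (simp add: divide_simps mult_ac)
  qed
  define t where "t = enn2real (\<Phi> (u / L))"
  show ?thesis
  proof (cases "u = 0")
    case True
    then have "a / v = 0" using au avg(2) v by (simp add: divide_le_0_iff)
    then show ?thesis
      using c L c1 young_inverse_nonneg[OF Y(2)] v by simp
  next
    case False
    then have uL: "0 < u / L" using mu(2) L by simp
    have \<Phi>u: "0 < \<Phi> (u / L)" "\<Phi> (u / L) < \<infinity>" using \<Phi> uL by (auto simp: young_Y_def)
    then have t: "0 < t" by (simp add: t_def enn2real_positive_iff)
    have u_le: "u \<le> L * young_inverse \<Phi> t"
      using le_young_inverse_young[OF Y(1) less_imp_le[OF uL] \<Phi>u(2)] L by (simp add: t_def divide_simps mult_ac)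
    have inv': "young_inverse \<Phi> s * s powr (- \<gamma>) \<le> c * young_inverse \<Psi> s" if "0 < s" for s
      using inv[OF that] by (simp add: \<gamma>_def)
    have main: "v powr \<gamma> * (a / v) \<le> (L + 2) * (c * young_inverse \<Psi> t)"
    proof (cases "t \<le> 1 / v")
      case True
      then have "v \<le> 1 / t" using t v by (simp add: field_simps)
      then have "v powr \<gamma> \<le> (1 / t) powr \<gamma>" using v \<gamma> by (intro powr_mono2) auto
      also have "\<dots> = t powr (- \<gamma>)" using t by (simp add: powr_minus_divide powr_divide)
      finally have "v powr \<gamma> * (a / v) \<le> t powr (- \<gamma>) * (L * young_inverse \<Phi> t)"
        using au u_le avg(2) v by (intro mult_mono) auto
      also have "\<dots> = L * (young_inverse \<Phi> t * t powr (- \<gamma>))" by simp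
      also have "\<dots> \<le> L * (c * young_inverse \<Psi> t)" using L by (intro mult_left_mono inv' t) auto
      also have "\<dots> \<le> (L + 2) * (c * young_inverse \<Psi> t)"
        using c young_inverse_nonneg[OF Y(2)] by (intro mult_right_mono) auto
      finally show ?thesis .
    next
      case False
      have "v powr \<gamma> * (a / v) \<le> v powr \<gamma> * (2 * young_inverse \<Phi> (1 / v))"
        using a\<Phi> by (intro mult_left_mono) auto
      also have "\<dots> = 2 * (young_inverse \<Phi> (1 / v) * (1 / v) powr (- \<gamma>))"
        using v by (simp add: powr_minus_divide powr_divide)
      also have "\<dots> \<le> 2 * (c * young_inverse \<Psi> (1 / v))" using v by (intro mult_left_mono inv') auto
      also have "\<dots> \<le> 2 * (c * young_inverse \<Psi> t)"
        using False c by (intro mult_left_mono young_inverse_mono[OF Y(2)]) auto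
      also have "\<dots> \<le> (L + 2) * (c * young_inverse \<Psi> t)"
        using c L young_inverse_nonneg[OF Y(2)] by (intro mult_right_mono) auto
      finally show ?thesis .
    qed
    have "r powr \<beta> * (a / v) = c1 powr (- \<gamma>) * (v powr \<gamma> * (a / v))" by (simp add: rp)
    also have "\<dots> \<le> c1 powr (- \<gamma>) * ((L + 2) * (c * young_inverse \<Psi> t))"
      using main by (intro mult_left_mono) auto
    finally show ?thesis by (simp add: v t_def u_def \<gamma>_def mult_ac)
  qed
qed

end

section \<open>Mean oscillation\<close>

context ball_geometry
begin

text \<open>
  The mean oscillation as a real number; on locally integrable functions the sharp maximal
  function is its supremum over the balls that contain the point (\<open>sharp_max_eq\<close>).
\<close>

definition osc :: "('a \<Rightarrow> real) \<Rightarrow> 'a set \<Rightarrow> real" where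
  "osc f A = (LINT y:A|lebesgue. \<bar>f y - average f A\<bar>) / vol A"

lemma integrable_on_B:
  assumes "locally_integrable f"
  shows "set_integrable lebesgue (B z r) f"
proof -
  have "compact (closure (B z r))" using bounded_ball' by simp
  then have "set_integrable lebesgue (closure (B z r)) f"
    using assms by (simp add: locally_integrable_def)
  then show ?thesis by (rule set_integrable_subset) (simp_all add: closure_subset)
qed

lemma set_integrable_const_B: "set_integrable lebesgue (B z r) (\<lambda>_. c :: real)"
  using B_lmeasurable[of z r] by (simp add: set_integrable_def fmeasurable_def)

lemma LINT_const_B: "(LINT y:B z r|lebesgue. c :: real) = vol (B z r) * c"
  using B_lmeasurable[of z r] by (subst set_integral_const) (auto simp: fmeasurable_def)

lemma nn_integral_abs_B:
  assumes "set_integrable lebesgue (B z r) f"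
  shows "(\<integral>\<^sup>+y\<in>B z r. ennreal \<bar>f y\<bar> \<partial>lebesgue) = ennreal (LINT y:B z r|lebesgue. \<bar>f y\<bar>)"
proof -
  have "integrable lebesgue (\<lambda>y. indicator (B z r) y *\<^sub>R \<bar>f y\<bar>)"
    using set_integrable_abs[OF assms] by (simp add: set_integrable_def)
  then have "(\<integral>\<^sup>+y. ennreal (indicator (B z r) y *\<^sub>R \<bar>f y\<bar>) \<partial>lebesgue) = ennreal (LINT y:B z r|lebesgue. \<bar>f y\<bar>)"
    unfolding set_lebesgue_integral_def by (intro nn_integral_eq_integral) auto
  moreover have "(\<integral>\<^sup>+y. ennreal (indicator (B z r) y *\<^sub>R \<bar>f y\<bar>) \<partial>lebesgue) = (\<integral>\<^sup>+y\<in>B z r. ennreal \<bar>f y\<bar> \<partial>lebesgue)"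
    by (intro nn_integral_cong) (simp add: indicator_def)
  ultimately show ?thesis by simp
qed

lemma LINT_abs_nonneg: "0 \<le> (LINT y:A|lebesgue. \<bar>f y :: real\<bar>)"
  unfolding set_lebesgue_integral_def by (intro integral_nonneg_AE) auto

lemma osc_nonneg: "0 \<le> osc f A"
  unfolding osc_def by (intro divide_nonneg_nonneg LINT_abs_nonneg) auto

lemma sharp_max_eq:
  assumes f: "\<And>z r. set_integrable lebesgue (B z r) f"
  shows "sharp_max G \<rho> f x = (SUP (z, r)\<in>{(z, r). 0 < r \<and> x \<in> B z r}. ennreal (osc f (B z r)))"
proof -
  have "(\<integral>\<^sup>+y\<in>B z r. ennreal \<bar>f y - average f (B z r)\<bar> \<partial>lebesgue) / emeasure lebesgue (B z r) = ennreal (osc f (B z r))"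
    if "0 < r" for z r
  proof -
    have "set_integrable lebesgue (B z r) (\<lambda>y. f y - average f (B z r))"
      using f set_integrable_const_B by (rule set_integral_diff)
    then show ?thesis
      using that c1
      by (simp add: nn_integral_abs_B osc_def emeasure_B measure_ball divide_ennreal LINT_abs_nonneg)
  qed
  moreover have "{A \<in> group_balls G \<rho>. x \<in> A} = (\<lambda>(z, r). B z r) ` {(z, r). 0 < r \<and> x \<in> B z r}"
    by (auto simp: group_balls_def)
  ultimately show ?thesis
    unfolding sharp_max_def by (auto simp: image_image intro!: SUP_cong)
qed

lemma sharp_max_upper:
  assumes "\<And>z r. set_integrable lebesgue (B z r) f" "0 < r" "x \<in> B z r"
  shows "ennreal (osc f (B z r)) \<le> sharp_max G \<rho> f x"
  unfolding sharp_max_eq[OF assms(1)] using assms(2,3) by (intro SUP_upper2[of "(z, r)"]) auto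

lemma sharp_max_least:
  assumes "\<And>z r. set_integrable lebesgue (B z r) f"
    and "\<And>z r. 0 < r \<Longrightarrow> x \<in> B z r \<Longrightarrow> ennreal (osc f (B z r)) \<le> X"
  shows "sharp_max G \<rho> f x \<le> X"
  unfolding sharp_max_eq[OF assms(1)] using assms(2) by (intro SUP_least) auto

lemma average_add:
  assumes "set_integrable lebesgue A f" "set_integrable lebesgue A g"
  shows "average (\<lambda>y. f y + g y) A = average f A + average g A"
  using assms by (simp add: average_def set_integral_add add_divide_distrib)

lemma average_cmult: "average (\<lambda>y. a * f y) A = a * average f A"
  by (simp add: average_def)

lemma osc_add:
  assumes f: "set_integrable lebesgue (B z r) f" and g: "set_integrable lebesgue (B z r) g"
  shows "osc (\<lambda>y. f y + g y) (B z r) \<le> osc f (B z r) + osc g (B z r)"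
proof -
  have f': "set_integrable lebesgue (B z r) (\<lambda>y. \<bar>f y - average f (B z r)\<bar>)"
    and g': "set_integrable lebesgue (B z r) (\<lambda>y. \<bar>g y - average g (B z r)\<bar>)"
    by (intro set_integrable_abs set_integral_diff(1) f g set_integrable_const_B)+
  have fg: "set_integrable lebesgue (B z r) (\<lambda>y. \<bar>f y + g y - (average f (B z r) + average g (B z r))\<bar>)"
    by (intro set_integrable_abs set_integral_diff(1) set_integral_add(1) f g set_integrable_const_B)
  have "(LINT y:B z r|lebesgue. \<bar>f y + g y - (average f (B z r) + average g (B z r))\<bar>) \<le>
      (LINT y:B z r|lebesgue. \<bar>f y - average f (B z r)\<bar> + \<bar>g y - average g (B z r)\<bar>)"
    using fg set_integral_add(1)[OF f' g'] by (intro set_integral_mono) auto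
  also have "\<dots> = (LINT y:B z r|lebesgue. \<bar>f y - average f (B z r)\<bar>) + (LINT y:B z r|lebesgue. \<bar>g y - average g (B z r)\<bar>)"
    by (rule set_integral_add(2)[OF f' g'])
  finally show ?thesis
    unfolding osc_def average_add[OF f g] add_divide_distrib[symmetric]
    by (intro divide_right_mono) auto
qed

lemma osc_cmult: "osc (\<lambda>y. a * f y) A = \<bar>a\<bar> * osc f A"
proof -
  have "\<bar>a * f y - a * average f A\<bar> = \<bar>a\<bar> * \<bar>f y - average f A\<bar>" for y
    by (simp add: abs_mult[symmetric] right_diff_distrib)
  then show ?thesis by (simp add: osc_def average_cmult)
qed

lemma osc_le:
  assumes f: "set_integrable lebesgue (B z r) f" and r: "0 < r"
  shows "osc f (B z r) \<le> 2 * ((LINT y:B z r|lebesgue. \<bar>f y\<bar>) / vol (B z r))"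
proof -
  let ?m = "vol (B z r)" and ?I = "LINT y:B z r|lebesgue. \<bar>f y\<bar>"
  have m: "0 < ?m" using r by (rule measure_B_pos)
  have "\<bar>LINT y:B z r|lebesgue. f y\<bar> \<le> ?I"
    unfolding set_lebesgue_integral_def
    using integral_abs_bound[of lebesgue "\<lambda>y. indicator (B z r) y *\<^sub>R f y"] by (simp add: abs_mult)
  then have avg: "?m * \<bar>average f (B z r)\<bar> \<le> ?I"
    using m by (simp add: average_def abs_mult)
  have "(LINT y:B z r|lebesgue. \<bar>f y - average f (B z r)\<bar>) \<le> (LINT y:B z r|lebesgue. \<bar>f y\<bar> + \<bar>average f (B z r)\<bar>)"
    by (intro set_integral_mono set_integrable_abs set_integral_diff(1) set_integral_add(1) f set_integrable_const_B) auto
  also have "\<dots> = ?I + ?m * \<bar>average f (B z r)\<bar>"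
    using set_integral_add(2)[OF set_integrable_abs[OF f] set_integrable_const_B[of z r "\<bar>average f (B z r)\<bar>"]]
    by (simp only: LINT_const_B)
  also have "\<dots> \<le> 2 * ?I" using avg by simp
  finally show ?thesis
    unfolding osc_def using m by (simp add: divide_right_mono)
qed

lemma sharp_max_le_maxfun:
  assumes f: "\<And>z r. set_integrable lebesgue (B z r) f"
  shows "sharp_max G \<rho> f x \<le> 2 * maxfun (\<lambda>y. ennreal \<bar>f y\<bar>) x"
proof (rule sharp_max_least[OF f])
  fix z r assume r: "0 < r" "x \<in> B z r"
  have "ennreal (osc f (B z r)) \<le> ennreal (2 * ((LINT y:B z r|lebesgue. \<bar>f y\<bar>) / vol (B z r)))"
    using osc_le[OF f r(1)] by (rule ennreal_leI)
  also have "\<dots> = 2 * ennreal ((LINT y:B z r|lebesgue. \<bar>f y\<bar>) / vol (B z r))"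
    by (subst ennreal_mult') auto
  also have "ennreal ((LINT y:B z r|lebesgue. \<bar>f y\<bar>) / vol (B z r)) =
      (\<integral>\<^sup>+y\<in>B z r. ennreal \<bar>f y\<bar> \<partial>lebesgue) / emeasure lebesgue (B z r)"
    using r c1
    by (simp add: nn_integral_abs_B[OF f] emeasure_B measure_ball divide_ennreal LINT_abs_nonneg)
  also have "2 * \<dots> \<le> 2 * maxfun (\<lambda>y. ennreal \<bar>f y\<bar>) x"
    by (intro mult_left_mono maxfun_upper r) auto
  finally show "ennreal (osc f (B z r)) \<le> 2 * maxfun (\<lambda>y. ennreal \<bar>f y\<bar>) x" by simp
qed

text \<open>
  Mean oscillation is a seminorm bounded by twice the average of the absolute value; apply
  this to \<open>b f = a f + (b - a) f\<close>.
\<close>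

lemma osc_freeze:
  assumes f: "set_integrable lebesgue (B z r) f" and bf: "set_integrable lebesgue (B z r) (\<lambda>y. b y * f y)"
    and r: "0 < r" and a: "0 \<le> a"
    and \<delta>: "AE y in lebesgue. y \<in> B z r \<longrightarrow> \<bar>b y - a\<bar> \<le> \<delta>"
  shows "osc (\<lambda>y. b y * f y) (B z r) \<le> a * osc f (B z r) + 2 * \<delta> * ((LINT y:B z r|lebesgue. \<bar>f y\<bar>) / vol (B z r))"
    and "a * osc f (B z r) \<le> osc (\<lambda>y. b y * f y) (B z r) + 2 * \<delta> * ((LINT y:B z r|lebesgue. \<bar>f y\<bar>) / vol (B z r))"
proof -
  let ?g = "\<lambda>y. b y * f y - a * f y" and ?m = "vol (B z r)"
  have m: "0 < ?m" using r by (rule measure_B_pos)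
  have af: "set_integrable lebesgue (B z r) (\<lambda>y. a * f y)" using f by simp
  have g: "set_integrable lebesgue (B z r) ?g" using bf af by (rule set_integral_diff)
  have g': "set_integrable lebesgue (B z r) (\<lambda>y. - 1 * ?g y)" using g by (intro set_integrable_mult_right)
  have "(LINT y:B z r|lebesgue. \<bar>?g y\<bar>) \<le> (LINT y:B z r|lebesgue. \<delta> * \<bar>f y\<bar>)"
  proof (rule set_integral_mono_AE)
    show "AE y\<in>B z r in lebesgue. \<bar>?g y\<bar> \<le> \<delta> * \<bar>f y\<bar>"
      using \<delta>
    proof (rule eventually_mono, intro impI)
      fix y assume "y \<in> B z r \<longrightarrow> \<bar>b y - a\<bar> \<le> \<delta>" "y \<in> B z r"
      then have "\<bar>b y - a\<bar> * \<bar>f y\<bar> \<le> \<delta> * \<bar>f y\<bar>" by (intro mult_right_mono) auto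
      then show "\<bar>?g y\<bar> \<le> \<delta> * \<bar>f y\<bar>" by (simp add: abs_mult[symmetric] left_diff_distrib)
    qed
  qed (use g f in \<open>auto intro: set_integrable_abs\<close>)
  then have "(LINT y:B z r|lebesgue. \<bar>?g y\<bar>) / ?m \<le> \<delta> * ((LINT y:B z r|lebesgue. \<bar>f y\<bar>) / ?m)"
    using m by (simp add: divide_right_mono)
  then have og: "osc ?g (B z r) \<le> 2 * \<delta> * ((LINT y:B z r|lebesgue. \<bar>f y\<bar>) / ?m)"
    using osc_le[OF g r] by simp
  show "osc (\<lambda>y. b y * f y) (B z r) \<le> a * osc f (B z r) + 2 * \<delta> * ((LINT y:B z r|lebesgue. \<bar>f y\<bar>) / ?m)"
    using osc_add[OF af g] og a by (simp add: osc_cmult)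
  have "osc (\<lambda>y. - 1 * ?g y) (B z r) = osc ?g (B z r)" by (subst osc_cmult) simp
  then show "a * osc f (B z r) \<le> osc (\<lambda>y. b y * f y) (B z r) + 2 * \<delta> * ((LINT y:B z r|lebesgue. \<bar>f y\<bar>) / ?m)"
    using osc_add[OF bf g'] og a by (simp add: osc_cmult)
qed

text \<open>
  The concentric ball with this radius has twice the volume.
\<close>

definition double_radius :: "real \<Rightarrow> real" where "double_radius r = 2 powr (1 / real Q) * r"

lemma double_ball:
  assumes "0 < r"
  shows "0 < double_radius r" "B z r \<subseteq> B z (double_radius r)"
    "vol (B z (double_radius r)) = 2 * vol (B z r)"
proof -
  have "(2 powr (1 / real Q)) ^ Q = 2"
    using Q by (simp add: powr_realpow[symmetric] powr_powr)
  then show "vol (B z (double_radius r)) = 2 * vol (B z r)"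
    using assms by (simp add: measure_ball double_radius_def power_mult_distrib)
  show "0 < double_radius r" using assms by (simp add: double_radius_def)
  have "1 \<le> (2::real) powr (1 / real Q)" by (rule ge_one_powr_ge_zero) auto
  then have "1 * r \<le> double_radius r"
    unfolding double_radius_def using assms by (intro mult_right_mono) auto
  then show "B z r \<subseteq> B z (double_radius r)" by (auto simp: mem_B)
qed

lemma set_integrable_indicator_B:
  "set_integrable lebesgue (B z r) (\<lambda>y. f y * indicator (B w s) y) \<longleftrightarrow> set_integrable lebesgue (B z r \<inter> B w s) (f :: 'a \<Rightarrow> real)"
  unfolding set_integrable_def
  by (rule Bochner_Integration.integrable_cong) (auto simp: indicator_def)

lemma LINT_indicator_B:
  "(LINT y:B z r|lebesgue. f y * indicator (B w s) y) = (LINT y:B z r \<inter> B w s|lebesgue. (f y :: real))"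
  unfolding set_lebesgue_integral_def
  by (rule Bochner_Integration.integral_cong) (auto simp: indicator_def)

lemma integrable_indicator_mult:
  assumes "set_integrable lebesgue (B w s) (f :: 'a \<Rightarrow> real)"
  shows "set_integrable lebesgue (B z r) (\<lambda>y. f y * indicator (B w s) y)"
  unfolding set_integrable_indicator_B by (rule set_integrable_subset[OF assms]) auto

lemma set_integrable_indicator: "set_integrable lebesgue (B z r) (indicator (B w s) :: 'a \<Rightarrow> real)"
  using integrable_indicator_mult[OF set_integrable_const_B[of w s 1], of z r] by simp

lemma osc_indicator:
  fixes z w :: 'a and r s :: real
  assumes "0 < r"
  defines "a \<equiv> vol (B z r \<inter> B w s) / vol (B z r)"
  shows "osc (indicator (B w s)) (B z r) = 2 * a * (1 - a)"
proof -
  let ?\<chi> = "indicator (B w s) :: 'a \<Rightarrow> real" and ?m = "vol (B z r)"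
  have m: "0 < ?m" using assms by (intro measure_B_pos)
  have i: "(LINT y:B z r|lebesgue. ?\<chi> y) = vol (B z r \<inter> B w s)"
  proof -
    have "B z r \<inter> B w s \<in> lmeasurable" by (intro fmeasurable.Int B_lmeasurable)
    then have "(LINT y:B z r \<inter> B w s|lebesgue. (1::real)) = vol (B z r \<inter> B w s)"
      by (subst set_integral_const) (auto simp: fmeasurable_def)
    then show ?thesis using LINT_indicator_B[of z r "\<lambda>_. 1" w s] by simp
  qed
  then have avg: "average ?\<chi> (B z r) = a" by (simp add: average_def a_def)
  have a: "0 \<le> a" "a \<le> 1"
    using m measure_mono_fmeasurable[of "B z r \<inter> B w s" "B z r" lebesgue] B_lmeasurable[of z r]
    by (auto simp: a_def divide_le_eq_1)
  have "\<bar>?\<chi> y - a\<bar> = (1 - 2 * a) * ?\<chi> y + a" for y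
    using a by (auto simp: indicator_def)
  then have "(LINT y:B z r|lebesgue. \<bar>?\<chi> y - a\<bar>) = (LINT y:B z r|lebesgue. (1 - 2 * a) * ?\<chi> y + a)"
    by simp
  also have "\<dots> = (LINT y:B z r|lebesgue. (1 - 2 * a) * ?\<chi> y) + (LINT y:B z r|lebesgue. a)"
    using set_integrable_indicator set_integrable_const_B by (intro set_integral_add) auto
  also have "\<dots> = (1 - 2 * a) * vol (B z r \<inter> B w s) + ?m * a"
    by (simp add: i LINT_const_B)
  also have "vol (B z r \<inter> B w s) = a * ?m" using m by (simp add: a_def)
  finally have "(LINT y:B z r|lebesgue. \<bar>?\<chi> y - a\<bar>) = 2 * a * (1 - a) * ?m"
    by (simp add: algebra_simps)
  then show ?thesis using m by (simp add: osc_def avg)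
qed

text \<open>
  If a ball meets \<open>B w r\<close> in the fraction \<open>a\<close> of its volume, the mean oscillation of the indicator
  on it is \<open>2 a (1 - a) \<le> 1 / 2\<close>, and the concentric ball of twice the volume attains the bound.
\<close>

lemma sharp_max_indicator:
  assumes r: "0 < r" and x: "x \<in> B w r"
  shows "sharp_max G \<rho> (indicator (B w r)) x = ennreal (1 / 2)"
proof (rule antisym)
  show "sharp_max G \<rho> (indicator (B w r)) x \<le> ennreal (1 / 2)"
  proof (rule sharp_max_least[OF set_integrable_indicator])
    fix z :: 'a and s :: real assume s: "0 < s"
    define a where "a = vol (B z s \<inter> B w r) / vol (B z s)"
    have "0 \<le> (1 - 2 * a) ^ 2" by simp
    then have "2 * a * (1 - a) \<le> 1 / 2" by (simp add: power2_eq_square algebra_simps)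
    then show "ennreal (osc (indicator (B w r)) (B z s)) \<le> ennreal (1 / 2)"
      by (intro ennreal_leI) (simp add: osc_indicator[OF s] a_def)
  qed
  note d = double_ball(1)[OF r] double_ball(2,3)[OF r, of w]
  have "vol (B w (double_radius r) \<inter> B w r) / vol (B w (double_radius r)) = 1 / 2"
    using d measure_B_pos[OF r, of w] by (simp add: Int_absorb1)
  then have half: "osc (indicator (B w r)) (B w (double_radius r)) = 1 / 2"
    using osc_indicator[OF d(1), where z = w and w = w and s = r] by simp
  have "x \<in> B w (double_radius r)" using x d(2) by auto
  from sharp_max_upper[where f = "indicator (B w r)", OF set_integrable_indicator d(1) this]
  show "ennreal (1 / 2) \<le> sharp_max G \<rho> (indicator (B w r)) x"
    unfolding half .
qed

text \<open>
  On the ball of twice the volume the average \<open>c\<close> of \<open>g = b \<chi>\<close> is half of the average of \<open>b\<close> on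
  \<open>B z r\<close>. Testing \<open>g - c\<close> against the function \<open>2 \<chi> - 1\<close> of absolute value one gives \<open>2 c\<close> times the
  volume of \<open>B z r\<close>.
\<close>

lemma abs_average_le_osc:
  assumes r: "0 < r" and b: "set_integrable lebesgue (B z r) b"
  shows "\<bar>average b (B z r)\<bar> \<le> 2 * osc (\<lambda>y. b y * indicator (B z r) y) (B z (double_radius r))"
proof -
  let ?B = "B z r" and ?D = "B z (double_radius r)"
  note d = double_ball(1)[OF r] double_ball(2,3)[OF r, of z]
  let ?\<chi> = "indicator ?B :: 'a \<Rightarrow> real" and ?m = "vol ?B"
  let ?g = "\<lambda>y. b y * ?\<chi> y"
  have m: "0 < ?m" using r by (rule measure_B_pos)
  have Int: "?D \<inter> ?B = ?B" using d(2) by auto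
  have g: "set_integrable lebesgue ?D ?g" by (rule integrable_indicator_mult[OF b])
  have Ig: "(LINT y:?D|lebesgue. ?g y) = ?m * average b ?B"
    using LINT_indicator_B[of z "double_radius r" b z r] m by (simp add: Int average_def)
  define c where "c = average ?g ?D"
  have c: "average b ?B = 2 * c"
    using m d(3) by (simp add: c_def average_def[of ?g] Ig)
  have I\<chi>: "(LINT y:?D|lebesgue. ?\<chi> y) = ?m"
    using LINT_indicator_B[of z "double_radius r" "\<lambda>_. 1" z r] LINT_const_B[of z r 1] by (simp add: Int)
  have gc: "set_integrable lebesgue ?D (\<lambda>y. ?g y - c)" by (intro set_integral_diff(1) g set_integrable_const_B)
  (* (g - c) * (2 \<chi> - 1) = g + (c - 2 c \<chi>), because g vanishes where \<chi> does *)
  have "(LINT y:?D|lebesgue. ?g y + (c - 2 * c * ?\<chi> y)) = (LINT y:?D|lebesgue. ?g y) + (LINT y:?D|lebesgue. c - 2 * c * ?\<chi> y)"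
    by (intro set_integral_add g set_integral_diff(1) set_integrable_const_B) (simp add: set_integrable_indicator)
  also have "(LINT y:?D|lebesgue. c - 2 * c * ?\<chi> y) = (LINT y:?D|lebesgue. c) - (LINT y:?D|lebesgue. 2 * c * ?\<chi> y)"
    by (intro set_integral_diff(2) set_integrable_const_B) (simp add: set_integrable_indicator)
  finally have eq: "(LINT y:?D|lebesgue. ?g y + (c - 2 * c * ?\<chi> y)) = 2 * c * ?m"
    by (simp add: Ig I\<chi> c LINT_const_B d(3))
  have bound: "\<bar>?g y + (c - 2 * c * ?\<chi> y)\<bar> = \<bar>?g y - c\<bar>" for y
    by (auto simp: indicator_def)
  have "\<bar>2 * c * ?m\<bar> \<le> (LINT y:?D|lebesgue. \<bar>?g y - c\<bar>)"
  proof -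
    have "\<bar>LINT y:?D|lebesgue. ?g y + (c - 2 * c * ?\<chi> y)\<bar> \<le> (LINT y:?D|lebesgue. \<bar>?g y + (c - 2 * c * ?\<chi> y)\<bar>)"
      unfolding set_lebesgue_integral_def
      using integral_abs_bound[of lebesgue "\<lambda>y. indicator ?D y *\<^sub>R (?g y + (c - 2 * c * ?\<chi> y))"] by (simp add: abs_mult)
    then show ?thesis by (simp only: eq bound)
  qed
  then have "2 * \<bar>c\<bar> * ?m / (2 * ?m) \<le> osc ?g ?D"
    unfolding osc_def c_def[symmetric] d(3) using m by (intro divide_right_mono) (auto simp: abs_mult)
  then show ?thesis using m by (simp add: c abs_mult)
qed

end

section \<open>Campanato's characterisation of Lipschitz functions\<close>

lemma locally_integrable_measurable:
  assumes "locally_integrable f"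
  shows "f \<in> borel_measurable lebesgue"
proof (rule borel_measurable_LIMSEQ_real)
  show "(\<lambda>x. indicator (cball 0 (real n)) x *\<^sub>R f x) \<in> borel_measurable lebesgue" for n
    using assms by (auto simp: locally_integrable_def set_integrable_def dest!: spec[of _ "cball 0 (real n)"])
  fix x
  have "\<forall>\<^sub>F n in sequentially. indicator (cball 0 (real n)) x *\<^sub>R f x = f x"
    using eventually_ge_at_top[of "nat \<lceil>norm x\<rceil>"]
    by (rule eventually_mono) (auto simp: indicator_def nat_ceiling_le_eq)
  then show "(\<lambda>n. indicator (cball 0 (real n)) x *\<^sub>R f x) \<longlonglongrightarrow> f x"
    by (rule tendsto_eventually)
qed

text \<open>
  Used for the averages of \<open>b\<close> over balls with halved radii.
\<close>

lemma geometric_steps_converge: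
  fixes a :: "nat \<Rightarrow> real"
  assumes step: "\<And>n. \<bar>a (Suc n) - a n\<bar> \<le> M * \<theta> ^ n" and \<theta>: "0 \<le> \<theta>" "\<theta> < 1"
  shows "\<exists>l. a \<longlonglongrightarrow> l \<and> \<bar>l - a 0\<bar> \<le> M / (1 - \<theta>)"
proof -
  have geo: "(\<lambda>n. M * \<theta> ^ n) sums (M * (1 / (1 - \<theta>)))"
    using \<theta> by (intro sums_mult geometric_sums) simp
  have summable_abs: "summable (\<lambda>n. \<bar>a (Suc n) - a n\<bar>)"
    by (rule summable_comparison_test[OF _ sums_summable[OF geo]]) (use step in auto)
  then have "summable (\<lambda>n. a (Suc n) - a n)" by (rule summable_rabs_cancel)
  then have tele: "(\<lambda>n. \<Sum>k<n. a (Suc k) - a k) \<longlonglongrightarrow> (\<Sum>k. a (Suc k) - a k)"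
    by (rule summable_LIMSEQ)
  have "(\<lambda>n. (a n - a 0) + a 0) \<longlonglongrightarrow> (\<Sum>k. a (Suc k) - a k) + a 0"
    using tele by (intro tendsto_intros) (simp add: sum_lessThan_telescope)
  then have "a \<longlonglongrightarrow> (\<Sum>k. a (Suc k) - a k) + a 0" by simp
  moreover have "\<bar>\<Sum>k. a (Suc k) - a k\<bar> \<le> M / (1 - \<theta>)"
  proof -
    have "\<bar>\<Sum>k. a (Suc k) - a k\<bar> \<le> (\<Sum>k. \<bar>a (Suc k) - a k\<bar>)"
      by (rule summable_rabs[OF summable_abs])
    also have "\<dots> \<le> (\<Sum>n. M * \<theta> ^ n)"
      by (rule suminf_le[OF step summable_abs sums_summable[OF geo]])
    finally show ?thesis using sums_unique[OF geo] by simp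
  qed
  ultimately show ?thesis by (intro exI[of _ "(\<Sum>k. a (Suc k) - a k) + a 0"]) auto
qed

context ball_geometry
begin

lemma lipschitz_continuous:
  assumes lip: "\<And>x y. \<bar>f x - f y\<bar> \<le> C * qd x y powr \<beta>" and \<beta>: "0 < \<beta>"
  shows "continuous_on UNIV (f :: 'a \<Rightarrow> real)"
proof -
  have "isCont f x" for x
    unfolding isCont_def
  proof (rule tendstoI)
    fix e :: real assume e: "0 < e"
    define \<eta> where "\<eta> = (e / (\<bar>C\<bar> + 1)) powr (1 / \<beta>)"
    have \<eta>: "0 < \<eta>" using e by (simp add: \<eta>_def add_nonneg_eq_0_iff)
    have "\<forall>\<^sub>F y in at x. y \<in> B x \<eta>"
      using open_ball' centre_mem_B[OF \<eta>] by (intro eventually_at_in_open') auto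
    then show "\<forall>\<^sub>F y in at x. dist (f y) (f x) < e"
    proof (rule eventually_mono)
      fix y assume "y \<in> B x \<eta>"
      then have q: "qd x y \<le> \<eta>" by (simp add: mem_B)
      have "\<bar>f x - f y\<bar> \<le> \<bar>C\<bar> * qd x y powr \<beta>"
        using lip[of x y] by (rule order_trans) (auto intro: mult_right_mono)
      also have "\<dots> \<le> \<bar>C\<bar> * \<eta> powr \<beta>"
        using q \<beta> by (intro mult_left_mono powr_mono2) (auto simp: qd_nonneg)
      also have "\<dots> = \<bar>C\<bar> * (e / (\<bar>C\<bar> + 1))"
        using \<beta> e by (simp add: \<eta>_def powr_powr)
      also have "\<dots> < e" using e by (simp add: field_simps)
      finally show "dist (f y) (f x) < e" by (simp add: dist_real_def abs_minus_commute)
    qed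
  qed
  then show ?thesis by (simp add: continuous_on_eq_continuous_at)
qed

lemma B_mono: "r \<le> s \<Longrightarrow> B x r \<subseteq> B x s"
  by (auto simp: mem_B)

lemma average_diff_le:
  assumes b: "locally_integrable b" and r: "0 < r" and s: "0 < s" and sub: "B x r \<subseteq> B y s"
  shows "\<bar>average b (B x r) - average b (B y s)\<bar> \<le> (s / r) ^ Q * osc b (B y s)"
proof -
  define c where "c = average b (B y s)"
  have ic: "set_integrable lebesgue (B z t) (\<lambda>w. b w - c)" for z t
    by (intro set_integral_diff(1) integrable_on_B[OF b] set_integrable_const_B)
  have m: "0 < vol (B x r)" "0 < vol (B y s)"
    using r s by (auto intro: measure_B_pos)
  have "(LINT w:B x r|lebesgue. b w - c) = (LINT w:B x r|lebesgue. b w) - vol (B x r) * c"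
    using set_integral_diff(2)[OF integrable_on_B[OF b] set_integrable_const_B] by (simp only: LINT_const_B)
  then have "average b (B x r) - c = (LINT w:B x r|lebesgue. b w - c) / vol (B x r)"
    using m by (simp add: average_def diff_divide_distrib)
  then have "\<bar>average b (B x r) - c\<bar> = \<bar>LINT w:B x r|lebesgue. b w - c\<bar> / vol (B x r)"
    by simp
  also have "\<dots> \<le> (LINT w:B y s|lebesgue. \<bar>b w - c\<bar>) / vol (B x r)"
  proof (rule divide_right_mono)
    have "\<bar>LINT w:B x r|lebesgue. b w - c\<bar> \<le> (LINT w:B x r|lebesgue. \<bar>b w - c\<bar>)"
      unfolding set_lebesgue_integral_def
      using integral_abs_bound[of lebesgue "\<lambda>w. indicator (B x r) w *\<^sub>R (b w - c)"] by (simp add: abs_mult)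
    also have "ennreal (LINT w:B x r|lebesgue. \<bar>b w - c\<bar>) \<le> ennreal (LINT w:B y s|lebesgue. \<bar>b w - c\<bar>)"
      unfolding nn_integral_abs_B[OF ic, symmetric]
      using sub by (intro nn_integral_mono) (auto simp: indicator_def)
    then have "(LINT w:B x r|lebesgue. \<bar>b w - c\<bar>) \<le> (LINT w:B y s|lebesgue. \<bar>b w - c\<bar>)"
      by (simp add: LINT_abs_nonneg)
    finally show "\<bar>LINT w:B x r|lebesgue. b w - c\<bar> \<le> (LINT w:B y s|lebesgue. \<bar>b w - c\<bar>)" .
  qed simp
  also have "\<dots> = (s / r) ^ Q * osc b (B y s)"
    using r s c1 by (simp add: osc_def c_def measure_ball power_divide)
  finally show ?thesis by (simp add: c_def)
qed

lemma compact_subset_B: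
  assumes "compact C"
  obtains R where "0 < R" "C \<subseteq> B 0 R"
proof -
  have "C \<subseteq> (\<Union>n. B 0 (real n))"
  proof
    fix x
    obtain n where "qd 0 x < real n" using reals_Archimedean2 by blast
    then show "x \<in> (\<Union>n. B 0 (real n))" by (auto simp: mem_B)
  qed
  then obtain N where N: "finite N" "C \<subseteq> (\<Union>n\<in>N. B 0 (real n))"
    using compactE_image[OF assms, of UNIV "\<lambda>n. B 0 (real n)"] open_ball' by metis
  obtain k where "\<forall>n\<in>N. n \<le> k" using N(1) finite_nat_set_iff_bounded_le by auto
  then have "C \<subseteq> B 0 (real (Suc k))" using N(2) by (force simp: mem_B)
  then show ?thesis using that[of "real (Suc k)"] by simp
qed

lemma tendsto_inverse_powr:
  assumes "0 < \<beta>"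
  shows "(\<lambda>n. X * inverse (real (Suc n)) powr \<beta>) \<longlonglongrightarrow> 0"
proof -
  have "(\<lambda>n. inverse (real (Suc n)) powr \<beta>) \<longlonglongrightarrow> 0 powr \<beta>"
    using assms by (intro tendsto_powr' LIMSEQ_inverse_real_of_nat tendsto_const) auto
  then show ?thesis using assms by (intro tendsto_mult_right_zero) simp
qed

text \<open>
  Takes the place of Lebesgue's differentiation theorem. Cover a compact set by the
  enlargements of disjoint balls of radius \<open>r\<close>; the disjoint balls lie in a fixed ball, so their
  volumes have a bounded sum, and the integral of \<open>\<bar>f\<bar>\<close> over the compact set is at most a
  constant times \<open>r\<^sup>\<beta>\<close>.
\<close>

lemma AE_eq_of_small_ball_averages:
  assumes f: "f \<in> borel_measurable lebesgue" and \<beta>: "0 < \<beta>" and K: "0 \<le> K"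
    and small: "\<And>x r. 0 < r \<Longrightarrow> (\<integral>\<^sup>+y\<in>B x r. ennreal \<bar>f y\<bar> \<partial>lebesgue) \<le> ennreal (K * r powr \<beta> * vol (B x r))"
  shows "AE x in lebesgue. f x = (0::real)"
proof -
  have zero: "(\<integral>\<^sup>+y\<in>C. ennreal \<bar>f y\<bar> \<partial>lebesgue) = 0" if C: "compact C" for C
  proof -
    obtain R where R: "0 < R" "C \<subseteq> B 0 R" using compact_subset_B[OF C] .
    define R' where "R' = c0 * (R + 1)"
    have R': "0 < R'" using R c0 by (simp add: R'_def)
    define X where "X = K * dil_const powr \<beta> * dil_const ^ Q * vol (B 0 R')"
    have bound: "(\<integral>\<^sup>+y\<in>C. ennreal \<bar>f y\<bar> \<partial>lebesgue) \<le> ennreal (X * r powr \<beta>)" if r: "0 < r" "r \<le> 1" for r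
    proof -
      obtain J where finJ: "finite J" and J: "J \<subseteq> (\<lambda>x. (x, r)) ` C"
        "disjoint_family_on (\<lambda>p. B (fst p) (snd p)) J" "C \<subseteq> (\<Union>p\<in>J. B (fst p) (dil_const * snd p))"
        using vitali_compact[OF C, of "\<lambda>x. (x, r)"] centre_mem_B[OF r(1)] by auto
      have Jr: "snd p = r" "fst p \<in> C" if "p \<in> J" for p
        using that J(1) by (auto dest!: subsetD)
      have cover: "C \<subseteq> (\<Union>p\<in>J. B (fst p) (dil_const * r))"
        using J(3) Jr(1) by force
      have "(\<integral>\<^sup>+y\<in>C. ennreal \<bar>f y\<bar> \<partial>lebesgue) \<le> (\<integral>\<^sup>+y. (\<Sum>p\<in>J. ennreal \<bar>f y\<bar> * indicator (B (fst p) (dil_const * r)) y) \<partial>lebesgue)"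
      proof (rule nn_integral_mono)
        fix y
        show "ennreal \<bar>f y\<bar> * indicator C y \<le> (\<Sum>p\<in>J. ennreal \<bar>f y\<bar> * indicator (B (fst p) (dil_const * r)) y)"
        proof (cases "y \<in> C")
          case True
          then obtain p where p: "p \<in> J" "y \<in> B (fst p) (dil_const * r)" using cover by auto
          then show ?thesis
            using member_le_sum[OF p(1) _ finJ, of "\<lambda>p. ennreal \<bar>f y\<bar> * indicator (B (fst p) (dil_const * r)) y"] True
            by simp
        qed simp
      qed
      also have "\<dots> = (\<Sum>p\<in>J. \<integral>\<^sup>+y\<in>B (fst p) (dil_const * r). ennreal \<bar>f y\<bar> \<partial>lebesgue)"
        using f by (intro nn_integral_sum) auto
      also have "\<dots> \<le> (\<Sum>p\<in>J. ennreal (K * dil_const powr \<beta> * dil_const ^ Q * r powr \<beta> * vol (B (fst p) r)))"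
      proof (rule sum_mono)
        fix p assume "p \<in> J"
        have "(\<integral>\<^sup>+y\<in>B (fst p) (dil_const * r). ennreal \<bar>f y\<bar> \<partial>lebesgue) \<le>
            ennreal (K * (dil_const * r) powr \<beta> * vol (B (fst p) (dil_const * r)))"
          using dil_const r by (intro small) auto
        also have "K * (dil_const * r) powr \<beta> * vol (B (fst p) (dil_const * r)) =
            K * dil_const powr \<beta> * dil_const ^ Q * r powr \<beta> * vol (B (fst p) r)"
          using dil_const r by (simp add: measure_ball powr_mult power_mult_distrib mult_ac)
        finally show "(\<integral>\<^sup>+y\<in>B (fst p) (dil_const * r). ennreal \<bar>f y\<bar> \<partial>lebesgue) \<le>
            ennreal (K * dil_const powr \<beta> * dil_const ^ Q * r powr \<beta> * vol (B (fst p) r))" .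
      qed
      also have "\<dots> = ennreal (K * dil_const powr \<beta> * dil_const ^ Q * r powr \<beta> * (\<Sum>p\<in>J. vol (B (fst p) r)))"
        using K dil_const by (subst sum_ennreal) (auto simp: sum_distrib_left)
      also have "\<dots> \<le> ennreal (X * r powr \<beta>)"
      proof (rule ennreal_leI)
        have "(\<Sum>p\<in>J. vol (B (fst p) r)) = vol (\<Union>p\<in>J. B (fst p) (snd p))"
          using J(2) finJ Jr(1) B_lmeasurable
          by (subst measure_finite_Union) (auto simp: fmeasurable_def less_top)
        also have "\<dots> \<le> vol (B 0 R')"
        proof (rule measure_mono_fmeasurable)
          show "(\<Union>p\<in>J. B (fst p) (snd p)) \<subseteq> B 0 R'"
          proof
            fix y assume "y \<in> (\<Union>p\<in>J. B (fst p) (snd p))"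
            then obtain p where p: "p \<in> J" "y \<in> B (fst p) (snd p)" by auto
            then have "qd 0 (fst p) < R" "qd (fst p) y < 1" using Jr[OF p(1)] R(2) r by (auto simp: mem_B)
            then show "y \<in> B 0 R'" unfolding mem_B R'_def by (rule qd_triangle_less)
          qed
        qed (use finJ B_lmeasurable in auto)
        finally show "K * dil_const powr \<beta> * dil_const ^ Q * r powr \<beta> * (\<Sum>p\<in>J. vol (B (fst p) r)) \<le> X * r powr \<beta>"
          using K dil_const unfolding X_def
          by (simp add: mult.assoc mult.left_commute[of "r powr \<beta>"] mult.commute[of "r powr \<beta>"] mult_left_mono mult_right_mono)
      qed
      finally show ?thesis .
    qed
    have "(\<integral>\<^sup>+y\<in>C. ennreal \<bar>f y\<bar> \<partial>lebesgue) \<le> 0"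
    proof (rule LIMSEQ_le_const)
      show "(\<lambda>n. ennreal (X * inverse (real (Suc n)) powr \<beta>)) \<longlonglongrightarrow> 0"
        using tendsto_ennrealI[OF tendsto_inverse_powr[OF \<beta>, of X]] by simp
      show "\<exists>N. \<forall>n\<ge>N. (\<integral>\<^sup>+y\<in>C. ennreal \<bar>f y\<bar> \<partial>lebesgue) \<le> ennreal (X * inverse (real (Suc n)) powr \<beta>)"
      proof (intro exI allI impI bound)
        show "inverse (real (Suc n)) \<le> 1" for n by (rule inverse_le_1_iff[THEN iffD2]) simp
      qed simp
    qed
    then show ?thesis by simp
  qed
  have "AE x in lebesgue. x \<in> cball 0 (real n) \<longrightarrow> f x = 0" for n
  proof -
    have "(\<lambda>x. ennreal \<bar>f x\<bar> * indicator (cball 0 (real n)) x) \<in> borel_measurable lebesgue"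
      using f by (intro borel_measurable_times_ennreal borel_measurable_indicator fmeasurableD[OF lmeasurable_cball]) simp
    then have "AE x in lebesgue. ennreal \<bar>f x\<bar> * indicator (cball 0 (real n)) x = 0"
      using zero[OF compact_cball, of 0 "real n"] by (simp add: nn_integral_0_iff_AE)
    then show ?thesis by (rule eventually_mono) (auto simp: indicator_def split: if_splits)
  qed
  then have "AE x in lebesgue. \<forall>n. x \<in> cball 0 (real n) \<longrightarrow> f x = 0"
    by (intro AE_all_countable[THEN iffD2] allI)
  then show ?thesis
  proof (rule eventually_mono)
    fix x :: 'a assume *: "\<forall>n. x \<in> cball 0 (real n) \<longrightarrow> f x = 0"
    obtain n where "norm x < real n" using reals_Archimedean2 by blast
    then show "f x = 0" using *[rule_format, of n] by simp
  qed
qed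

text \<open>
  The averages over nested balls of comparable radii differ by at most a constant times \<open>r\<^sup>\<beta>\<close>.
  Hence the averages over \<open>B x (r / 2\<^sup>n)\<close> converge, at a rate of order \<open>r\<^sup>\<beta>\<close>, to a limit \<open>b' x\<close> that
  does not depend on \<open>r\<close>. The Lipschitz bound for \<open>b'\<close> follows by comparing the averages over
  \<open>B x \<delta>\<close> and over \<open>B y (2 c0 \<delta>)\<close>, which contains it, with \<open>\<delta> = d x y\<close>. Finally \<open>\<bar>b - b'\<bar>\<close> has average
  of order \<open>r\<^sup>\<beta>\<close> on all balls, so it vanishes almost everywhere.
\<close>

lemma campanato:
  assumes b: "locally_integrable b" and \<beta>: "0 < \<beta>"
    and osc: "\<And>z r. 0 < r \<Longrightarrow> osc b (B z r) \<le> K * r powr \<beta>"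
  obtains b' K' where "\<And>z r. 0 < r \<Longrightarrow> \<bar>b' z - average b (B z r)\<bar> \<le> K' * r powr \<beta>"
    and "\<And>x y. \<bar>b' x - b' y\<bar> \<le> K' * qd x y powr \<beta>" and "AE x in lebesgue. b x = b' x"
proof -
  have K: "0 \<le> K" using osc[of 1 0] osc_nonneg[of b "B 0 1"] by simp
  define a where "a x r n = average b (B x (r * (1 / 2) ^ n))" for x r n
  define \<theta> where "\<theta> = (1 / 2) powr \<beta>"
  have \<theta>: "0 \<le> \<theta>" "\<theta> < 1"
    using \<beta> powr_less_mono2[of \<beta> "1 / 2" 1] by (auto simp: \<theta>_def)
  have scale: "(r * (1 / 2) ^ n) powr \<beta> = r powr \<beta> * \<theta> ^ n" if "0 < r" for r n
    using that by (simp add: \<theta>_def powr_mult powr_realpow[symmetric] powr_powr mult.commute)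
  have diff: "\<bar>average b (B x r) - average b (B y s)\<bar> \<le> (s / r) ^ Q * (K * s powr \<beta>)"
    if "0 < r" "0 < s" "B x r \<subseteq> B y s" for x y r s
  proof -
    have "\<bar>average b (B x r) - average b (B y s)\<bar> \<le> (s / r) ^ Q * osc b (B y s)"
      by (rule average_diff_le[OF b that])
    also have "\<dots> \<le> (s / r) ^ Q * (K * s powr \<beta>)"
      using that by (intro mult_left_mono osc) auto
    finally show ?thesis .
  qed
  define K1 where "K1 = 2 ^ Q * K / (1 - \<theta>)"
  have K1: "0 \<le> K1" using K \<theta> by (simp add: K1_def)
  have lim: "\<exists>l. a x r \<longlonglongrightarrow> l \<and> \<bar>l - average b (B x r)\<bar> \<le> K1 * r powr \<beta>" if r: "0 < r" for x r
  proof -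
    have "\<bar>a x r (Suc n) - a x r n\<bar> \<le> (2 ^ Q * K * r powr \<beta>) * \<theta> ^ n" for n
    proof -
      have p: "0 < r * (1 / 2) ^ n" "0 < r * (1 / 2) ^ Suc n" "r * (1 / 2) ^ Suc n \<le> r * (1 / 2) ^ n"
        using r by (auto intro!: mult_left_mono)
      have "\<bar>a x r (Suc n) - a x r n\<bar> \<le> ((r * (1 / 2) ^ n) / (r * (1 / 2) ^ Suc n)) ^ Q * (K * (r * (1 / 2) ^ n) powr \<beta>)"
        unfolding a_def using p by (intro diff B_mono) auto
      also have "(r * (1 / 2) ^ n) / (r * (1 / 2) ^ Suc n) = 2" using r by simp
      finally show ?thesis by (simp add: scale[OF r] mult_ac)
    qed
    from geometric_steps_converge[OF this \<theta>] show ?thesis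
      by (simp add: a_def[of x r 0] K1_def mult_ac)
  qed
  have same: "l = l'" if rs: "0 < r" "r \<le> s" and l: "a x r \<longlonglongrightarrow> l" "a x s \<longlonglongrightarrow> l'" for x r s l l'
  proof -
    have "(\<lambda>n. \<bar>a x r n - a x s n\<bar>) \<longlonglongrightarrow> \<bar>l - l'\<bar>" by (intro tendsto_intros l)
    moreover have "(\<lambda>n. \<bar>a x r n - a x s n\<bar>) \<longlonglongrightarrow> 0"
    proof (rule tendsto_sandwich[OF _ _ tendsto_const])
      show "\<forall>\<^sub>F n in sequentially. \<bar>a x r n - a x s n\<bar> \<le> ((s / r) ^ Q * (K * s powr \<beta>)) * \<theta> ^ n"
      proof (rule always_eventually, rule allI)
        fix n
        have "\<bar>a x r n - a x s n\<bar> \<le> ((s * (1 / 2) ^ n) / (r * (1 / 2) ^ n)) ^ Q * (K * (s * (1 / 2) ^ n) powr \<beta>)"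
          unfolding a_def using rs by (intro diff B_mono mult_right_mono) auto
        also have "(s * (1 / 2) ^ n) / (r * (1 / 2) ^ n) = s / r" by simp
        finally show "\<bar>a x r n - a x s n\<bar> \<le> ((s / r) ^ Q * (K * s powr \<beta>)) * \<theta> ^ n"
          using rs by (simp add: scale mult_ac)
      qed
      show "(\<lambda>n. ((s / r) ^ Q * (K * s powr \<beta>)) * \<theta> ^ n) \<longlonglongrightarrow> 0"
        using \<theta> by (intro tendsto_mult_right_zero LIMSEQ_realpow_zero)
    qed simp
    ultimately have "\<bar>l - l'\<bar> = 0" by (rule LIMSEQ_unique)
    then show ?thesis by simp
  qed
  define b' where "b' x = Topological_Spaces.lim (a x 1)" for x
  have b'_lim: "a x 1 \<longlonglongrightarrow> b' x" for x
    using lim[of 1 x] unfolding b'_def by (auto simp: convergent_LIMSEQ_iff[symmetric] convergent_def)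
  have b'_avg: "\<bar>b' z - average b (B z r)\<bar> \<le> K1 * r powr \<beta>" if r: "0 < r" for z r
  proof -
    obtain l where l: "a z r \<longlonglongrightarrow> l" "\<bar>l - average b (B z r)\<bar> \<le> K1 * r powr \<beta>"
      using lim[OF r] by blast
    have "l = b' z"
      using same[OF r _ l(1) b'_lim] same[of 1 r, OF _ _ b'_lim l(1)] by (cases "r \<le> 1") auto
    then show ?thesis using l(2) by simp
  qed
  define K2 where "K2 = K1 + ((2 * c0) ^ Q * K + K1) * (2 * c0) powr \<beta>"
  have K2: "K1 \<le> K2" using K K1 c0 by (simp add: K2_def)
  have lip: "\<bar>b' x - b' y\<bar> \<le> K2 * qd x y powr \<beta>" for x y
  proof (cases "x = y")
    case False
    define \<delta> where "\<delta> = qd x y"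
    have \<delta>: "0 < \<delta>" using False qd_nonneg[of x y] qd_eq_0[of x y] by (simp add: \<delta>_def less_le)
    have sub: "B x \<delta> \<subseteq> B y (2 * c0 * \<delta>)"
    proof
      fix z assume "z \<in> B x \<delta>"
      then have "c0 * (qd y x + qd x z) < c0 * (\<delta> + \<delta>)"
        using c0 by (intro mult_strict_left_mono) (auto simp: mem_B \<delta>_def qd_sym)
      then show "z \<in> B y (2 * c0 * \<delta>)" using qd_triangle[of y z x] by (simp add: mem_B)
    qed
    have "\<bar>average b (B x \<delta>) - average b (B y (2 * c0 * \<delta>))\<bar> \<le> ((2 * c0 * \<delta>) / \<delta>) ^ Q * (K * (2 * c0 * \<delta>) powr \<beta>)"
      using \<delta> c0 by (intro diff sub) auto
    also have "(2 * c0 * \<delta>) / \<delta> = 2 * c0" using \<delta> by simp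
    finally have 1: "\<bar>average b (B x \<delta>) - average b (B y (2 * c0 * \<delta>))\<bar> \<le> (2 * c0) ^ Q * K * ((2 * c0) powr \<beta> * \<delta> powr \<beta>)"
      using \<delta> c0 by (simp add: powr_mult mult_ac)
    have 2: "\<bar>b' x - average b (B x \<delta>)\<bar> \<le> K1 * \<delta> powr \<beta>" by (rule b'_avg[OF \<delta>])
    have 3: "\<bar>b' y - average b (B y (2 * c0 * \<delta>))\<bar> \<le> K1 * ((2 * c0) powr \<beta> * \<delta> powr \<beta>)"
      using b'_avg[of "2 * c0 * \<delta>" y] \<delta> c0 by (simp add: powr_mult)
    have "\<bar>b' x - b' y\<bar> \<le> K1 * \<delta> powr \<beta> + (2 * c0) ^ Q * K * ((2 * c0) powr \<beta> * \<delta> powr \<beta>) + K1 * ((2 * c0) powr \<beta> * \<delta> powr \<beta>)"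
      using 1 2 3 by linarith
    also have "\<dots> = K2 * \<delta> powr \<beta>" by (simp add: K2_def algebra_simps)
    finally show ?thesis by (simp add: \<delta>_def)
  qed (use K1 K2 in simp)
  have "AE x in lebesgue. b x - b' x = 0"
  proof (rule AE_eq_of_small_ball_averages[OF _ \<beta>])
    have "b' \<in> borel_measurable borel" by (rule borel_measurable_continuous_onI[OF lipschitz_continuous[OF lip \<beta>]])
    then have "b' \<in> borel_measurable lebesgue" by (simp add: measurable_completion)
    then show "(\<lambda>x. b x - b' x) \<in> borel_measurable lebesgue"
      using locally_integrable_measurable[OF b] by simp
    show "0 \<le> K + (K1 + K2)" using K K1 K2 by simp
    fix x r assume r: "(0::real) < r"
    let ?c = "average b (B x r)" and ?m = "vol (B x r)"
    have ib: "set_integrable lebesgue (B x r) (\<lambda>y. b y - ?c)"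
      by (intro set_integral_diff(1) integrable_on_B[OF b] set_integrable_const_B)
    have meas: "(\<lambda>y. ennreal \<bar>b y - ?c\<bar> * indicator (B x r) y) \<in> borel_measurable lebesgue"
      using locally_integrable_measurable[OF b] by simp
    have "(\<integral>\<^sup>+y\<in>B x r. ennreal \<bar>b y - b' y\<bar> \<partial>lebesgue) \<le>
        (\<integral>\<^sup>+y. ennreal \<bar>b y - ?c\<bar> * indicator (B x r) y + ennreal ((K1 + K2) * r powr \<beta>) * indicator (B x r) y \<partial>lebesgue)"
    proof (rule nn_integral_mono)
      fix y
      have "\<bar>b y - b' y\<bar> \<le> \<bar>b y - ?c\<bar> + (K1 + K2) * r powr \<beta>" if "y \<in> B x r"
      proof -
        have "\<bar>b' x - b' y\<bar> \<le> K2 * r powr \<beta>"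
          using lip[of x y] that K1 K2 \<beta> qd_nonneg[of x y]
          by (elim order_trans) (auto simp: mem_B intro!: mult_left_mono powr_mono2)
        then show ?thesis using b'_avg[OF r, of x] unfolding distrib_right by linarith
      qed
      then show "ennreal \<bar>b y - b' y\<bar> * indicator (B x r) y \<le>
          ennreal \<bar>b y - ?c\<bar> * indicator (B x r) y + ennreal ((K1 + K2) * r powr \<beta>) * indicator (B x r) y"
        using K1 K2 by (auto simp: indicator_def ennreal_plus[symmetric] simp del: ennreal_plus intro!: ennreal_leI)
    qed
    also have "\<dots> = ennreal (LINT y:B x r|lebesgue. \<bar>b y - ?c\<bar>) + ennreal ((K1 + K2) * r powr \<beta>) * emeasure lebesgue (B x r)"
      using meas by (subst nn_integral_add) (auto simp: nn_integral_abs_B[OF ib] nn_integral_cmult_indicator)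
    also have "(LINT y:B x r|lebesgue. \<bar>b y - ?c\<bar>) = osc b (B x r) * ?m"
      using measure_B_pos[OF r, of x] by (simp add: osc_def)
    also have "ennreal (osc b (B x r) * ?m) + ennreal ((K1 + K2) * r powr \<beta>) * emeasure lebesgue (B x r) =
        ennreal (osc b (B x r) * ?m + (K1 + K2) * r powr \<beta> * ?m)"
      using emeasure_eq_measure2[OF B_lmeasurable, of x r] K1 K2 osc_nonneg[of b "B x r"]
      by (simp add: ennreal_mult'[symmetric] ennreal_plus[symmetric] del: ennreal_plus)
    also have "\<dots> \<le> ennreal ((K + (K1 + K2)) * r powr \<beta> * ?m)"
      using mult_right_mono[OF osc[OF r, of x], of ?m] by (intro ennreal_leI) (simp add: distrib_right)
    finally show "(\<integral>\<^sup>+y\<in>B x r. ennreal \<bar>b y - b' y\<bar> \<partial>lebesgue) \<le> ennreal ((K + (K1 + K2)) * r powr \<beta> * ?m)" .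
  qed
  then have AE: "AE x in lebesgue. b x = b' x" by simp
  show ?thesis
  proof (rule that[OF _ lip AE])
    fix z r assume r: "(0::real) < r"
    have "K1 * r powr \<beta> \<le> K2 * r powr \<beta>" using K2 by (intro mult_right_mono) auto
    then show "\<bar>b' z - average b (B z r)\<bar> \<le> K2 * r powr \<beta>" using b'_avg[OF r, of z] by simp
  qed
qed

end

section \<open>From Lipschitz functions to bounded commutators\<close>

lemma orlicz_norm_le:
  assumes "0 < l" "(\<integral>\<^sup>+x. \<Phi> (\<bar>f x\<bar> / l) \<partial>lebesgue) \<le> 1"
  shows "orlicz_norm \<Phi> f \<le> ennreal l"
  unfolding orlicz_norm_def using assms by (intro Inf_lower) auto

text \<open>
  The infimum that defines the norm may be over the empty set and is then \<open>\<infinity>\<close>; this is why \<open>c\<close>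
  must be positive.
\<close>

lemma le_cmult_orlicz_norm:
  assumes c: "0 < c" and X: "\<And>l. 0 < l \<Longrightarrow> (\<integral>\<^sup>+x. \<Phi> (\<bar>f x\<bar> / l) \<partial>lebesgue) \<le> 1 \<Longrightarrow> X \<le> ennreal (c * l)"
  shows "X \<le> ennreal c * orlicz_norm \<Phi> f"
proof -
  have "ennreal (1 / c) * X \<le> orlicz_norm \<Phi> f"
    unfolding orlicz_norm_def
  proof (rule Inf_greatest, clarify)
    fix l :: real assume l: "0 < l" "(\<integral>\<^sup>+x. \<Phi> (\<bar>f x\<bar> / l) \<partial>lebesgue) \<le> 1"
    have "ennreal (1 / c) * X \<le> ennreal (1 / c) * ennreal (c * l)" by (intro mult_left_mono X l) auto
    also have "\<dots> = ennreal l" using c l by (subst ennreal_mult'[symmetric]) auto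
    finally show "ennreal (1 / c) * X \<le> ennreal l" .
  qed
  then have "ennreal c * (ennreal (1 / c) * X) \<le> ennreal c * orlicz_norm \<Phi> f" by (rule mult_left_mono) simp
  moreover have "ennreal c * (ennreal (1 / c) * X) = X"
    using c by (subst mult.assoc[symmetric], subst ennreal_mult'[symmetric]) auto
  ultimately show ?thesis by simp
qed

lemma orlicz_space_admissible:
  assumes Y: "young_function \<Phi>" and f: "f \<in> orlicz_space \<Phi>"
  obtains l where "0 < l" "(\<integral>\<^sup>+x. \<Phi> (\<bar>f x\<bar> / l) \<partial>lebesgue) \<le> 1"
proof -
  obtain k where k: "0 < k" "(\<integral>\<^sup>+x. \<Phi> (k * \<bar>f x\<bar>) \<partial>lebesgue) < \<infinity>" and li: "locally_integrable f"
    using f by (auto simp: orlicz_space_def)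
  define I where "I = enn2real (\<integral>\<^sup>+x. \<Phi> (k * \<bar>f x\<bar>) \<partial>lebesgue)"
  have I: "0 \<le> I" "(\<integral>\<^sup>+x. \<Phi> (k * \<bar>f x\<bar>) \<partial>lebesgue) = ennreal I" using k by (auto simp: I_def)
  have "(\<integral>\<^sup>+x. \<Phi> (\<bar>f x\<bar> / ((I + 1) / k)) \<partial>lebesgue) \<le> (\<integral>\<^sup>+x. ennreal (1 / (I + 1)) * \<Phi> (k * \<bar>f x\<bar>) \<partial>lebesgue)"
  proof (rule nn_integral_mono)
    fix x
    have "\<Phi> (1 / (I + 1) * (k * \<bar>f x\<bar>)) \<le> ennreal (1 / (I + 1)) * \<Phi> (k * \<bar>f x\<bar>)"
      using I k by (intro young_scale[OF Y]) auto
    then show "\<Phi> (\<bar>f x\<bar> / ((I + 1) / k)) \<le> ennreal (1 / (I + 1)) * \<Phi> (k * \<bar>f x\<bar>)"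
      by (simp add: mult_ac)
  qed
  also have "\<dots> = ennreal (1 / (I + 1)) * ennreal I"
    unfolding I(2)[symmetric]
    using locally_integrable_measurable[OF li] k by (intro nn_integral_cmult young_measurable[OF Y]) auto
  also have "\<dots> = ennreal (I / (I + 1))" using I by (simp add: ennreal_mult'[symmetric])
  also have "\<dots> \<le> 1" using I by simp
  finally show ?thesis using that[of "(I + 1) / k"] k I by simp
qed

context ball_geometry
begin

lemma sharp_max_measurable:
  assumes f: "\<And>z r. set_integrable lebesgue (B z r) f"
  shows "sharp_max G \<rho> f \<in> borel_measurable lebesgue"
proof (rule borel_measurableI_greater)
  fix t :: ennreal
  have "open {x. t < sharp_max G \<rho> f x}"
  proof (subst open_subopen, intro ballI)
    fix x assume "x \<in> {x. t < sharp_max G \<rho> f x}"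
    then obtain z r where zr: "0 < r" "x \<in> B z r" "t < ennreal (osc f (B z r))"
      unfolding mem_Collect_eq sharp_max_eq[OF f] less_SUP_iff by auto
    then have "B z r \<subseteq> {x. t < sharp_max G \<rho> f x}"
      using sharp_max_upper[OF f zr(1)] by (auto intro: less_le_trans)
    then show "\<exists>T. open T \<and> x \<in> T \<and> T \<subseteq> {x. t < sharp_max G \<rho> f x}"
      using open_ball' zr(2) by blast
  qed
  then show "{x \<in> space lebesgue. t < sharp_max G \<rho> f x} \<in> sets lebesgue" by auto
qed

lemma maxfun_cmult:
  assumes h: "h \<in> borel_measurable lebesgue"
  shows "maxfun (\<lambda>y. ennreal l * h y) x \<le> ennreal l * maxfun h x"
proof (rule maxfun_least)
  fix z r assume zr: "0 < r" "x \<in> B z r"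
  have "(\<integral>\<^sup>+y\<in>B z r. ennreal l * h y \<partial>lebesgue) = ennreal l * (\<integral>\<^sup>+y\<in>B z r. h y \<partial>lebesgue)"
    using h by (simp add: mult.assoc nn_integral_cmult)
  then have "(\<integral>\<^sup>+y\<in>B z r. ennreal l * h y \<partial>lebesgue) / emeasure lebesgue (B z r) =
      ennreal l * ((\<integral>\<^sup>+y\<in>B z r. h y \<partial>lebesgue) / emeasure lebesgue (B z r))"
    by (simp add: ennreal_times_divide)
  also have "\<dots> \<le> ennreal l * maxfun h x" by (intro mult_left_mono maxfun_upper zr) auto
  finally show "(\<integral>\<^sup>+y\<in>B z r. ennreal l * h y \<partial>lebesgue) / emeasure lebesgue (B z r) \<le> ennreal l * maxfun h x" .
qed

lemma volume_powr:
  assumes "0 < r"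
  shows "vol (B z r) powr (\<beta> / real Q) = c1 powr (\<beta> / real Q) * r powr \<beta>"
  using radius_powr[OF assms measure_ball[OF assms, of z], of \<beta>] c1
  by (simp add: mult.assoc[symmetric] powr_add[symmetric])

lemma locally_integrable_lipschitz_mult:
  assumes f: "locally_integrable f" and b: "locally_integrable b" and \<beta>: "0 < \<beta>"
    and ae: "AE x in lebesgue. b x = b' x" and lip: "\<And>x y. \<bar>b' x - b' y\<bar> \<le> C * qd x y powr \<beta>"
  shows "locally_integrable (\<lambda>x. b x * f x)"
  unfolding locally_integrable_def
proof (intro allI impI)
  fix K :: "'a set" assume K: "compact K"
  have "compact (b' ` K)"
    by (rule compact_continuous_image[OF continuous_on_subset[OF lipschitz_continuous[OF lip \<beta>]] K]) simp
  then obtain M where M: "\<And>x. x \<in> K \<Longrightarrow> \<bar>b' x\<bar> \<le> M"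
    using compact_imp_bounded bounded_iff by (metis image_eqI real_norm_def)
  have KS: "K \<in> sets lebesgue" using K lmeasurable_compact by blast
  have fK: "integrable lebesgue (\<lambda>x. M *\<^sub>R (indicator K x *\<^sub>R f x))"
    using f K by (auto simp: locally_integrable_def set_integrable_def)
  show "set_integrable lebesgue K (\<lambda>x. b x * f x)"
    unfolding set_integrable_def
  proof (rule Bochner_Integration.integrable_bound[OF fK])
    show "(\<lambda>x. indicator K x *\<^sub>R (b x * f x)) \<in> borel_measurable lebesgue"
      using locally_integrable_measurable[OF f] locally_integrable_measurable[OF b] KS by simp
    show "AE x in lebesgue. norm (indicator K x *\<^sub>R (b x * f x)) \<le> norm (M *\<^sub>R (indicator K x *\<^sub>R f x))"
      using ae
    proof (rule eventually_mono)
      fix x assume bx: "b x = b' x"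
      show "norm (indicator K x *\<^sub>R (b x * f x)) \<le> norm (M *\<^sub>R (indicator K x *\<^sub>R f x))"
      proof (cases "x \<in> K")
        case True
        then have "\<bar>b' x\<bar> * \<bar>f x\<bar> \<le> \<bar>M\<bar> * \<bar>f x\<bar>" using M[OF True] by (intro mult_right_mono) auto
        then show ?thesis using True by (simp add: bx abs_mult)
      qed simp
    qed
  qed
qed

text \<open>
  Let \<open>l\<close> be admissible for \<open>f\<close> and put \<open>h = \<bar>f\<bar> / l\<close>. At a point \<open>x\<close> where \<open>b x \<ge> 0\<close> and \<open>M h x\<close> is
  finite, freezing \<open>b\<close> at \<open>b x\<close> and Hedberg's argument bound the commutator by \<open>A * l * g x\<close> with
  \<open>g = \<Psi>\<inverse> (\<Phi> (M h / L))\<close>. Since \<open>\<Psi> (g x) \<le> \<Phi> (M h x / L)\<close>, the number \<open>A * l\<close> is admissible for the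
  commutator.
\<close>

lemma commutator_bounded:
  assumes Y: "young_function \<Phi>" "young_function \<Psi>" and \<Phi>: "\<Phi> \<in> young_Y" "nabla2 \<Phi>"
    and \<beta>: "0 < \<beta>" and c: "0 < c"
    and inv: "\<And>t. 0 < t \<Longrightarrow> young_inverse \<Phi> t * t powr (- \<beta> / real Q) \<le> c * young_inverse \<Psi> t"
    and b: "locally_integrable b" and nonneg: "AE x in lebesgue. 0 \<le> b x"
    and lip: "b \<in> lipschitz_space G \<rho> \<beta>"
  shows "sharp_commutator_bounded G \<rho> b \<Phi> \<Psi>"
proof -
  obtain b' C' where ae: "AE x in lebesgue. b x = b' x" and lip': "\<And>x y. \<bar>b' x - b' y\<bar> \<le> C' * qd x y powr \<beta>"
    using lip by (auto simp: lipschitz_space_def qd_def)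
  define C where "C = \<bar>C'\<bar>"
  have C: "0 \<le> C" "\<bar>b' x - b' y\<bar> \<le> C * qd x y powr \<beta>" for x y
  proof -
    have "C' * qd x y powr \<beta> \<le> C * qd x y powr \<beta>" by (intro mult_right_mono) (auto simp: C_def)
    then show "\<bar>b' x - b' y\<bar> \<le> C * qd x y powr \<beta>" using lip'[of x y] by linarith
  qed (simp add: C_def)
  obtain L where L: "1 \<le> L" "\<And>h :: 'a \<Rightarrow> real. h \<in> borel_measurable lebesgue \<Longrightarrow> (\<And>x. 0 \<le> h x) \<Longrightarrow>
      (\<integral>\<^sup>+x. \<Phi> (h x) \<partial>lebesgue) \<le> 1 \<Longrightarrow>
      (\<integral>\<^sup>+x. \<Phi> (enn2real (maxfun (\<lambda>y. ennreal (h y)) x) / L) \<partial>lebesgue) \<le> 1"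
  proof (rule modular_maxfun_le_1[OF Y(1) \<Phi>(2)], goal_cases)
    case (1 L)
    show ?case by (rule 1(1)) (use 1(2,3) in blast)+
  qed
  have \<Phi>_fin: "\<Phi> r < \<infinity>" if "0 \<le> r" for r
    using that \<Phi>(1) young_0[OF Y(1)] by (cases "r = 0") (auto simp: young_Y_def)
  define A0 where "A0 = c1 powr (- \<beta> / real Q) * (L + 2) * c"
  define A where "A = 2 * (C * (2 * c0) powr \<beta>) * A0 + 1"
  have A0: "0 \<le> A0" using L c by (simp add: A0_def)
  have A: "0 < A" "2 * (C * (2 * c0) powr \<beta>) * A0 \<le> A"
    using C(1) A0 by (auto simp: A_def intro!: add_nonneg_pos)
  have main: "(AE x in lebesgue. sharp_max G \<rho> f x < \<infinity>) \<and>
      (AE x in lebesgue. sharp_max G \<rho> (\<lambda>y. b y * f y) x < \<infinity>) \<and>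
      orlicz_norm \<Psi> (sharp_commutator G \<rho> b f) \<le> ennreal (A * l)"
    if f: "locally_integrable f" and bf: "locally_integrable (\<lambda>x. b x * f x)"
      and l: "0 < l" "(\<integral>\<^sup>+x. \<Phi> (\<bar>f x\<bar> / l) \<partial>lebesgue) \<le> 1" for f l
  proof -
    define h where "h y = \<bar>f y\<bar> / l" for y
    have h: "h \<in> borel_measurable lebesgue" "\<And>y. 0 \<le> h y"
      using locally_integrable_measurable[OF f] l by (auto simp: h_def[abs_def])
    have h_mod: "(\<integral>\<^sup>+x. \<Phi> (h x) \<partial>lebesgue) \<le> 1" using l by (simp add: h_def)
    let ?M = "maxfun (\<lambda>y. ennreal (h y))"
    have M_fin: "AE x in lebesgue. ?M x < \<infinity>"
      using \<Phi>(1) by (intro maxfun_finite_modular[OF Y(1) _ _ h h_mod]) (auto simp: young_Y_def)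
    define g where "g x = young_inverse \<Psi> (enn2real (\<Phi> (enn2real (?M x) / L)))" for x
    have g0: "0 \<le> g x" for x unfolding g_def by (rule young_inverse_nonneg[OF Y(2)])
    have f_fin: "sharp_max G \<rho> f x < \<infinity>" if "?M x < \<infinity>" for x
    proof -
      have "sharp_max G \<rho> f x \<le> 2 * maxfun (\<lambda>y. ennreal \<bar>f y\<bar>) x"
        by (rule sharp_max_le_maxfun[OF integrable_on_B[OF f]])
      also have "(\<lambda>y. ennreal \<bar>f y\<bar>) = (\<lambda>y. ennreal l * ennreal (h y))"
        using l by (auto simp: h_def ennreal_mult'[symmetric])
      also have "2 * maxfun (\<lambda>y. ennreal l * ennreal (h y)) x \<le> 2 * (ennreal l * ?M x)"
        using h by (intro mult_left_mono maxfun_cmult) auto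
      also have "\<dots> < \<infinity>" using that by (auto simp: ennreal_mult_less_top)
      finally show ?thesis .
    qed
    have pointwise: "sharp_max G \<rho> (\<lambda>y. b y * f y) x \<le> ennreal (b x) * sharp_max G \<rho> f x + ennreal (A * l * g x)
        \<and> ennreal (b x) * sharp_max G \<rho> f x \<le> sharp_max G \<rho> (\<lambda>y. b y * f y) x + ennreal (A * l * g x)"
      if x: "?M x < \<infinity>" "b x = b' x" "0 \<le> b x" for x
    proof -
      have ball: "osc (\<lambda>y. b y * f y) (B z r) \<le> b x * osc f (B z r) + A * l * g x \<and>
          b x * osc f (B z r) \<le> osc (\<lambda>y. b y * f y) (B z r) + A * l * g x" if zr: "0 < r" "x \<in> B z r" for z r
      proof -
        let ?avg = "(LINT y:B z r|lebesgue. \<bar>f y\<bar>) / vol (B z r)"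
        define \<delta> where "\<delta> = C * (2 * c0) powr \<beta> * r powr \<beta>"
        have \<delta>: "AE y in lebesgue. y \<in> B z r \<longrightarrow> \<bar>b y - b x\<bar> \<le> \<delta>"
          using ae
        proof (rule eventually_mono, intro impI)
          fix y assume y: "b y = b' y" "y \<in> B z r"
          have "qd y x < c0 * (r + r)"
            using y zr by (intro qd_triangle_less[of y z]) (auto simp: mem_B qd_sym)
          then have "C * qd y x powr \<beta> \<le> C * (2 * c0 * r) powr \<beta>"
            using C(1) \<beta> by (intro mult_left_mono powr_mono2) (auto simp: qd_nonneg algebra_simps)
          then show "\<bar>b y - b x\<bar> \<le> \<delta>"
            using C(2)[of y x] zr c0 by (simp add: y x(2) \<delta>_def powr_mult mult_ac)
        qed
        have h_int: "set_integrable lebesgue (B z r) h"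
          using set_integrable_abs[OF integrable_on_B[OF f, of z r]] l
          by (simp add: h_def[abs_def])
        have lint: "(LINT y:B z r|lebesgue. \<bar>f y\<bar>) = l * (LINT y:B z r|lebesgue. h y)"
          using l by (simp add: h_def)
        have "(\<integral>\<^sup>+y\<in>B z r. ennreal (h y) \<partial>lebesgue) = ennreal (LINT y:B z r|lebesgue. h y)"
          using nn_integral_abs_B[OF h_int] h(2) by simp
        moreover have "0 \<le> (LINT y:B z r|lebesgue. h y)"
          using LINT_abs_nonneg[of "B z r" h] h(2) by simp
        ultimately have "r powr \<beta> * ((LINT y:B z r|lebesgue. h y) / vol (B z r)) \<le> A0 * g x"
          unfolding A0_def g_def
          by (intro fractional_average_le[OF Y \<Phi>(1) \<beta> L(1) c inv h h_mod x(1) zr])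
        then have "(2 * (C * (2 * c0) powr \<beta>) * l) * (r powr \<beta> * ((LINT y:B z r|lebesgue. h y) / vol (B z r)))
            \<le> (2 * (C * (2 * c0) powr \<beta>) * l) * (A0 * g x)"
          using C(1) l by (intro mult_left_mono) auto
        also have "\<dots> = (2 * (C * (2 * c0) powr \<beta>) * A0) * (l * g x)" by (simp add: mult_ac)
        also have "\<dots> \<le> A * (l * g x)" using A l g0 by (intro mult_right_mono) auto
        finally have "2 * \<delta> * ?avg \<le> A * l * g x" by (simp add: \<delta>_def lint mult_ac)
        then show ?thesis
          using osc_freeze[OF integrable_on_B[OF f] integrable_on_B[OF bf] zr(1) x(3) \<delta>] by linarith
      qed
      have Ag: "0 \<le> A * l * g x" using A l g0 by simp
      show ?thesis
      proof
        show "sharp_max G \<rho> (\<lambda>y. b y * f y) x \<le> ennreal (b x) * sharp_max G \<rho> f x + ennreal (A * l * g x)"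
        proof (rule sharp_max_least[OF integrable_on_B[OF bf]])
          fix z r assume zr: "0 < r" "x \<in> B z r"
          have "ennreal (osc (\<lambda>y. b y * f y) (B z r)) \<le> ennreal (b x * osc f (B z r) + A * l * g x)"
            using ball[OF zr] by (intro ennreal_leI) simp
          also have "\<dots> = ennreal (b x) * ennreal (osc f (B z r)) + ennreal (A * l * g x)"
            using Ag x(3) osc_nonneg[of f "B z r"] by (simp add: ennreal_mult)
          also have "\<dots> \<le> ennreal (b x) * sharp_max G \<rho> f x + ennreal (A * l * g x)"
            by (intro add_right_mono mult_left_mono sharp_max_upper[OF integrable_on_B[OF f]] zr) auto
          finally show "ennreal (osc (\<lambda>y. b y * f y) (B z r)) \<le> ennreal (b x) * sharp_max G \<rho> f x + ennreal (A * l * g x)" .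
        qed
        have "ennreal (b x) * sharp_max G \<rho> f x = (SUP (z, r)\<in>{(z, r). 0 < r \<and> x \<in> B z r}. ennreal (b x) * ennreal (osc f (B z r)))"
          unfolding sharp_max_eq[OF integrable_on_B[OF f]] by (simp add: SUP_mult_left_ennreal case_prod_unfold)
        also have "\<dots> \<le> sharp_max G \<rho> (\<lambda>y. b y * f y) x + ennreal (A * l * g x)"
        proof (rule SUP_least, clarify)
          fix z r assume zr: "0 < r" "x \<in> B z r"
          have "ennreal (b x) * ennreal (osc f (B z r)) = ennreal (b x * osc f (B z r))"
            using x(3) by (simp add: ennreal_mult')
          also have "\<dots> \<le> ennreal (osc (\<lambda>y. b y * f y) (B z r) + A * l * g x)"
            using ball[OF zr] by (intro ennreal_leI) simp
          also have "\<dots> = ennreal (osc (\<lambda>y. b y * f y) (B z r)) + ennreal (A * l * g x)"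
            using Ag osc_nonneg by simp
          also have "\<dots> \<le> sharp_max G \<rho> (\<lambda>y. b y * f y) x + ennreal (A * l * g x)"
            by (intro add_right_mono sharp_max_upper[OF integrable_on_B[OF bf]] zr)
          finally show "ennreal (b x) * ennreal (osc f (B z r)) \<le> sharp_max G \<rho> (\<lambda>y. b y * f y) x + ennreal (A * l * g x)" .
        qed
        finally show "ennreal (b x) * sharp_max G \<rho> f x \<le> sharp_max G \<rho> (\<lambda>y. b y * f y) x + ennreal (A * l * g x)" .
      qed
    qed
    have good: "AE x in lebesgue. ?M x < \<infinity> \<and> b x = b' x \<and> 0 \<le> b x"
      using M_fin ae nonneg by (intro AE_conjI)
    have bf_fin: "sharp_max G \<rho> (\<lambda>y. b y * f y) x < \<infinity>" if "?M x < \<infinity> \<and> b x = b' x \<and> 0 \<le> b x" for x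
    proof -
      have "sharp_max G \<rho> (\<lambda>y. b y * f y) x \<le> ennreal (b x) * sharp_max G \<rho> f x + ennreal (A * l * g x)"
        using pointwise that by blast
      also have "\<dots> < \<infinity>" using f_fin that by (auto simp: ennreal_mult_less_top)
      finally show ?thesis .
    qed
    have comm: "\<bar>sharp_commutator G \<rho> b f x\<bar> \<le> A * l * g x" if x: "?M x < \<infinity> \<and> b x = b' x \<and> 0 \<le> b x" for x
    proof -
      define S where "S = enn2real (sharp_max G \<rho> f x)"
      define T where "T = enn2real (sharp_max G \<rho> (\<lambda>y. b y * f y) x)"
      have S: "sharp_max G \<rho> f x = ennreal S" "0 \<le> S" using f_fin x by (auto simp: S_def)
      have T: "sharp_max G \<rho> (\<lambda>y. b y * f y) x = ennreal T" "0 \<le> T" using bf_fin[OF x] by (auto simp: T_def)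
      have Ag: "0 \<le> A * l * g x" using A l g0 by simp
      have "ennreal T \<le> ennreal (b x * S + A * l * g x)" "ennreal (b x * S) \<le> ennreal (T + A * l * g x)"
        using pointwise[of x] x S T Ag by (simp_all add: ennreal_mult)
      then have "T \<le> b x * S + A * l * g x" "b x * S \<le> T + A * l * g x"
        using x S T Ag by (simp_all add: ennreal_le_iff del: ennreal_plus)
      then show ?thesis by (simp add: sharp_commutator_def S_def[symmetric] T_def[symmetric] abs_le_iff)
    qed
    have "(\<integral>\<^sup>+x. \<Psi> (\<bar>sharp_commutator G \<rho> b f x\<bar> / (A * l)) \<partial>lebesgue) \<le> (\<integral>\<^sup>+x. \<Phi> (enn2real (?M x) / L) \<partial>lebesgue)"
    proof (rule nn_integral_mono_AE, use good in \<open>rule eventually_mono\<close>)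
      fix x assume x: "?M x < \<infinity> \<and> b x = b' x \<and> 0 \<le> b x"
      have "\<Psi> (\<bar>sharp_commutator G \<rho> b f x\<bar> / (A * l)) \<le> \<Psi> (g x)"
        using comm[OF x] A l by (intro young_mono[OF Y(2)]) (auto simp: field_simps)
      also have "\<dots> \<le> ennreal (enn2real (\<Phi> (enn2real (?M x) / L)))"
        unfolding g_def by (rule young_young_inverse[OF Y(2)])
      also have "\<dots> = \<Phi> (enn2real (?M x) / L)" using \<Phi>_fin[of "enn2real (?M x) / L"] L by simp
      finally show "\<Psi> (\<bar>sharp_commutator G \<rho> b f x\<bar> / (A * l)) \<le> \<Phi> (enn2real (?M x) / L)" .
    qed
    also have "\<dots> \<le> 1" by (rule L(2)[OF h h_mod])
    finally have "orlicz_norm \<Psi> (sharp_commutator G \<rho> b f) \<le> ennreal (A * l)"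
      using A l by (intro orlicz_norm_le) auto
    moreover have "AE x in lebesgue. sharp_max G \<rho> f x < \<infinity>"
      using M_fin by (rule eventually_mono) (rule f_fin)
    moreover have "AE x in lebesgue. sharp_max G \<rho> (\<lambda>y. b y * f y) x < \<infinity>"
      using good by (rule eventually_mono) (rule bf_fin)
    ultimately show ?thesis by blast
  qed
  show ?thesis
    unfolding sharp_commutator_bounded_def
  proof (intro exI[of _ A] ballI)
    fix f :: "'a \<Rightarrow> real" assume fO: "f \<in> orlicz_space \<Phi>"
    then have f: "locally_integrable f" by (simp add: orlicz_space_def)
    have bf: "locally_integrable (\<lambda>x. b x * f x)"
      by (rule locally_integrable_lipschitz_mult[OF f b \<beta> ae lip'])
    obtain l where l: "0 < l" "(\<integral>\<^sup>+x. \<Phi> (\<bar>f x\<bar> / l) \<partial>lebesgue) \<le> 1"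
      using orlicz_space_admissible[OF Y(1) fO] .
    have "orlicz_norm \<Psi> (sharp_commutator G \<rho> b f) \<le> ennreal A * orlicz_norm \<Phi> f"
      using main[OF f bf] by (intro le_cmult_orlicz_norm A) blast
    then show "locally_integrable (\<lambda>x. b x * f x) \<and> (AE x in lebesgue. sharp_max G \<rho> f x < \<infinity>) \<and>
        (AE x in lebesgue. sharp_max G \<rho> (\<lambda>y. b y * f y) x < \<infinity>) \<and>
        orlicz_norm \<Psi> (sharp_commutator G \<rho> b f) \<le> ennreal A * orlicz_norm \<Phi> f"
      using main[OF f bf l] bf by blast
  qed
qed

end

section \<open>From bounded commutators to Lipschitz functions\<close>

context ball_geometry
begin

lemma integrable_on_B_indicator:
  assumes "locally_integrable b"
  shows "set_integrable lebesgue (B z s) (\<lambda>y. b y * indicator (B w r) y)"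
  by (rule integrable_indicator_mult[OF integrable_on_B[OF assms]])

lemma sharp_osc_measurable:
  assumes b: "locally_integrable b"
  shows "sharp_osc G \<rho> b (B z r) \<in> borel_measurable lebesgue"
proof -
  have "sharp_max G \<rho> (\<lambda>y. b y * indicator (B z r) y) \<in> borel_measurable lebesgue"
    by (rule sharp_max_measurable[OF integrable_on_B_indicator[OF b]])
  then show ?thesis
    using locally_integrable_measurable[OF b] by (simp add: sharp_osc_def[abs_def])
qed

lemma orlicz_norm_indicator_le:
  assumes Y: "young_function \<Phi>" and r: "0 < r"
  shows "orlicz_norm \<Phi> (indicator (B z r) :: 'a \<Rightarrow> real) \<le> ennreal (1 / young_inverse \<Phi> (1 / vol (B z r)))"
proof (rule orlicz_norm_le)
  let ?v = "vol (B z r)" and ?u = "young_inverse \<Phi> (1 / vol (B z r))"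
  have v: "0 < ?v" using r by (rule measure_B_pos)
  have u: "0 < ?u" using v by (intro young_inverse_pos[OF Y]) simp
  then show "0 < 1 / ?u" by simp
  have "(\<integral>\<^sup>+x. \<Phi> (\<bar>indicator (B z r) x\<bar> / (1 / ?u)) \<partial>lebesgue) = (\<integral>\<^sup>+x. \<Phi> ?u * indicator (B z r) x \<partial>lebesgue)"
    by (intro nn_integral_cong) (auto simp: indicator_def young_0[OF Y])
  also have "\<dots> = \<Phi> ?u * emeasure lebesgue (B z r)" by (simp add: nn_integral_cmult_indicator)
  also have "\<dots> \<le> ennreal (1 / ?v) * ennreal ?v"
    using young_young_inverse[OF Y] emeasure_eq_measure2[OF B_lmeasurable, of z r] by (intro mult_mono) auto
  also have "\<dots> = 1" using v by (simp add: ennreal_mult'[symmetric])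
  finally show "(\<integral>\<^sup>+x. \<Phi> (\<bar>indicator (B z r) x\<bar> / (1 / ?u)) \<partial>lebesgue) \<le> 1" .
qed

lemma indicator_in_orlicz_space:
  assumes Y: "young_function \<Phi>" and r: "0 < r"
  shows "(indicator (B z r) :: 'a \<Rightarrow> real) \<in> orlicz_space \<Phi>"
proof -
  let ?v = "vol (B z r)"
  have "locally_integrable (indicator (B z r) :: 'a \<Rightarrow> real)"
    unfolding locally_integrable_def
  proof (intro allI impI)
    fix K :: "'a set" assume "compact K"
    then have "K \<inter> B z r \<in> lmeasurable" using lmeasurable_compact B_lmeasurable by (intro fmeasurable.Int)
    then have "integrable lebesgue (indicator (K \<inter> B z r) :: 'a \<Rightarrow> real)" by (simp add: fmeasurable_def)
    then show "set_integrable lebesgue K (indicator (B z r) :: 'a \<Rightarrow> real)"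
      by (simp add: set_integrable_def indicator_inter_arith[symmetric])
  qed
  moreover have "\<exists>k>0. (\<integral>\<^sup>+x. \<Phi> (k * \<bar>indicator (B z r) x\<bar>) \<partial>lebesgue) < \<infinity>"
  proof (intro exI conjI)
    let ?u = "young_inverse \<Phi> 1"
    show "0 < ?u" by (rule young_inverse_pos[OF Y]) simp
    have "(\<integral>\<^sup>+x. \<Phi> (?u * \<bar>indicator (B z r) x\<bar>) \<partial>lebesgue) = (\<integral>\<^sup>+x. \<Phi> ?u * indicator (B z r) x \<partial>lebesgue)"
      by (intro nn_integral_cong) (auto simp: indicator_def young_0[OF Y])
    also have "\<dots> = \<Phi> ?u * emeasure lebesgue (B z r)" by (simp add: nn_integral_cmult_indicator)
    also have "\<dots> < \<infinity>"
      using young_young_inverse[OF Y, of 1] B_lmeasurable[of z r]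
      by (auto simp: ennreal_mult_less_top fmeasurable_def intro: le_less_trans)
    finally show "(\<integral>\<^sup>+x. \<Phi> (?u * \<bar>indicator (B z r) x\<bar>) \<partial>lebesgue) < \<infinity>" .
  qed
  ultimately show ?thesis by (simp add: orlicz_space_def)
qed

lemma sharp_osc_eq_commutator:
  assumes "0 < r" "x \<in> B z r"
  shows "sharp_osc G \<rho> b (B z r) x = 2 * sharp_commutator G \<rho> b (indicator (B z r)) x"
proof -
  have half: "enn2real (ennreal (1 / 2)) = 1 / 2" by (rule enn2real_ennreal) simp
  show ?thesis
    unfolding sharp_osc_def sharp_commutator_def sharp_max_indicator[OF assms] half by simp
qed

text \<open>
  Test the commutator on the indicator of the ball, whose norm is at most \<open>1 / \<Phi>\<inverse> (1 / v)\<close>. The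
  weight \<open>v powr (- \<beta> / Q) * \<Psi>\<inverse> (1 / v)\<close> is at most a constant times \<open>\<Phi>\<inverse> (1 / v)\<close>, as the two
  powers of \<open>v\<close> cancel.
\<close>

lemma orlicz_osc_of_commutator:
  assumes Y: "young_function \<Phi>" "young_function \<Psi>" and c: "0 < c"
    and inv: "\<And>t. 0 < t \<Longrightarrow> young_inverse \<Psi> t \<le> c * (young_inverse \<Phi> t * t powr (- \<beta> / real Q))"
    and bounded: "sharp_commutator_bounded G \<rho> b \<Phi> \<Psi>"
  shows "\<exists>C>0. \<forall>z r. 0 < r \<longrightarrow>
    ennreal (vol (B z r) powr (- \<beta> / real Q) * young_inverse \<Psi> (1 / vol (B z r))) *
      orlicz_norm_on \<Psi> (B z r) (sharp_osc G \<rho> b (B z r)) \<le> ennreal C"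
proof -
  obtain C0 where C0: "\<And>f. f \<in> orlicz_space \<Phi> \<Longrightarrow>
      orlicz_norm \<Psi> (sharp_commutator G \<rho> b f) \<le> ennreal C0 * orlicz_norm \<Phi> f"
    using bounded unfolding sharp_commutator_bounded_def by blast
  define C where "C = max 0 C0"
  have C: "0 \<le> C" "ennreal C0 = ennreal C" by (auto simp: C_def max_def ennreal_neg)
  have "ennreal (vol (B z r) powr (- \<beta> / real Q) * young_inverse \<Psi> (1 / vol (B z r))) *
      orlicz_norm_on \<Psi> (B z r) (sharp_osc G \<rho> b (B z r)) \<le> ennreal (2 * c * C + 1)" if r: "0 < r" for z r
  proof -
    let ?v = "vol (B z r)" and ?comm = "sharp_commutator G \<rho> b (indicator (B z r))"
    let ?u = "young_inverse \<Phi> (1 / ?v)"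
    have v: "0 < ?v" using r by (rule measure_B_pos)
    have u: "0 < ?u" using v by (intro young_inverse_pos[OF Y(1)]) simp
    have "orlicz_norm_on \<Psi> (B z r) (sharp_osc G \<rho> b (B z r)) \<le> ennreal 2 * orlicz_norm \<Psi> ?comm"
    proof (rule le_cmult_orlicz_norm)
      fix l :: real assume l: "0 < l" "(\<integral>\<^sup>+x. \<Psi> (\<bar>?comm x\<bar> / l) \<partial>lebesgue) \<le> 1"
      have "(\<integral>\<^sup>+x. \<Psi> (\<bar>sharp_osc G \<rho> b (B z r) x * indicator (B z r) x\<bar> / (2 * l)) \<partial>lebesgue) \<le> (\<integral>\<^sup>+x. \<Psi> (\<bar>?comm x\<bar> / l) \<partial>lebesgue)"
      proof (rule nn_integral_mono)
        fix x
        show "\<Psi> (\<bar>sharp_osc G \<rho> b (B z r) x * indicator (B z r) x\<bar> / (2 * l)) \<le> \<Psi> (\<bar>?comm x\<bar> / l)"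
          using l sharp_osc_eq_commutator[OF r, of x z b]
          by (cases "x \<in> B z r") (auto simp: abs_mult young_0[OF Y(2)])
      qed
      then show "orlicz_norm_on \<Psi> (B z r) (sharp_osc G \<rho> b (B z r)) \<le> ennreal (2 * l)"
        unfolding orlicz_norm_on_def using l by (intro orlicz_norm_le) auto
    qed simp
    also have "\<dots> \<le> ennreal 2 * (ennreal C * ennreal (1 / ?u))"
    proof (rule mult_left_mono)
      have "orlicz_norm \<Psi> ?comm \<le> ennreal C * orlicz_norm \<Phi> (indicator (B z r) :: 'a \<Rightarrow> real)"
        using C0[OF indicator_in_orlicz_space[OF Y(1) r]] C by simp
      also have "\<dots> \<le> ennreal C * ennreal (1 / ?u)"
        by (intro mult_left_mono orlicz_norm_indicator_le Y r) auto
      finally show "orlicz_norm \<Psi> ?comm \<le> ennreal C * ennreal (1 / ?u)" .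
    qed simp
    also have "ennreal C * ennreal (1 / ?u) = ennreal (C * (1 / ?u))"
      by (rule ennreal_mult'[symmetric, OF C(1)])
    also have "ennreal 2 * ennreal (C * (1 / ?u)) = ennreal (2 * (C * (1 / ?u)))"
      by (rule ennreal_mult'[symmetric]) simp
    finally have norm: "orlicz_norm_on \<Psi> (B z r) (sharp_osc G \<rho> b (B z r)) \<le> ennreal (2 * (C * (1 / ?u)))" .
    have "?v powr (- \<beta> / real Q) * young_inverse \<Psi> (1 / ?v) \<le> ?v powr (- \<beta> / real Q) * (c * (?u * (1 / ?v) powr (- \<beta> / real Q)))"
      using v by (intro mult_left_mono inv) auto
    also have "\<dots> = c * ?u * (?v powr (- \<beta> / real Q) * (1 / ?v) powr (- \<beta> / real Q))" by simp
    also have "?v powr (- \<beta> / real Q) * (1 / ?v) powr (- \<beta> / real Q) = 1"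
      using v by (simp add: powr_mult[symmetric])
    finally have k: "?v powr (- \<beta> / real Q) * young_inverse \<Psi> (1 / ?v) \<le> c * ?u" by simp
    have "ennreal (?v powr (- \<beta> / real Q) * young_inverse \<Psi> (1 / ?v)) * orlicz_norm_on \<Psi> (B z r) (sharp_osc G \<rho> b (B z r))
        \<le> ennreal (c * ?u) * ennreal (2 * (C * (1 / ?u)))"
      by (intro mult_mono norm ennreal_leI k) auto
    also have "\<dots> = ennreal (2 * c * C)" using c u by (subst ennreal_mult'[symmetric]) (auto simp: field_simps)
    also have "\<dots> \<le> ennreal (2 * c * C + 1)" by (intro ennreal_leI) simp
    finally show ?thesis .
  qed
  moreover have "0 < 2 * c * C + 1" using c C by (intro add_nonneg_pos) auto
  ultimately show ?thesis by blast
qed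

lemma L1_osc_of_orlicz_osc:
  assumes Y: "young_function \<Psi>" and b: "locally_integrable b" and r: "0 < r" and C: "0 < C"
    and bound: "ennreal (vol (B z r) powr (- \<beta> / real Q) * young_inverse \<Psi> (1 / vol (B z r))) *
      orlicz_norm_on \<Psi> (B z r) (sharp_osc G \<rho> b (B z r)) \<le> ennreal C"
  shows "ennreal (vol (B z r) powr (- 1 - \<beta> / real Q)) *
      (\<integral>\<^sup>+x\<in>B z r. ennreal \<bar>sharp_osc G \<rho> b (B z r) x\<bar> \<partial>lebesgue) \<le> ennreal (2 * C)"
proof -
  let ?v = "vol (B z r)" and ?u = "young_inverse \<Psi> (1 / vol (B z r))"
  let ?g = "sharp_osc G \<rho> b (B z r)" and ?N = "orlicz_norm_on \<Psi> (B z r) (sharp_osc G \<rho> b (B z r))"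
  have v: "0 < ?v" using r by (rule measure_B_pos)
  have u: "0 < ?u" using v by (intro young_inverse_pos[OF Y]) simp
  have "(\<integral>\<^sup>+x\<in>B z r. ennreal \<bar>?g x\<bar> \<partial>lebesgue) \<le> ennreal (2 * ?v * ?u) * ?N"
    unfolding orlicz_norm_on_def
  proof (rule le_cmult_orlicz_norm)
    fix l :: real assume l: "0 < l" "(\<integral>\<^sup>+x. \<Psi> (\<bar>?g x * indicator (B z r) x\<bar> / l) \<partial>lebesgue) \<le> 1"
    have "(\<integral>\<^sup>+x\<in>B z r. \<Psi> (\<bar>?g x\<bar> / l) \<partial>lebesgue) = (\<integral>\<^sup>+x. \<Psi> (\<bar>?g x * indicator (B z r) x\<bar> / l) \<partial>lebesgue)"
      by (intro nn_integral_cong) (auto simp: indicator_def young_0[OF Y])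
    then show "(\<integral>\<^sup>+x\<in>B z r. ennreal \<bar>?g x\<bar> \<partial>lebesgue) \<le> ennreal (2 * ?v * ?u * l)"
      using l v sharp_osc_measurable[OF b, of z r]
      by (intro orlicz_average_le[OF Y B_lmeasurable]) auto
  qed (use u v in simp)
  then have "ennreal (?v powr (- 1 - \<beta> / real Q)) * (\<integral>\<^sup>+x\<in>B z r. ennreal \<bar>?g x\<bar> \<partial>lebesgue) \<le>
      ennreal (?v powr (- 1 - \<beta> / real Q)) * (ennreal (2 * ?v * ?u) * ?N)"
    by (rule mult_left_mono) simp
  also have "\<dots> = ennreal (?v powr (- 1 - \<beta> / real Q) * (2 * ?v * ?u)) * ?N"
    by (subst mult.assoc[symmetric], subst ennreal_mult'[symmetric]) auto
  also have "?v powr (- 1 - \<beta> / real Q) * (2 * ?v * ?u) = 2 * (?v powr (- \<beta> / real Q) * ?u)"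
  proof -
    have "?v powr (- 1 - \<beta> / real Q) * ?v powr 1 = ?v powr (- \<beta> / real Q)"
      by (subst powr_add[symmetric]) simp
    then show ?thesis using v by (simp add: mult_ac)
  qed
  also have "ennreal (2 * (?v powr (- \<beta> / real Q) * ?u)) * ?N = 2 * (ennreal (?v powr (- \<beta> / real Q) * ?u) * ?N)"
    using u by (subst ennreal_mult) (auto simp: mult.assoc)
  also have "\<dots> \<le> 2 * ennreal C" by (intro mult_left_mono bound) auto
  also have "\<dots> = ennreal (2 * C)" using C by (simp add: ennreal_mult)
  finally show ?thesis .
qed

lemma set_integrable_pos_part:
  assumes "set_integrable M A (f :: _ \<Rightarrow> real)"
  shows "set_integrable M A (\<lambda>x. max 0 (f x))"
proof -
  have "integrable M (\<lambda>x. max 0 (indicator A x *\<^sub>R f x))"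
    using assms unfolding set_integrable_def by (intro integrable_max) auto
  moreover have "(\<lambda>x. max 0 (indicator A x *\<^sub>R f x)) = (\<lambda>x. indicator A x *\<^sub>R max 0 (f x))"
    by (auto simp: indicator_def)
  ultimately show ?thesis unfolding set_integrable_def by simp
qed

text \<open>
  Almost everywhere on the ball \<open>\<bar>c\<bar> - b \<le> \<bar>sharp_osc\<bar>\<close>, where \<open>c\<close> is the average of \<open>b\<close>. For the
  first claim recall that \<open>c - b\<close> has mean zero, so the integral of \<open>\<bar>c - b\<bar>\<close> is twice that of its
  positive part, and \<open>c \<le> \<bar>c\<bar>\<close>. For the second claim integrate \<open>\<bar>c\<bar> - b\<close> itself.
\<close>

lemma sharp_osc_controls:
  assumes b: "locally_integrable b" and r: "0 < r" and X: "0 \<le> X"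
    and bound: "(\<integral>\<^sup>+x\<in>B z r. ennreal \<bar>sharp_osc G \<rho> b (B z r) x\<bar> \<partial>lebesgue) \<le> ennreal (X * vol (B z r))"
  shows "osc b (B z r) \<le> 2 * X" and "\<bar>average b (B z r)\<bar> - average b (B z r) \<le> X"
proof -
  let ?c = "average b (B z r)" and ?v = "vol (B z r)"
  let ?g = "\<lambda>y. b y * indicator (B z r) y"
  have v: "0 < ?v" using r by (rule measure_B_pos)
  note g = integrable_on_B_indicator[OF b, of _ _ z r]
  have "AE x in lebesgue. maxfun (\<lambda>y. ennreal \<bar>?g y\<bar>) x < \<infinity>"
  proof (rule maxfun_finite_integrable)
    show "(\<lambda>y. ennreal \<bar>?g y\<bar>) \<in> borel_measurable lebesgue"
      using locally_integrable_measurable[OF b] by simp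
    have "(\<integral>\<^sup>+y. ennreal \<bar>?g y\<bar> \<partial>lebesgue) = (\<integral>\<^sup>+y\<in>B z r. ennreal \<bar>b y\<bar> \<partial>lebesgue)"
      by (intro nn_integral_cong) (auto simp: indicator_def)
    then show "(\<integral>\<^sup>+y. ennreal \<bar>?g y\<bar> \<partial>lebesgue) < \<infinity>"
      by (simp add: nn_integral_abs_B[OF integrable_on_B[OF b]])
  qed
  then have key: "AE x in lebesgue. x \<in> B z r \<longrightarrow> \<bar>?c\<bar> - b x \<le> \<bar>sharp_osc G \<rho> b (B z r) x\<bar>"
  proof (rule eventually_mono, intro impI)
    fix x assume fin: "maxfun (\<lambda>y. ennreal \<bar>?g y\<bar>) x < \<infinity>" and x: "x \<in> B z r"
    have "sharp_max G \<rho> ?g x \<le> 2 * maxfun (\<lambda>y. ennreal \<bar>?g y\<bar>) x"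
      by (rule sharp_max_le_maxfun[OF g])
    also have "\<dots> < \<infinity>" using fin by (auto simp: ennreal_mult_less_top)
    finally have sfin: "sharp_max G \<rho> ?g x < \<infinity>" .
    have "x \<in> B z (double_radius r)" using x double_ball(2)[OF r] by blast
    from enn2real_mono[OF sharp_max_upper[OF g double_ball(1)[OF r] this]] sfin
    have "osc ?g (B z (double_radius r)) \<le> enn2real (sharp_max G \<rho> ?g x)"
      by (simp add: osc_nonneg)
    then have "\<bar>?c\<bar> \<le> 2 * enn2real (sharp_max G \<rho> ?g x)"
      using abs_average_le_osc[OF r integrable_on_B[OF b], of z] by linarith
    then show "\<bar>?c\<bar> - b x \<le> \<bar>sharp_osc G \<rho> b (B z r) x\<bar>" by (simp add: sharp_osc_def)
  qed
  have ib: "set_integrable lebesgue (B z r) b" by (rule integrable_on_B[OF b])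
  have control: "(LINT y:B z r|lebesgue. \<bar>f y\<bar>) \<le> X * ?v"
    if f: "set_integrable lebesgue (B z r) f" and le: "\<And>y. \<bar>f y\<bar> \<le> max 0 (\<bar>?c\<bar> - b y)" for f
  proof -
    have "ennreal (LINT y:B z r|lebesgue. \<bar>f y\<bar>) = (\<integral>\<^sup>+y\<in>B z r. ennreal \<bar>f y\<bar> \<partial>lebesgue)"
      by (rule nn_integral_abs_B[OF f, symmetric])
    also have "\<dots> \<le> (\<integral>\<^sup>+x\<in>B z r. ennreal \<bar>sharp_osc G \<rho> b (B z r) x\<bar> \<partial>lebesgue)"
    proof (rule nn_integral_mono_AE, use key in \<open>rule eventually_mono\<close>)
      fix y assume y: "y \<in> B z r \<longrightarrow> \<bar>?c\<bar> - b y \<le> \<bar>sharp_osc G \<rho> b (B z r) y\<bar>"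
      show "ennreal \<bar>f y\<bar> * indicator (B z r) y \<le> ennreal \<bar>sharp_osc G \<rho> b (B z r) y\<bar> * indicator (B z r) y"
        using y le[of y] by (auto simp: indicator_def intro!: ennreal_leI)
    qed
    also note bound
    finally show ?thesis using X v by simp
  qed
  have Ib: "(LINT y:B z r|lebesgue. ?c - b y) = 0"
  proof -
    have "(LINT y:B z r|lebesgue. ?c - b y) = (LINT y:B z r|lebesgue. ?c) - (LINT y:B z r|lebesgue. b y)"
      by (rule set_integral_diff(2)[OF set_integrable_const_B ib])
    then show ?thesis using v by (simp add: LINT_const_B average_def)
  qed
  have i1: "set_integrable lebesgue (B z r) (\<lambda>y. ?c - b y)"
    by (rule set_integral_diff(1)[OF set_integrable_const_B ib])
  define p where "p y = max 0 (?c - b y)" for y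
  have ip: "set_integrable lebesgue (B z r) p"
    unfolding p_def[abs_def] by (rule set_integrable_pos_part[OF i1])
  have "\<bar>b y - ?c\<bar> = 2 * p y - (?c - b y)" for y
    by (auto simp: p_def max_def abs_if)
  then have "(LINT y:B z r|lebesgue. \<bar>b y - ?c\<bar>) = (LINT y:B z r|lebesgue. 2 * p y - (?c - b y))"
    by simp
  also have "\<dots> = (LINT y:B z r|lebesgue. 2 * p y) - (LINT y:B z r|lebesgue. ?c - b y)"
    using ip i1 by (intro set_integral_diff(2)) auto
  also have "\<dots> = 2 * (LINT y:B z r|lebesgue. \<bar>p y\<bar>)"
  proof -
    have "\<bar>p y\<bar> = p y" for y by (auto simp: p_def)
    then show ?thesis by (simp add: Ib)
  qed
  also have "\<dots> \<le> 2 * (X * ?v)"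
    by (intro mult_left_mono control ip) (auto simp: p_def max_def abs_if)
  finally show "osc b (B z r) \<le> 2 * X"
    unfolding osc_def using v by (simp add: divide_le_eq)
  define q where "q y = max 0 (\<bar>?c\<bar> - b y)" for y
  have i2: "set_integrable lebesgue (B z r) (\<lambda>y. \<bar>?c\<bar> - b y)"
    by (rule set_integral_diff(1)[OF set_integrable_const_B ib])
  have iq: "set_integrable lebesgue (B z r) q"
    unfolding q_def[abs_def] by (rule set_integrable_pos_part[OF i2])
  have "(LINT y:B z r|lebesgue. \<bar>?c\<bar> - b y) = (LINT y:B z r|lebesgue. \<bar>?c\<bar>) - (LINT y:B z r|lebesgue. b y)"
    by (rule set_integral_diff(2)[OF set_integrable_const_B ib])
  then have "?v * (\<bar>?c\<bar> - ?c) = (LINT y:B z r|lebesgue. \<bar>?c\<bar> - b y)"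
    using v by (simp add: LINT_const_B average_def right_diff_distrib)
  also have "\<dots> \<le> (LINT y:B z r|lebesgue. \<bar>q y\<bar>)"
    by (intro set_integral_mono i2 set_integrable_abs iq) (auto simp: q_def)
  also have "\<dots> \<le> X * ?v" by (intro control iq) (auto simp: q_def)
  finally show "\<bar>?c\<bar> - ?c \<le> X" using v by (simp add: mult.commute)
qed

text \<open>
  Campanato's theorem gives the Lipschitz representative \<open>b'\<close>. Its nonnegativity is the limit of
  \<open>\<bar>average b (B x r)\<bar> - average b (B x r) \<le> K r\<^sup>\<beta>\<close> as \<open>r \<rightarrow> 0\<close>.
\<close>

lemma lipschitz_of_L1_osc:
  assumes b: "locally_integrable b" and \<beta>: "0 < \<beta>" and C: "0 < C"
    and bound: "\<And>z r. 0 < r \<Longrightarrow> ennreal (vol (B z r) powr (- 1 - \<beta> / real Q)) *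
      (\<integral>\<^sup>+x\<in>B z r. ennreal \<bar>sharp_osc G \<rho> b (B z r) x\<bar> \<partial>lebesgue) \<le> ennreal C"
  shows "b \<in> lipschitz_space G \<rho> \<beta>" and "AE x in lebesgue. 0 \<le> b x"
proof -
  define K where "K = C * c1 powr (\<beta> / real Q)"
  have K: "0 \<le> K" using C by (simp add: K_def)
  have L1: "(\<integral>\<^sup>+x\<in>B z r. ennreal \<bar>sharp_osc G \<rho> b (B z r) x\<bar> \<partial>lebesgue) \<le>
      ennreal (K * r powr \<beta> * vol (B z r))" if r: "0 < r" for z r
  proof -
    let ?v = "vol (B z r)" and ?I = "\<integral>\<^sup>+x\<in>B z r. ennreal \<bar>sharp_osc G \<rho> b (B z r) x\<bar> \<partial>lebesgue"
    have v: "0 < ?v" using r by (rule measure_B_pos)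
    have "ennreal (?v powr (1 + \<beta> / real Q)) * (ennreal (?v powr (- 1 - \<beta> / real Q)) * ?I) \<le> ennreal (?v powr (1 + \<beta> / real Q)) * ennreal C"
      by (intro mult_left_mono bound r) auto
    moreover have "ennreal (?v powr (1 + \<beta> / real Q)) * (ennreal (?v powr (- 1 - \<beta> / real Q)) * ?I) = ?I"
      using v by (subst mult.assoc[symmetric], subst ennreal_mult'[symmetric]) (auto simp: powr_add[symmetric])
    moreover have "ennreal (?v powr (1 + \<beta> / real Q)) * ennreal C = ennreal (K * r powr \<beta> * ?v)"
    proof -
      have "?v powr (1 + \<beta> / real Q) = ?v * (c1 powr (\<beta> / real Q) * r powr \<beta>)"
        using v by (simp add: powr_add volume_powr[OF r])
      then show ?thesis using C by (simp add: ennreal_mult'[symmetric] K_def mult_ac)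
    qed
    ultimately show ?thesis by simp
  qed
  have osc_le: "osc b (B z r) \<le> 2 * K * r powr \<beta>" if "0 < r" for z r
    using sharp_osc_controls(1)[OF b that _ L1[OF that]] K by (simp add: mult.assoc)
  have neg: "\<bar>average b (B z r)\<bar> - average b (B z r) \<le> K * r powr \<beta>" if "0 < r" for z r
    using sharp_osc_controls(2)[OF b that _ L1[OF that]] K by simp
  obtain b' K' where avg: "\<And>z r. 0 < r \<Longrightarrow> \<bar>b' z - average b (B z r)\<bar> \<le> K' * r powr \<beta>"
    and lip: "\<And>x y. \<bar>b' x - b' y\<bar> \<le> K' * qd x y powr \<beta>" and ae: "AE x in lebesgue. b x = b' x"
    using campanato[OF b \<beta> osc_le] by blast
  show "b \<in> lipschitz_space G \<rho> \<beta>"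
    unfolding lipschitz_space_def using ae lip by (auto simp: qd_def)
  have "0 \<le> b' x" for x
  proof -
    have "(\<lambda>n. (K + 2 * K') * inverse (real (Suc n)) powr \<beta>) \<longlonglongrightarrow> 0"
      by (rule tendsto_inverse_powr[OF \<beta>])
    moreover have "\<bar>b' x\<bar> - b' x \<le> (K + 2 * K') * inverse (real (Suc n)) powr \<beta>" for n
    proof -
      define r where "r = inverse (real (Suc n))"
      have r: "0 < r" by (simp add: r_def)
      have "\<bar>b' x\<bar> - b' x \<le> K * r powr \<beta> + 2 * (K' * r powr \<beta>)"
        using avg[OF r, of x] neg[OF r, of x] by linarith
      then show ?thesis unfolding r_def[symmetric] by (simp add: algebra_simps)
    qed
    ultimately have "\<bar>b' x\<bar> - b' x \<le> 0" by (intro LIMSEQ_le_const) auto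
    then show ?thesis by simp
  qed
  then show "AE x in lebesgue. 0 \<le> b x" using ae by (auto elim!: eventually_mono)
qed

end

section \<open>The theorem\<close>

lemma (in stratified_group) ball_geometry_group_ball:
  assumes \<rho>: "homogeneous_norm G V m \<rho>"
  shows "\<exists>c0. ball_geometry G \<rho> (homogeneous_dim V m) c0 (measure lebesgue {y. \<rho> y < 1})"
proof -
  have nonneg: "0 \<le> \<rho> x" and zero: "\<rho> x = 0 \<longleftrightarrow> x = 0" for x
    using \<rho> by (auto simp: homogeneous_norm_def one_eq_0)
  obtain c0 where c0: "1 \<le> c0" "\<And>x y. \<rho> (x \<cdot> y) \<le> c0 * (\<rho> x + \<rho> y)"
    using \<rho> unfolding homogeneous_norm_def by blast
  have "ball_geometry G \<rho> (homogeneous_dim V m) c0 (measure lebesgue {y. \<rho> y < 1})"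
  proof
    fix x y z :: 'a and r :: real
    show "0 \<le> \<rho> (ginv y \<cdot> x)" by (rule nonneg)
    have "ginv y \<cdot> x = 0 \<longleftrightarrow> x = y"
    proof
      assume "ginv y \<cdot> x = 0"
      then have "y \<cdot> (ginv y \<cdot> x) = y" by simp
      then show "x = y" by (simp add: gmult_assoc[symmetric])
    qed simp
    then show "\<rho> (ginv y \<cdot> x) = 0 \<longleftrightarrow> x = y" by (simp add: zero)
    show "\<rho> (ginv y \<cdot> x) = \<rho> (ginv x \<cdot> y)" by (rule norm_inverse_mult[OF \<rho>])
    have "(ginv z \<cdot> y) \<cdot> (ginv y \<cdot> x) = ginv z \<cdot> (y \<cdot> ginv y) \<cdot> x"
      by (simp only: gmult_assoc)
    then have "ginv z \<cdot> x = (ginv z \<cdot> y) \<cdot> (ginv y \<cdot> x)" by simp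
    then show "\<rho> (ginv z \<cdot> x) \<le> c0 * (\<rho> (ginv y \<cdot> x) + \<rho> (ginv z \<cdot> y))"
      using c0(2)[of "ginv z \<cdot> y" "ginv y \<cdot> x"] by (simp add: add.commute)
    show "1 \<le> c0" by (rule c0)
    show "0 < measure lebesgue {y. \<rho> y < 1}" by (rule measure_norm_ball_pos[OF \<rho>])
    show "0 < homogeneous_dim V m" by (rule homogeneous_dim_pos)
    show "open (group_ball G \<rho> x r)" by (rule open_group_ball[OF \<rho>])
    show "bounded (group_ball G \<rho> x r)" by (rule bounded_group_ball[OF \<rho>])
    show "measure lebesgue (group_ball G \<rho> x r) = measure lebesgue {y. \<rho> y < 1} * r ^ homogeneous_dim V m"
      if "0 < r" by (rule measure_group_ball[OF \<rho> that])
  qed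
  then show ?thesis by blast
qed

theorem theorem4p5:
  fixes G :: "'a::euclidean_space monoid"
    and bracket :: "'a \<Rightarrow> 'a \<Rightarrow> 'a"
    and V :: "nat \<Rightarrow> 'a set"
    and m Q :: nat
    and \<rho> b :: "'a \<Rightarrow> real"
    and \<beta> :: real
    and \<Phi> \<Psi> :: "real \<Rightarrow> ennreal"
  assumes "stratified_group G bracket V m"
    and "homogeneous_norm G V m \<rho>"
    and "Q = homogeneous_dim V m"
    and "0 < \<beta>" and "\<beta> < 1"
    and "locally_integrable b"
    and "young_function \<Phi>" and "young_function \<Psi>"
    and "\<Phi> \<in> young_Y" and "nabla2 \<Phi>"
    and "\<exists>c>0. \<forall>t>0.
           young_inverse \<Psi> t \<le> c * (young_inverse \<Phi> t * t powr (- \<beta> / real Q)) \<and>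
           young_inverse \<Phi> t * t powr (- \<beta> / real Q) \<le> c * young_inverse \<Psi> t"
  defines "S1 \<equiv> b \<in> lipschitz_space G \<rho> \<beta> \<and> (AE x in lebesgue. 0 \<le> b x)"
    and "S2 \<equiv> sharp_commutator_bounded G \<rho> b \<Phi> \<Psi>"
    and "S3 \<equiv> \<exists>C>0. (SUP B\<in>group_balls G \<rho>.
           ennreal (measure lebesgue B powr (- \<beta> / real Q) *
                    young_inverse \<Psi> (1 / measure lebesgue B)) *
           orlicz_norm_on \<Psi> B (sharp_osc G \<rho> b B)) \<le> ennreal C"
    and "S4 \<equiv> \<exists>C>0. (SUP B\<in>group_balls G \<rho>.
           ennreal (measure lebesgue B powr (- 1 - \<beta> / real Q)) *
           (\<integral>\<^sup>+x\<in>B. ennreal \<bar>sharp_osc G \<rho> b B x\<bar> \<partial>lebesgue)) \<le> ennreal C"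
  shows "(S1 \<longleftrightarrow> S2) \<and> (S2 \<longleftrightarrow> S3) \<and> (S3 \<longleftrightarrow> S4)"
proof -
  obtain c0 where "ball_geometry G \<rho> Q c0 (measure lebesgue {y. \<rho> y < 1})"
    using stratified_group.ball_geometry_group_ball[OF assms(1,2)] assms(3) by blast
  then interpret ball_geometry G \<rho> Q c0 "measure lebesgue {y. \<rho> y < 1}" .
  note \<beta> = \<open>0 < \<beta>\<close> and b = \<open>locally_integrable b\<close>
    and Y = \<open>young_function \<Phi>\<close> \<open>young_function \<Psi>\<close> and \<Phi> = \<open>\<Phi> \<in> young_Y\<close> \<open>nabla2 \<Phi>\<close> and inv = assms(11)
  obtain c where c: "0 < c"
    and inv1: "\<And>t. 0 < t \<Longrightarrow> young_inverse \<Psi> t \<le> c * (young_inverse \<Phi> t * t powr (- \<beta> / real Q))"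
    and inv2: "\<And>t. 0 < t \<Longrightarrow> young_inverse \<Phi> t * t powr (- \<beta> / real Q) \<le> c * young_inverse \<Psi> t"
    using inv by blast
  have ball_SUP: "(SUP A\<in>group_balls G \<rho>. F A) \<le> X \<longleftrightarrow> (\<forall>z r. 0 < r \<longrightarrow> F (B z r) \<le> X)"
    for F :: "'a set \<Rightarrow> ennreal" and X
    by (auto simp: SUP_le_iff group_balls_def)
  have 12: "S2" if "S1"
    using that commutator_bounded[OF Y \<Phi> \<beta> c inv2 b] by (auto simp: S1_def S2_def)
  have 23: "S3" if "S2"
    using orlicz_osc_of_commutator[OF Y c inv1, of b] that unfolding S2_def S3_def ball_SUP by blast
  have 34: "S4" if s3: "S3"
  proof -
    obtain C where C: "0 < C" "\<forall>z r. 0 < r \<longrightarrow> ennreal (measure lebesgue (B z r) powr (- \<beta> / real Q) *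
        young_inverse \<Psi> (1 / measure lebesgue (B z r))) * orlicz_norm_on \<Psi> (B z r) (sharp_osc G \<rho> b (B z r)) \<le> ennreal C"
      using s3 unfolding S3_def ball_SUP by blast
    show ?thesis
      unfolding S4_def ball_SUP
    proof (intro exI[of _ "2 * C"] conjI allI impI)
      fix z and r :: real assume r: "0 < r"
      show "ennreal (measure lebesgue (B z r) powr (- 1 - \<beta> / real Q)) *
          (\<integral>\<^sup>+x\<in>B z r. ennreal \<bar>sharp_osc G \<rho> b (B z r) x\<bar> \<partial>lebesgue) \<le> ennreal (2 * C)"
        using C r by (intro L1_osc_of_orlicz_osc[OF Y(2) b]) auto
    qed (use C in simp)
  qed
  have 41: "S1" if s4: "S4"
  proof -
    obtain C where C: "0 < C" "\<And>z r. 0 < r \<Longrightarrow> ennreal (measure lebesgue (B z r) powr (- 1 - \<beta> / real Q)) *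
        (\<integral>\<^sup>+x\<in>B z r. ennreal \<bar>sharp_osc G \<rho> b (B z r) x\<bar> \<partial>lebesgue) \<le> ennreal C"
      using s4 unfolding S4_def ball_SUP by blast
    show ?thesis
      unfolding S1_def using lipschitz_of_L1_osc[OF b \<beta> C] by blast
  qed
  show ?thesis using 12 23 34 41 by blast
qed

end
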